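(* Let $\ell\ge 1$ be an integer and let $T$ be any (finite) tree. Then $$\operatorname{ex}_{\mathcal P}\big(n,T,\{C_4,C_6,\dots,C_{2\ell}\}\big)=\Theta\big(n^{\beta_\ell(T)}\big)\qquad (n\to\infty),$$ where the implied constants may depend on $T$ and $\ell$.
   Context: All graphs are finite and simple. $C_t$ denotes the cycle on $t$ vertices; the family $\{C_4,C_6,\dots,C_{2\ell}\}$ consists of all even cycles of length at least $4$ and at most $2\ell$ (it is empty when $\ell=1$). For a graph $H$ and a family $\mathcal F$ of graphs, $\operatorname{ex}_{\mathcal P}(n,H,\mathcal F)$ denotes the maximum number of copies of $H$ (subgraphs isomorphic to $H$, not necessarily induced) in an $n$-vertex planar graph that contains no member of $\mathcal F$ as a subgraph (not necessarily induced). The length of a path is its number of edges. For a graph $H$ and an integer $i\ge 1$, $\beta_i(H)$ denotes the maximum number of connected components in an induced subgraph of $H$ each of whose components is of one of the following two types: (1) an isolated vertex (of the induced subgraph) which has degree at most one in $H$; (2) a path of length $i-1$ (that is, with $i$ vertices) all of whose vertices have degree two in $H$. The notation $g(n)=\Theta(n^k)$ means that there are constants $c,C>0$ with $c\,n^k\le g(n)\le C\,n^k$ for all sufficiently large $n$. *)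

theory Defs
  imports "HOL-Analysis.Analysis" "HOL-Library.Landau_Symbols"
begin

section \<open>Finite simple graphs\<close>

type_synonym 'a graph = "'a set \<times> 'a set set"

abbreviation verts :: "'a graph \<Rightarrow> 'a set" where "verts \<equiv> fst"
abbreviation edges :: "'a graph \<Rightarrow> 'a set set" where "edges \<equiv> snd"

definition simple_graph :: "'a graph \<Rightarrow> bool" where
  "simple_graph G \<longleftrightarrow> finite (verts G) \<and> (\<forall>e\<in>edges G. e \<subseteq> verts G \<and> card e = 2)"

definition subgraph :: "'a graph \<Rightarrow> 'a graph \<Rightarrow> bool" where
  "subgraph H G \<longleftrightarrow> simple_graph H \<and> verts H \<subseteq> verts G \<and> edges H \<subseteq> edges G"

definition induced :: "'a graph \<Rightarrow> 'a set \<Rightarrow> 'a graph" where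
  "induced G S = (S, {e \<in> edges G. e \<subseteq> S})"

definition iso :: "'a graph \<Rightarrow> 'b graph \<Rightarrow> bool" where
  "iso G H \<longleftrightarrow> (\<exists>f. bij_betw f (verts G) (verts H) \<and> (\<lambda>e. f ` e) ` edges G = edges H)"

definition degree :: "'a graph \<Rightarrow> 'a \<Rightarrow> nat" where
  "degree G v = card {e \<in> edges G. v \<in> e}"

definition adj :: "'a graph \<Rightarrow> ('a \<times> 'a) set" where
  "adj G = {(u, v). {u, v} \<in> edges G}"

definition connected_graph :: "'a graph \<Rightarrow> bool" where
  "connected_graph G \<longleftrightarrow> verts G \<noteq> {} \<and> (\<forall>u\<in>verts G. \<forall>v\<in>verts G. (u, v) \<in> (adj G)\<^sup>*)"

text \<open>Connected components are represented by their vertex sets.\<close>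

definition components :: "'a graph \<Rightarrow> 'a set set" where
  "components G = {{v. (u, v) \<in> (adj G)\<^sup>*} | u. u \<in> verts G}"

text \<open>The following two are only used for \<open>t \<ge> 3\<close> and \<open>k \<ge> 1\<close>, respectively;
  \<open>path_graph k\<close> has \<open>k\<close> vertices, i.e. length \<open>k - 1\<close>.\<close>

definition cycle_graph :: "nat \<Rightarrow> nat graph" where
  "cycle_graph t = ({..<t}, {{i, Suc i mod t} | i. i < t})"

definition path_graph :: "nat \<Rightarrow> nat graph" where
  "path_graph k = ({..<k}, {{i, Suc i} | i. Suc i < k})"

text \<open>Copies are counted as subgraphs, not as embeddings.\<close>

definition copies :: "'a graph \<Rightarrow> 'b graph \<Rightarrow> 'b graph set" where
  "copies H G = {H'. subgraph H' G \<and> iso H H'}"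

definition tree :: "'a graph \<Rightarrow> bool" where
  "tree T \<longleftrightarrow> simple_graph T \<and> connected_graph T \<and> (\<forall>t\<ge>3. copies (cycle_graph t) T = {})"


section \<open>Planarity\<close>

text \<open>A drawing places the vertices at distinct points \<open>p v\<close> of the plane (here \<^typ>\<open>complex\<close>,
  as in the library's Jordan curve theorem) and each edge \<open>e\<close> along an arc \<open>\<gamma> e\<close> joining its
  ends. An arc passes through no vertex other than its ends, and two distinct arcs meet at most
  in a common end.\<close>

definition plane_drawing ::
    "'a graph \<Rightarrow> ('a \<Rightarrow> complex) \<Rightarrow> ('a set \<Rightarrow> real \<Rightarrow> complex) \<Rightarrow> bool" where
  "plane_drawing G p \<gamma> \<longleftrightarrow>
     inj_on p (verts G) \<and>
     (\<forall>e\<in>edges G. arc (\<gamma> e) \<and> {pathstart (\<gamma> e), pathfinish (\<gamma> e)} = p ` e \<and>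
        path_image (\<gamma> e) \<inter> p ` verts G \<subseteq> p ` e) \<and>
     (\<forall>e\<in>edges G. \<forall>e'\<in>edges G. e \<noteq> e' \<longrightarrow>
        path_image (\<gamma> e) \<inter> path_image (\<gamma> e') \<subseteq> p ` (e \<inter> e'))"

definition planar :: "'a graph \<Rightarrow> bool" where
  "planar G \<longleftrightarrow> (\<exists>p \<gamma>. plane_drawing G p \<gamma>)"


section \<open>Generalized planar Turan numbers\<close>

text \<open>Up to isomorphism every finite graph has its vertices in \<^typ>\<open>nat\<close>. The set below is
  nonempty unless \<open>F\<close> forbids all \<open>n\<close>-vertex planar graphs; it is finite since the number of
  subgraphs of an \<open>n\<close>-vertex graph is bounded in terms of \<open>n\<close>.\<close>

definition ex_planar :: "nat \<Rightarrow> 'a graph \<Rightarrow> 'b graph set \<Rightarrow> nat" where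
  "ex_planar n H F = Max {card (copies H G) | G :: nat graph.
     simple_graph G \<and> card (verts G) = n \<and> planar G \<and> (\<forall>K\<in>F. copies K G = {})}"

definition even_cycles :: "nat \<Rightarrow> nat graph set" where
  "even_cycles l = {cycle_graph (2 * i) | i. 2 \<le> i \<and> i \<le> l}"


section \<open>The exponent\<close>

text \<open>\<open>C\<close> is a component of an induced subgraph of \<open>H\<close>, so the subgraph it spans there is
  \<open>induced H C\<close>.\<close>

definition admissible_component :: "nat \<Rightarrow> 'a graph \<Rightarrow> 'a set \<Rightarrow> bool" where
  "admissible_component i H C \<longleftrightarrow>
     (\<exists>v. C = {v} \<and> degree H v \<le> 1) \<or>
     (iso (path_graph i) (induced H C) \<and> (\<forall>v\<in>C. degree H v = 2))"

definition beta :: "nat \<Rightarrow> 'a graph \<Rightarrow> nat" where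
  "beta i H = Max {card (components (induced H S)) | S.
     S \<subseteq> verts H \<and> (\<forall>C\<in>components (induced H S). admissible_component i H C)}"

end

theory Submission
  imports Defs
begin

text \<open>
  Upper bound. For a set of homomorphisms from \<open>T\<close> to \<open>G\<close>, direct an edge \<open>uv\<close> of \<open>T\<close> from \<open>u\<close> to \<open>v\<close>
  if the image of \<open>u\<close> determines that of \<open>v\<close>. A homomorphism is given by one value in each source
  component of this digraph. Split the set into boundedly many classes whenever this
  directs further edges. Sparsity of \<open>G\<close> and of its minors makes this possible if an edge is not
  directed, if a source component has three neighbours, and if it is a path of fewer than \<open>l\<close>
  vertices of degree two: as \<open>G\<close> has no short even cycle, the images of such a path are then
  contracted edges with distinct pairs of ends. When no further split is possible, each source
  component contains a leaf or a path of \<open>l\<close> vertices of degree two, so that there are at most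
  \<open>beta l T\<close> of them.

  The only property of planar graphs that enters is the absence of three disjoint connected sets
  with three common neighbours, which follows from Janiszewski's theorem; sparsity follows from it
  by a contraction argument due to Mader.

  Lower bound. Replace each component of an optimal set by about \<open>n / card (verts T)\<close> parallel copies.
\<close>

section \<open>Connected vertex sets and Mader's contraction argument\<close>

text \<open>A split rests on orientation: in a sparse family of bounded sets, every set can choose
  one of its elements so that no element is chosen too often (\<open>bounded_choice\<close>). The
  class of a homomorphism records the colour of the chosen element and a label; within a class that
  element determines the whole set, which yields a new arc. The number of darts of \<open>T\<close>
  bounds the number of rounds, so the factor lost depends on \<open>T\<close> alone. The obstacle is
  a source component with only two neighbours: in the planar graph K_{2,m} one pair carries
  arbitrarily many disjoint connected sets, so only distinct pairs can be counted. Triples may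
  coincide, but at most twice, since three equal ones form a K_{3,3}. Constants: Mader's argument
  runs three times with thresholds 8, 4, 2, so there are at most 8 edges per vertex; hence outdegree
  \<open>17 = 2 * 8 + 1\<close>, then \<open>586 = 8 + 2 * 17 ^ 2\<close> for triples and
  \<open>5277 = Suc (3 * 586) * 3\<close> classes. In the lower bound, every cycle contains two
  copies of one path with \<open>l\<close> vertices and a further vertex, so it is longer than
  \<open>2 * l\<close>.\<close>

definition sconn :: "('b \<Rightarrow> 'b \<Rightarrow> bool) \<Rightarrow> 'b set \<Rightarrow> bool" where
  "sconn R B \<longleftrightarrow> B \<noteq> {} \<and> (\<forall>x\<in>B. \<forall>y\<in>B. (\<lambda>a b. a \<in> B \<and> b \<in> B \<and> R a b)\<^sup>*\<^sup>* x y)"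

definition dg :: "('b \<Rightarrow> 'b \<Rightarrow> bool) \<Rightarrow> 'b set \<Rightarrow> 'b \<Rightarrow> nat" where
  "dg R V x = card {y \<in> V. R x y}"

definition e2 :: "('b \<Rightarrow> 'b \<Rightarrow> bool) \<Rightarrow> 'b set \<Rightarrow> nat" where
  "e2 R V = (\<Sum>x\<in>V. dg R V x)"

definition touches :: "('b \<Rightarrow> 'b \<Rightarrow> bool) \<Rightarrow> 'b set \<Rightarrow> 'b \<Rightarrow> bool" where
  "touches R B x \<longleftrightarrow> (\<exists>b\<in>B. R b x)"

text \<open>Excludes a K_{3,3} minor whose branch sets on one side are single vertices. Mader's
  argument produces this form, and in a drawing the single vertices are the tips of tripods. It is
  stated for relations so that it also applies to the contracted graphs of
  \<open>k33_free_contract\<close>.\<close>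

definition k33_free :: "('b \<Rightarrow> 'b \<Rightarrow> bool) \<Rightarrow> bool" where
  "k33_free R \<longleftrightarrow> \<not> (\<exists>B1 B2 B3 x1 x2 x3. sconn R B1 \<and> sconn R B2 \<and> sconn R B3 \<and>
     B1 \<inter> B2 = {} \<and> B1 \<inter> B3 = {} \<and> B2 \<inter> B3 = {} \<and> distinct [x1, x2, x3] \<and>
     {x1, x2, x3} \<inter> (B1 \<union> B2 \<union> B3) = {} \<and>
     (\<forall>x\<in>{x1, x2, x3}. touches R B1 x \<and> touches R B2 x \<and> touches R B3 x))"

lemma sconn_singleton: "sconn R {v}"
  by (auto simp: sconn_def)

lemma sconn_nonempty: "sconn R B \<Longrightarrow> B \<noteq> {}"
  by (simp add: sconn_def)

lemma sconn_rootI: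
  assumes "symp R" "r \<in> B" and r: "\<And>x. x \<in> B \<Longrightarrow> (\<lambda>a b. a \<in> B \<and> b \<in> B \<and> R a b)\<^sup>*\<^sup>* r x"
  shows "sconn R B"
proof -
  let ?r = "\<lambda>a b. a \<in> B \<and> b \<in> B \<and> R a b"
  have "symp ?r" using assms(1) by (auto simp: symp_def)
  hence "symp ?r\<^sup>*\<^sup>*" by (rule symp_rtranclp)
  hence "?r\<^sup>*\<^sup>* x r" if "x \<in> B" for x using r[OF that] by (auto dest: sympD)
  thus ?thesis using assms(2) r unfolding sconn_def by (blast intro: rtranclp_trans)
qed

lemma sconn_insert:
  assumes "symp R" "sconn R B" "touches R B x"
  shows "sconn R (insert x B)"
proof -
  obtain b where b: "b \<in> B" "R b x" using assms(3) by (auto simp: touches_def)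
  let ?r = "\<lambda>a c. a \<in> insert x B \<and> c \<in> insert x B \<and> R a c"
  have "?r\<^sup>*\<^sup>* b y" if "y \<in> insert x B" for y
  proof (cases "y \<in> B")
    case True
    have "(\<lambda>a c. a \<in> B \<and> c \<in> B \<and> R a c)\<^sup>*\<^sup>* b y" using assms(2) b True by (auto simp: sconn_def)
    thus ?thesis by (rule rtranclp_mono[THEN predicate2D, rotated]) auto
  next
    case False
    hence "y = x" using that by auto
    thus ?thesis using b by auto
  qed
  thus ?thesis using b assms(1) by (intro sconn_rootI[where r = b]) auto
qed

lemma sconn_cut:
  assumes "sconn R B" "X \<subseteq> B" "X \<noteq> {}" "X \<noteq> B"
  obtains x y where "x \<in> X" "y \<in> B - X" "R x y"
proof (rule ccontr)
  assume "\<not> thesis"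
  hence no: "\<And>x y. x \<in> X \<Longrightarrow> y \<in> B - X \<Longrightarrow> \<not> R x y" using that by blast
  obtain x y where xy: "x \<in> X" "y \<in> B - X" using assms by blast
  have "(\<lambda>a c. a \<in> B \<and> c \<in> B \<and> R a c)\<^sup>*\<^sup>* x y" using assms(1,2) xy by (auto simp: sconn_def)
  hence "y \<in> X" by (induction rule: rtranclp_induct) (use xy no in auto)
  thus False using xy by auto
qed

lemma dg_split: "finite V \<Longrightarrow> dg R V x = dg R (V \<inter> X) x + dg R (V - X) x"
  unfolding dg_def by (subst card_Un_disjoint[symmetric]) (auto intro!: arg_cong[where f = card])

lemma e2_remove:
  assumes "finite V" "x \<in> V" "symp R" "irreflp R"
  shows "e2 R V = e2 R (V - {x}) + 2 * dg R V x"
proof -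
  have "dg R V y = dg R (V - {x}) y + (if R x y then 1 else 0)" for y
  proof -
    have "{z \<in> V \<inter> {x}. R y z} = (if R x y then {x} else {})"
      using assms by (auto dest: sympD)
    hence "dg R (V \<inter> {x}) y = (if R x y then 1 else 0)" by (auto simp: dg_def)
    thus ?thesis using dg_split[OF assms(1), of R y "{x}"] by simp
  qed
  hence "(\<Sum>y\<in>V - {x}. dg R V y) = e2 R (V - {x}) + (\<Sum>y\<in>V - {x}. if R x y then 1 else 0)"
    by (simp add: e2_def sum.distrib)
  also have "(\<Sum>y\<in>V - {x}. if R x y then 1 else 0) = card {y \<in> V - {x}. R x y}"
    using assms(1) by (simp add: sum.If_cases Int_def)
  also have "{y \<in> V - {x}. R x y} = {y \<in> V. R x y}" using assms(4) by (auto simp: irreflp_def)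
  finally have "(\<Sum>y\<in>V - {x}. dg R V y) = e2 R (V - {x}) + dg R V x" by (simp add: dg_def)
  thus ?thesis using assms(1,2) by (simp add: e2_def sum.remove)
qed

text \<open>Contracting a connected set \<open>B\<close> of the graph on \<open>V\<close> leaves \<open>card (V - B) + 1\<close> vertices and
  the edges of \<open>V - B\<close> together with one edge for each neighbour of \<open>B\<close>. If \<open>B\<close> is maximal
  such that the contraction is still dense, absorbing a neighbour \<open>x\<close> loses many edges,
  hence \<open>x\<close> and \<open>B\<close> have many common neighbours.\<close>

lemma dense_neighbourhood:
  assumes "finite V" "V \<noteq> {}" "symp R" "irreflp R" "2 * c * card V \<le> e2 R V" "1 \<le> c"
  shows "\<exists>B N. B \<subseteq> V \<and> N \<subseteq> V \<and> B \<inter> N = {} \<and> sconn R B \<and> N \<noteq> {} \<and>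
           (\<forall>x\<in>N. touches R B x \<and> c \<le> dg R N x)"
  using assms
proof (induction "card V" arbitrary: V rule: less_induct)
  case less
  define nb where "nb B = {x \<in> V - B. touches R B x}" for B
  define P where "P B \<longleftrightarrow> B \<subseteq> V \<and> sconn R B \<and>
     2 * c * (card (V - B) + 1) \<le> e2 R (V - B) + 2 * card (nb B)" for B
  obtain v where v: "v \<in> V" using less.prems by auto
  have "nb {v} = {y \<in> V. R v y}" using less.prems(4) by (auto simp: nb_def touches_def irreflp_def)
  hence "e2 R (V - {v}) + 2 * card (nb {v}) = e2 R V"
    using e2_remove[OF less.prems(1) v less.prems(3,4)] by (simp add: dg_def)
  moreover have "card (V - {v}) + 1 = card V" using v less.prems(1)
    by (metis card_Suc_Diff1 Suc_eq_plus1)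
  ultimately have Pv: "P {v}" using v less.prems(5) by (auto simp: P_def sconn_singleton)
  have "\<forall>B. P B \<longrightarrow> card B < Suc (card V)" using less.prems(1) by (auto simp: P_def card_mono less_Suc_eq_le)
  from ex_has_greatest_nat[OF Pv this]
  obtain B where B: "P B" and Bmax: "\<And>B'. P B' \<Longrightarrow> card B' \<le> card B" by blast
  have fB: "finite B" "B \<subseteq> V" "sconn R B" using B less.prems(1) finite_subset by (auto simp: P_def)
  show ?case
  proof (cases "nb B = {}")
    \<comment> \<open>\<open>B\<close> is an isolated vertex of the contraction, so
      \<open>V - B\<close> alone is still dense, and it is smaller.\<close>
    case True
    hence d: "2 * c * (card (V - B) + 1) \<le> e2 R (V - B)" using B by (simp add: P_def)
    hence ne: "V - B \<noteq> {}" using d less.prems(6) by (intro notI) (simp add: e2_def)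
    have "V - B \<subset> V" using fB sconn_nonempty by blast
    hence "card (V - B) < card V" using less.prems(1) by (simp add: psubset_card_mono)
    from less.hyps[OF this _ ne less.prems(3,4) _ less.prems(6)]
    obtain B' N where "B' \<subseteq> V - B \<and> N \<subseteq> V - B \<and> B' \<inter> N = {} \<and> sconn R B' \<and> N \<noteq> {} \<and>
           (\<forall>x\<in>N. touches R B' x \<and> c \<le> dg R N x)"
      using d less.prems(1) by auto
    thus ?thesis by (intro exI[of _ B'] exI[of _ N]) auto
  next
    case False
    have "c \<le> dg R (nb B) x" if x: "x \<in> nb B" for x
    proof -
      define W where "W = V - B"
      have W: "finite W" "x \<in> W" "nb B \<subseteq> W" using less.prems(1) x by (auto simp: W_def nb_def)
      have VB: "V - insert x B = W - {x}" by (auto simp: W_def)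
      have "sconn R (insert x B)" using x by (intro sconn_insert less.prems fB) (auto simp: nb_def)
      moreover have "insert x B \<subseteq> V" using x fB by (auto simp: nb_def)
      moreover have "\<not> P (insert x B)"
        using Bmax[of "insert x B"] x fB by (auto simp: nb_def)
      ultimately have "e2 R (W - {x}) + 2 * card (nb (insert x B)) < 2 * c * (card (W - {x}) + 1)"
        by (auto simp: P_def VB)
      moreover have cW: "card (W - {x}) + 1 = card W" using W by (metis card_Suc_Diff1 Suc_eq_plus1)
      ultimately have 1: "e2 R (W - {x}) + 2 * card (nb (insert x B)) < 2 * c * card W" unfolding cW by blast
      have 2: "2 * c * card W + 2 * c \<le> e2 R W + 2 * card (nb B)"
        using B unfolding P_def W_def[symmetric] by simp
      have 3: "e2 R W = e2 R (W - {x}) + 2 * dg R W x" by (rule e2_remove) (use W less.prems in auto)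
      have eq: "nb (insert x B) = (nb B - {x}) \<union> {y \<in> W - nb B. R x y}"
        using less.prems(4) x by (auto simp: nb_def W_def touches_def irreflp_def)
      have "card (nb (insert x B)) = card (nb B - {x}) + dg R (W - nb B) x"
        unfolding eq dg_def by (rule card_Un_disjoint) (use W finite_subset in auto)
      moreover have "card (nb B - {x}) + 1 = card (nb B)"
        using x W finite_subset by (metis card_Suc_Diff1 Suc_eq_plus1)
      ultimately have 4: "card (nb (insert x B)) + 1 = card (nb B) + dg R (W - nb B) x" by simp
      \<comment> \<open>Absorbing \<open>x\<close> costs its edges in \<open>W\<close> and the edge
        to \<open>B\<close>, but its edges to \<open>W - nb B\<close> survive as edges of
        \<open>B\<close>. By 1 and 2 the cost exceeds \<open>c\<close>, so at least \<open>c\<close>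
        edges go to \<open>nb B\<close>.\<close>
      have "dg R W x = dg R (nb B) x + dg R (W - nb B) x"
        using dg_split[OF W(1), of R x "nb B"] W(3) by (simp add: Int_absorb1)
      thus ?thesis using 1 2 3 4 by simp
    qed
    thus ?thesis using fB False by (intro exI[of _ B] exI[of _ "nb B"]) (auto simp: nb_def)
  qed
qed

lemma e2_ge: "finite V \<Longrightarrow> (\<And>x. x \<in> V \<Longrightarrow> c \<le> dg R V x) \<Longrightarrow> c * card V \<le> e2 R V"
  using sum_bounded_below[of V c "dg R V"] by (simp add: e2_def mult.commute)

lemma touches_mono: "touches R B x \<Longrightarrow> B \<subseteq> B' \<Longrightarrow> touches R B' x"
  by (auto simp: touches_def)

text \<open>Each of three nested rounds yields a connected set that touches every vertex of the
  next, smaller set; the minimum degree there is 8, then 4, then 2. The last bound provides three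
  vertices of \<open>N3\<close>, which touch \<open>B1\<close>, \<open>B2\<close> and
  \<open>B3\<close>.\<close>

lemma k33_free_e2:
  assumes "k33_free R" "symp R" "irreflp R" "finite V" "V \<noteq> {}"
  shows "e2 R V < 16 * card V"
proof (rule ccontr)
  assume "\<not> ?thesis"
  hence "2 * 8 * card V \<le> e2 R V" by simp
  from dense_neighbourhood[OF assms(4,5,2,3) this one_le_numeral] obtain B1 N1 where
    1: "B1 \<subseteq> V" "N1 \<subseteq> V" "B1 \<inter> N1 = {}" "sconn R B1" "N1 \<noteq> {}"
       "\<And>x. x \<in> N1 \<Longrightarrow> touches R B1 x" "\<And>x. x \<in> N1 \<Longrightarrow> 8 \<le> dg R N1 x" by blast
  have f1: "finite N1" by (rule finite_subset[OF 1(2) assms(4)])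
  have "2 * 4 * card N1 \<le> e2 R N1" using e2_ge[OF f1, of 8 R] 1 by simp
  from dense_neighbourhood[OF f1 1(5) assms(2,3) this one_le_numeral] obtain B2 N2 where
    2: "B2 \<subseteq> N1" "N2 \<subseteq> N1" "B2 \<inter> N2 = {}" "sconn R B2" "N2 \<noteq> {}"
       "\<And>x. x \<in> N2 \<Longrightarrow> touches R B2 x" "\<And>x. x \<in> N2 \<Longrightarrow> 4 \<le> dg R N2 x" by blast
  have f2: "finite N2" by (rule finite_subset[OF 2(2) f1])
  have "2 * 2 * card N2 \<le> e2 R N2" using e2_ge[OF f2, of 4 R] 2 by simp
  from dense_neighbourhood[OF f2 2(5) assms(2,3) this one_le_numeral] obtain B3 N3 where
    3: "B3 \<subseteq> N2" "N3 \<subseteq> N2" "B3 \<inter> N3 = {}" "sconn R B3" "N3 \<noteq> {}"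
       "\<And>x. x \<in> N3 \<Longrightarrow> touches R B3 x" "\<And>x. x \<in> N3 \<Longrightarrow> 2 \<le> dg R N3 x" by blast
  obtain x1 where x1: "x1 \<in> N3" using 3 by auto
  have "\<exists>x2 x3. {x2, x3} \<subseteq> {y \<in> N3. R x1 y} \<and> x2 \<noteq> x3"
  proof (rule ccontr)
    assume "\<nexists>x2 x3. {x2, x3} \<subseteq> {y \<in> N3. R x1 y} \<and> x2 \<noteq> x3"
    hence "card {y \<in> N3. R x1 y} \<le> Suc 0"
      using f2 3(2) finite_subset[of N3 N2] by (subst card_le_Suc0_iff_eq) auto
    thus False using 3(7)[OF x1] by (simp add: dg_def)
  qed
  then obtain x2 x3 where "x2 \<in> N3" "x3 \<in> N3" "R x1 x2" "R x1 x3" "x2 \<noteq> x3" by auto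
  hence x: "distinct [x1, x2, x3]" "{x1, x2, x3} \<subseteq> N3"
    using x1 assms(3) by (auto simp: irreflp_def)
  have s: "N3 \<subseteq> N1" "N3 \<subseteq> N2" "B3 \<subseteq> N1" "B3 \<subseteq> N2" "B2 \<subseteq> N1" using 2 3 by auto
  have t: "\<forall>x\<in>{x1, x2, x3}. touches R B1 x \<and> touches R B2 x \<and> touches R B3 x"
  proof
    fix x assume "x \<in> {x1, x2, x3}"
    hence "x \<in> N3" using x by blast
    hence "x \<in> N1 \<and> x \<in> N2 \<and> x \<in> N3" using 2(2) 3(2) by blast
    thus "touches R B1 x \<and> touches R B2 x \<and> touches R B3 x" using 1(6) 2(6) 3(6) by blast
  qed
  show False
    using assms(1) unfolding k33_free_def
    apply (rule notE)
    apply (rule exI[of _ B1], rule exI[of _ B2], rule exI[of _ B3])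
    apply (rule exI[of _ x1], rule exI[of _ x2], rule exI[of _ x3])
    apply (intro conjI 1(4) 2(4) 3(4) x(1) t)
    using 1(3) 2(3) 3(3) x(2) s by auto
qed

section \<open>Disjoint connected sets with few attachments\<close>

text \<open>\<open>A i\<close> stands for an edge of a minor: it is contracted onto an end of its pair \<open>g i\<close>.\<close>

lemma k33_free_contract:
  assumes k: "k33_free R" and R: "symp R"
    and conn: "\<And>i. i \<in> I \<Longrightarrow> sconn R (A i)"
    and disj: "\<And>i j. i \<in> I \<Longrightarrow> j \<in> I \<Longrightarrow> i \<noteq> j \<Longrightarrow> A i \<inter> A j = {}"
    and AN: "\<And>i j. i \<in> I \<Longrightarrow> j \<in> I \<Longrightarrow> A i \<inter> g j = {}"
    and adj: "\<And>i x. i \<in> I \<Longrightarrow> x \<in> g i \<Longrightarrow> touches R (A i) x"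
  shows "k33_free (\<lambda>x y. x \<noteq> y \<and> (\<exists>i\<in>I. g i = {x, y}))" (is "k33_free ?H")
  unfolding k33_free_def
proof (rule notI, elim exE conjE)
  fix B1 B2 B3 x1 x2 x3
  assume B: "sconn ?H B1" "sconn ?H B2" "sconn ?H B3" "B1 \<inter> B2 = {}" "B1 \<inter> B3 = {}" "B2 \<inter> B3 = {}"
    and x: "distinct [x1, x2, x3]" "{x1, x2, x3} \<inter> (B1 \<union> B2 \<union> B3) = {}"
    and t: "\<forall>x\<in>{x1, x2, x3}. touches ?H B1 x \<and> touches ?H B2 x \<and> touches ?H B3 x"
  define X where "X = {x1, x2, x3}"
  \<comment> \<open>\<open>A i\<close> joins the branch set of \<open>B\<close> if its pair lies in
    \<open>B \<union> X\<close> and meets \<open>B\<close>. Such a pair misses the other branch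
    sets, so no \<open>A i\<close> is used twice; pairs inside \<open>X\<close> go nowhere.\<close>
  define J where "J B = {i \<in> I. g i \<subseteq> B \<union> X \<and> g i \<inter> B \<noteq> {}}" for B
  define E where "E B = B \<union> (\<Union>i\<in>J B. A i)" for B
  \<comment> \<open>\<open>AN\<close> only speaks of vertices in pairs. Every vertex of
    \<open>B\<close> is one: it is the chosen neighbour of \<open>x1\<close> or has a neighbour in
    \<open>B\<close>.\<close>
  have nogB: "A i \<inter> B = {}" if "i \<in> I" "B \<in> {B1, B2, B3}" for i B
  proof -
    have "B \<subseteq> (\<Union>j\<in>I. g j)"
    proof
      fix b assume b: "b \<in> B"
      have "sconn ?H B" "touches ?H B x1" using that B t by auto
      then obtain y where y: "y \<in> B" "?H y x1" by (auto simp: touches_def)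
      show "b \<in> (\<Union>j\<in>I. g j)"
      proof (cases "b = y")
        case False
        obtain x' y' where "x' \<in> {b}" "y' \<in> B - {b}" "?H x' y'"
          using sconn_cut[OF \<open>sconn ?H B\<close>, of "{b}"] b y False by (metis empty_not_insert insert_subset
              empty_subsetI singletonD)
        thus ?thesis by auto
      qed (use y in auto)
    qed
    thus ?thesis using AN[OF that(1)] by blast
  qed
  have noX: "A i \<inter> X = {}" if i: "i \<in> I" for i
  proof -
    have "X \<subseteq> (\<Union>j\<in>I. g j)" 
    proof
      fix x assume "x \<in> X"
      hence "touches ?H B1 x" using t by (auto simp: X_def)
      then obtain y j where "j \<in> I" "g j = {y, x}" by (auto simp: touches_def)
      thus "x \<in> (\<Union>j\<in>I. g j)" by blast
    qed
    thus ?thesis using AN[OF i] by blast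
  qed
  have connE: "sconn R (E B)" if "sconn ?H B" for B
  proof -
    let ?r = "\<lambda>a b. a \<in> E B \<and> b \<in> E B \<and> R a b"
    have inA: "?r\<^sup>*\<^sup>* u w" if "i \<in> J B" "u \<in> A i" "w \<in> A i" for i u w
    proof -
      have "(\<lambda>a b. a \<in> A i \<and> b \<in> A i \<and> R a b)\<^sup>*\<^sup>* u w"
        using conn that by (auto simp: sconn_def J_def)
      thus ?thesis by (rule rtranclp_mono[THEN predicate2D, rotated]) (use that in \<open>auto simp: E_def\<close>)
    qed
    have toA: "?r\<^sup>*\<^sup>* u w" "?r\<^sup>*\<^sup>* w u" if i: "i \<in> J B" "u \<in> A i" "w \<in> g i \<inter> B" for i u w
    proof -
      obtain z where z: "z \<in> A i" "R z w" using adj[of i w] i by (auto simp: touches_def J_def)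
      hence "?r z w" "?r w z" using i R by (auto simp: E_def dest: sympD)
      thus "?r\<^sup>*\<^sup>* u w" "?r\<^sup>*\<^sup>* w u"
        using rtranclp.rtrancl_into_rtrancl[OF inA[OF i(1,2) z(1)], of w]
          converse_rtranclp_into_rtranclp[OF _ inA[OF i(1) z(1) i(2)], of w] by auto
    qed
    have inB: "?r\<^sup>*\<^sup>* u w" if "u \<in> B" "w \<in> B" for u w
    proof -
      have "(\<lambda>a b. a \<in> B \<and> b \<in> B \<and> ?H a b)\<^sup>*\<^sup>* u w" using \<open>sconn ?H B\<close> that by (auto simp: sconn_def)
      thus ?thesis
      proof (induction rule: rtranclp_induct)
        case (step y z)
        then obtain i where i: "i \<in> I" "g i = {y, z}" by auto
        hence "i \<in> J B" using step by (auto simp: J_def)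
        moreover obtain u where "u \<in> A i" using conn[OF i(1)] by (auto simp: sconn_def)
        ultimately have "?r\<^sup>*\<^sup>* y z" using toA[of i u] i step by (auto intro: rtranclp_trans)
        thus ?case using step by (auto intro: rtranclp_trans)
      qed auto
    qed
    obtain r where r: "r \<in> B" using \<open>sconn ?H B\<close> by (auto simp: sconn_def)
    have "?r\<^sup>*\<^sup>* r w" if "w \<in> E B" for w
    proof (cases "w \<in> B")
      case False
      then obtain i where i: "i \<in> J B" "w \<in> A i" using \<open>w \<in> E B\<close> unfolding E_def by blast
      then obtain b where "b \<in> g i \<inter> B" by (auto simp: J_def)
      thus ?thesis using toA(2)[OF i, of b] inB[OF r, of b] by (auto intro: rtranclp_trans)
    qed (use inB r in auto)
    thus ?thesis by (rule sconn_rootI[OF R, rotated]) (use r in \<open>auto simp: E_def\<close>)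
  qed
  have disE: "E B \<inter> E B' = {}" if "B \<in> {B1, B2, B3}" "B' \<in> {B1, B2, B3}" "B \<inter> B' = {}" "X \<inter> B' = {}" for B B'
  proof -
    have "J B \<inter> J B' = {}" using that by (auto simp: J_def)
    hence "A i \<inter> A j = {}" if "i \<in> J B" "j \<in> J B'" for i j
      using disj[of i j] that by (auto simp: J_def)
    hence "(\<Union>i\<in>J B. A i) \<inter> (\<Union>i\<in>J B'. A i) = {}" by blast
    moreover have "(\<Union>i\<in>J B. A i) \<inter> B' = {}" "(\<Union>i\<in>J B'. A i) \<inter> B = {}"
      using nogB that by (auto simp: J_def)
    ultimately show ?thesis using that(3) by (auto simp: E_def)
  qed
  have XE: "X \<inter> E B = {}" if "B \<in> {B1, B2, B3}" for B
    using that x noX by (auto simp: E_def X_def J_def)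
  have tE: "touches R (E B) y" if ty: "touches ?H B y" "y \<in> X" for B y
  proof -
    obtain b i where i: "b \<in> B" "i \<in> I" "g i = {b, y}" using ty by (auto simp: touches_def)
    hence "i \<in> J B" using ty by (auto simp: J_def)
    thus ?thesis using adj[of i y] i by (auto simp: E_def intro: touches_mono)
  qed
  show False
    using k unfolding k33_free_def
    apply (rule notE)
    apply (rule exI[of _ "E B1"], rule exI[of _ "E B2"], rule exI[of _ "E B3"])
    apply (rule exI[of _ x1], rule exI[of _ x2], rule exI[of _ x3])
    apply (intro conjI connE B disE x(1))
    using x B t XE[of B1] XE[of B2] XE[of B3] tE by (auto simp: X_def)
qed

lemma card_pairs_le_e2:
  assumes I: "finite I" and N: "finite N"
    and g: "\<And>i. i \<in> I \<Longrightarrow> g i \<subseteq> N \<and> card (g i) = 2" "inj_on g I"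
    and H: "\<And>i x y. i \<in> I \<Longrightarrow> g i = {x, y} \<Longrightarrow> x \<noteq> y \<Longrightarrow> H x y"
  shows "2 * card I \<le> e2 H N"
proof -
  let ?P = "\<lambda>i. {(x, y). x \<noteq> y \<and> g i = {x, y}}"
  have "(\<Union>i\<in>I. ?P i) \<subseteq> (SIGMA x:N. {y \<in> N. H x y})"
  proof
    fix z assume "z \<in> (\<Union>i\<in>I. ?P i)"
    then obtain i x y where z: "i \<in> I" "z = (x, y)" "x \<noteq> y" "g i = {x, y}" by auto
    thus "z \<in> (SIGMA x:N. {y \<in> N. H x y})" using g(1)[OF z(1)] H[OF z(1,4,3)] by auto
  qed
  hence "card (\<Union>i\<in>I. ?P i) \<le> card (SIGMA x:N. {y \<in> N. H x y})" using N by (intro card_mono) auto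
  also have "\<dots> = e2 H N" unfolding e2_def dg_def using N by simp
  also have "card (\<Union>i\<in>I. ?P i) = (\<Sum>i\<in>I. card (?P i))"
  proof (rule card_UN_disjoint[OF I])
    show "\<forall>i\<in>I. finite (?P i)"
    proof
      fix i assume "i \<in> I"
      have "?P i \<subseteq> N \<times> N" using g(1)[OF \<open>i \<in> I\<close>] by auto
      thus "finite (?P i)" using N by (meson finite_SigmaI finite_subset)
    qed
  qed (use g(2) in \<open>auto simp: inj_on_def\<close>)
  also have "\<dots> = (\<Sum>i\<in>I. 2)"
  proof (rule sum.cong[OF refl])
    fix i assume "i \<in> I"
    then obtain x y where xy: "g i = {x, y}" "x \<noteq> y" using g(1) by (meson card_2_iff)
    have "?P i = {(x, y), (y, x)}" using xy by (auto simp: doubleton_eq_iff)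
    thus "card (?P i) = 2" using xy by simp
  qed
  finally show ?thesis by simp
qed

text \<open>After contraction the pairs are edges of a \<open>k33_free\<close> graph on
  \<open>N\<close>, distinct ones because \<open>g\<close> is injective. The 8 is half of the 16 of
  \<open>k33_free_e2\<close>, as \<open>e2\<close> counts each edge twice.\<close>

lemma connected_sets_pairs:
  assumes k: "k33_free R" and R: "symp R" and I: "finite I" and N: "finite N"
    and conn: "\<And>i. i \<in> I \<Longrightarrow> sconn R (A i)"
    and disj: "\<And>i j. i \<in> I \<Longrightarrow> j \<in> I \<Longrightarrow> i \<noteq> j \<Longrightarrow> A i \<inter> A j = {}"
    and AN: "\<And>i. i \<in> I \<Longrightarrow> A i \<inter> N = {}"
    and adj: "\<And>i x. i \<in> I \<Longrightarrow> x \<in> g i \<Longrightarrow> touches R (A i) x"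
    and g: "\<And>i. i \<in> I \<Longrightarrow> g i \<subseteq> N \<and> card (g i) = 2" "inj_on g I"
  shows "card I \<le> 8 * card N"
proof (cases "I = {}")
  case False
  let ?H = "\<lambda>x y. x \<noteq> y \<and> (\<exists>i\<in>I. g i = {x, y})"
  have k: "k33_free ?H" by (rule k33_free_contract[OF k R conn disj _ adj]) (use g AN in blast)+
  obtain i where "i \<in> I" using False by auto
  hence ne: "N \<noteq> {}" using g(1)[of i] by auto
  have "e2 ?H N < 16 * card N"
    by (rule k33_free_e2[OF k _ _ N ne]) (auto simp: symp_def irreflp_def insert_commute)
  moreover have "2 * card I \<le> e2 ?H N"
    by (rule card_pairs_le_e2[OF I N g]) auto
  ultimately show ?thesis by simp
qed simp

text \<open>A weak form of Hall's theorem: repeatedly pick an element contained in few of the remaining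
  sets, and let these sets choose it.\<close>

lemma bounded_choice:
  assumes "finite I" and S: "\<And>i. i \<in> I \<Longrightarrow> finite (S i) \<and> card (S i) \<le> b \<and> S i \<noteq> {}"
    and sp: "\<And>J. J \<subseteq> I \<Longrightarrow> card J \<le> c * card (\<Union>i\<in>J. S i)"
  shows "\<exists>\<phi> lab. (\<forall>i\<in>I. \<phi> i \<in> S i \<and> lab i < Suc (b * c)) \<and> inj_on (\<lambda>i. (\<phi> i, lab i :: nat)) I"
  using assms
proof (induction "card I" arbitrary: I rule: less_induct)
  case less
  show ?case
  proof (cases "I = {}")
    case False
    let ?U = "\<Union>i\<in>I. S i"
    have fU: "finite ?U" using less.prems by auto
    have neU: "?U \<noteq> {}" using less.prems(2) False by blast
    \<comment> \<open>Double counting: the multiplicities add up to at most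
      \<open>b * card I\<close>, hence to at most \<open>b * c * card ?U\<close>, and some element
      does not exceed the average.\<close>
    have "\<exists>v\<in>?U. card {i \<in> I. v \<in> S i} \<le> b * c"
    proof (rule ccontr)
      assume "\<not> ?thesis"
      hence "Suc (b * c) \<le> card {i \<in> I. v \<in> S i}" if "v \<in> ?U" for v using that by fastforce
      hence "card ?U * Suc (b * c) \<le> (\<Sum>v\<in>?U. card {i \<in> I. v \<in> S i})"
        using sum_bounded_below[of ?U "Suc (b * c)" "\<lambda>v. card {i \<in> I. v \<in> S i}"] by simp
      also have "\<dots> = (\<Sum>i\<in>I. card {v \<in> ?U. v \<in> S i})"
        using sum.swap_restrict[OF fU less.prems(1), of "\<lambda>_ _. 1::nat" "\<lambda>v i. v \<in> S i"]
        by (simp only: card_eq_sum)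
      also have "\<dots> \<le> (\<Sum>i\<in>I. b)"
      proof (rule sum_mono)
        fix i assume i: "i \<in> I"
        hence "{v \<in> ?U. v \<in> S i} = S i" by auto
        thus "card {v \<in> ?U. v \<in> S i} \<le> b" using less.prems(2)[OF i] by simp
      qed
      also have "\<dots> \<le> c * card ?U * b" using less.prems(3)[of I] by simp
      finally have "card ?U * Suc (b * c) \<le> card ?U * (b * c)" by (simp add: algebra_simps)
      thus False using neU fU by (simp add: card_gt_0_iff)
    qed
    then obtain v where v: "v \<in> ?U" "card {i \<in> I. v \<in> S i} \<le> b * c" by auto
    let ?J = "{i \<in> I. v \<in> S i}"
    have "I - ?J \<subset> I" using v by auto
    hence "card (I - ?J) < card I" using less.prems(1) by (simp add: psubset_card_mono)
    hence "\<exists>\<phi> lab. (\<forall>i\<in>I - ?J. \<phi> i \<in> S i \<and> lab i < Suc (b * c)) \<and> inj_on (\<lambda>i. (\<phi> i, lab i :: nat)) (I - ?J)"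
    proof (rule less.hyps)
      show "finite (I - ?J)" using less.prems(1) by simp
      show "finite (S i) \<and> card (S i) \<le> b \<and> S i \<noteq> {}" if "i \<in> I - ?J" for i
        using less.prems(2) that by blast
      show "card J \<le> c * card (\<Union>i\<in>J. S i)" if "J \<subseteq> I - ?J" for J
        using less.prems(3) that by blast
    qed
    then obtain \<phi> lab where h: "\<forall>i\<in>I - ?J. \<phi> i \<in> S i \<and> lab i < Suc (b * c)"
      "inj_on (\<lambda>i. (\<phi> i, lab i :: nat)) (I - ?J)" by blast
    obtain m where m: "bij_betw m ?J {0..<card ?J}"
      using ex_bij_betw_finite_nat[of ?J] less.prems(1) by auto
    let ?\<phi> = "\<lambda>i. if i \<in> ?J then v else \<phi> i" and ?l = "\<lambda>i. if i \<in> ?J then m i else lab i"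
    have "?\<phi> i \<in> S i \<and> ?l i < Suc (b * c)" if i: "i \<in> I" for i
    proof (cases "i \<in> ?J")
      case True
      hence "m i < card ?J" using bij_betwE[OF m] by auto
      thus ?thesis using True v by auto
    qed (use h i in auto)
    moreover have "inj_on (\<lambda>i. (?\<phi> i, ?l i)) I"
    proof (rule inj_onI)
      fix i j assume ij: "i \<in> I" "j \<in> I" "(?\<phi> i, ?l i) = (?\<phi> j, ?l j)"
      \<comment> \<open>A set without \<open>v\<close> has not chosen \<open>v\<close>, so labels
        can be reused across the two groups.\<close>
      have nv: "\<phi> i \<noteq> v" if "i \<in> I - ?J" for i using h(1) that by auto
      show "i = j"
      proof (cases "i \<in> ?J"; cases "j \<in> ?J")
        assume "i \<in> ?J" "j \<in> ?J"
        thus ?thesis using ij bij_betw_imp_inj_on[OF m] by (auto dest: inj_onD)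
      next
        assume "i \<notin> ?J" "j \<notin> ?J"
        thus ?thesis using ij inj_onD[OF h(2), of i j] by auto
      qed (use ij nv[of i] nv[of j] in auto)
    qed
    ultimately show ?thesis by (intro exI[of _ ?\<phi>] exI[of _ ?l]) blast
  qed auto
qed

lemma three_elements:
  assumes "finite A" "\<not> card A \<le> 2"
  obtains x y z where "x \<in> A" "y \<in> A" "z \<in> A" "distinct [x, y, z]"
proof -
  obtain B where "B \<subseteq> A" "card B = 3"
    using obtain_subset_with_card_n[of 3 A] assms(2) by auto
  thus ?thesis using that by (auto simp: card_3_iff)
qed

text \<open>Pairs inside the triples are selected greedily, with distinct pairs for distinct sets. A triple
  that is left over is a triangle in the sparse graph of the selected pairs. Orienting this
  graph with bounded outdegree, a triangle is a directed path \<open>x \<rightarrow> y \<rightarrow> z\<close>, and thus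
  given by \<open>x\<close> and two labels.\<close>

lemma connected_sets_triples:
  assumes k: "k33_free R" and R: "symp R" and I: "finite I" and N: "finite N"
    and conn: "\<And>i. i \<in> I \<Longrightarrow> sconn R (A i)"
    and disj: "\<And>i j. i \<in> I \<Longrightarrow> j \<in> I \<Longrightarrow> i \<noteq> j \<Longrightarrow> A i \<inter> A j = {}"
    and AN: "\<And>i. i \<in> I \<Longrightarrow> A i \<inter> N = {}"
    and adj: "\<And>i x. i \<in> I \<Longrightarrow> x \<in> g i \<Longrightarrow> touches R (A i) x"
    and g: "\<And>i. i \<in> I \<Longrightarrow> g i \<subseteq> N \<and> card (g i) = 3"
  shows "card I \<le> 586 * card N"
proof -
  define P where "P J h \<longleftrightarrow> J \<subseteq> I \<and> (\<forall>j\<in>J. h j \<subseteq> g j \<and> card (h j) = 2) \<and> inj_on h J" for J h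
  have "P {} (\<lambda>_. {})" by (simp add: P_def)
  hence P0: "\<exists>h. P {} h" by blast
  have "\<forall>J. (\<exists>h. P J h) \<longrightarrow> card J < Suc (card I)"
    using I by (auto simp: P_def less_Suc_eq_le card_mono)
  from ex_has_greatest_nat[of "\<lambda>J. \<exists>h. P J h", OF P0 this] obtain J h where
    P: "P J h" and Jmax: "\<And>J' h'. P J' h' \<Longrightarrow> card J' \<le> card J" by blast
  have J: "J \<subseteq> I" "\<And>j. j \<in> J \<Longrightarrow> h j \<subseteq> g j" "\<And>j. j \<in> J \<Longrightarrow> card (h j) = 2" "inj_on h J"
    using P by (auto simp: P_def)
  have fJ: "finite J" using J(1) I finite_subset by blast
  have pairs: "card J' \<le> 8 * card N'" if J': "J' \<subseteq> J" "\<And>j. j \<in> J' \<Longrightarrow> h j \<subseteq> N'" "N' \<subseteq> N" for J' N'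
  proof (rule connected_sets_pairs[OF k R, of J' N' A h])
    show "finite J'" "finite N'" using J' fJ N finite_subset by blast+
    show "sconn R (A i)" if "i \<in> J'" for i using conn that J' J(1) by blast
    show "A i \<inter> A j = {}" if "i \<in> J'" "j \<in> J'" "i \<noteq> j" for i j using disj that J' J(1) by blast
    show "A i \<inter> N' = {}" if "i \<in> J'" for i using AN that J' J(1) by blast
    show "touches R (A i) x" if "i \<in> J'" "x \<in> h i" for i x using adj that J' J by blast
    show "h i \<subseteq> N' \<and> card (h i) = 2" if "i \<in> J'" for i using that J' J by blast
    show "inj_on h J'" using J(4) J'(1) inj_on_subset by blast
  qed
  have hN: "h j \<subseteq> N" if "j \<in> J" for j using that J g by blast
  have cJ: "card J \<le> 8 * card N" using pairs[of J N] hN by auto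
  \<comment> \<open>Otherwise \<open>p\<close> could be selected for \<open>i\<close>, against
    maximality. So all three pairs of a leftover triple are selected.\<close>
  have left: "p \<in> h ` J" if i: "i \<in> I - J" and p: "p \<subseteq> g i" "card p = 2" for i p
  proof (rule ccontr)
    assume np: "p \<notin> h ` J"
    have "P (insert i J) (h(i := p))"
      using i p J np by (auto simp: P_def inj_on_def)
    from Jmax[OF this] show False using i fJ by simp
  qed
  have "\<exists>\<phi> lab. (\<forall>i\<in>J. \<phi> i \<in> h i \<and> lab i < Suc (2 * 8)) \<and> inj_on (\<lambda>i. (\<phi> i, lab i :: nat)) J"
  proof (rule bounded_choice[OF fJ])
    show "finite (h i) \<and> card (h i) \<le> 2 \<and> h i \<noteq> {}" if "i \<in> J" for i
      using J(3)[OF that] by (auto intro: card_ge_0_finite)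
    show "card J' \<le> 8 * card (\<Union>i\<in>J'. h i)" if "J' \<subseteq> J" for J'
      by (rule pairs) (use that hN in blast)+
  qed
  then obtain \<phi> lab where ph: "\<And>i. i \<in> J \<Longrightarrow> \<phi> i \<in> h i" "\<And>i. i \<in> J \<Longrightarrow> lab i < 17"
    and phi: "inj_on (\<lambda>i. (\<phi> i, lab i :: nat)) J" by auto
  \<comment> \<open>The pair \<open>h j\<close> is oriented away from \<open>\<phi> j\<close>;
    \<open>nx x m\<close> is the head of the arc at \<open>x\<close> with label \<open>m\<close>,
    and arbitrary if there is none. There are \<open>17 = Suc (2 * 8)\<close> labels.\<close>
  define nx where "nx x m = (THE y. \<exists>j\<in>J. \<phi> j = x \<and> lab j = m \<and> h j = {x, y})" for x m
  define S where "S x y \<longleftrightarrow> (\<exists>m<17. y = nx x m)" for x y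
  have S1: "S x y" if "j \<in> J" "\<phi> j = x" "h j = {x, y}" for j x y
  proof -
    have "nx x (lab j) = y"
      unfolding nx_def
    proof (rule the_equality)
      fix y' assume "\<exists>j'\<in>J. \<phi> j' = x \<and> lab j' = lab j \<and> h j' = {x, y'}"
      then obtain j' where j': "j' \<in> J" "\<phi> j' = x" "lab j' = lab j" "h j' = {x, y'}" by blast
      have "j' = j" using inj_onD[OF phi, of j' j] j' that by auto
      thus "y' = y" using j' that by (auto simp: doubleton_eq_iff)
    qed (use that in blast)
    thus ?thesis using ph(2)[OF that(1)] by (auto simp: S_def)
  qed
  have S2: "S x y \<or> S y x" if "i \<in> I - J" "x \<in> g i" "y \<in> g i" "x \<noteq> y" for i x y
  proof -
    have "{x, y} \<in> h ` J" by (rule left[OF that(1)]) (use that in auto)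
    then obtain j where j: "j \<in> J" "h j = {x, y}" by auto
    hence "\<phi> j = x \<or> \<phi> j = y" using ph(1)[OF j(1)] by auto
    thus ?thesis using S1[OF j(1), of x y] S1[OF j(1), of y x] j by (auto simp: insert_commute)
  qed
  have tri: "g ` (I - J) \<subseteq> (\<lambda>(x, m, n). {x, nx x m, nx (nx x m) n}) ` (N \<times> {..<17} \<times> {..<17})"
  proof
    fix t assume "t \<in> g ` (I - J)"
    then obtain i where i: "i \<in> I - J" "t = g i" by auto
    then obtain a b c where abc: "g i = {a, b, c}" "a \<noteq> b" "b \<noteq> c" "a \<noteq> c"
      using g[of i] by (auto simp: card_3_iff)
    have "t = {a, b, c}" "t = {a, c, b}" "t = {b, a, c}" "t = {b, c, a}" "t = {c, a, b}" "t = {c, b, a}"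
      using abc i(2) by auto
    moreover have "S a b \<or> S b a" "S b c \<or> S c b" "S a c \<or> S c a"
      using S2[OF i(1)] abc by auto
    \<comment> \<open>A tournament on three vertices has a directed path through all of
      them.\<close>
    ultimately have "\<exists>x y z. t = {x, y, z} \<and> S x y \<and> S y z" by blast
    then obtain x y z where xyz: "t = {x, y, z}" "S x y" "S y z" by blast
    have "x \<in> N" using g[of i] i xyz by auto
    thus "t \<in> (\<lambda>(x, m, n). {x, nx x m, nx (nx x m) n}) ` (N \<times> {..<17} \<times> {..<17})"
      using xyz unfolding S_def by force
  qed
  have "card (g ` (I - J)) \<le> card (N \<times> {..<17::nat} \<times> {..<17::nat})"
    by (rule surj_card_le[OF _ tri]) (use N in auto)
  hence ctri: "card (g ` (I - J)) \<le> 289 * card N" by (simp add: card_cartesian_product)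
  \<comment> \<open>Three sets attached to the same triple would form a K_{3,3} minor.\<close>
  have two: "card {i \<in> I - J. g i = t} \<le> 2" if t: "t \<in> g ` (I - J)" for t
  proof (rule ccontr)
    assume "\<not> ?thesis"
    then obtain i1 i2 i3 where i: "i1 \<in> I" "i2 \<in> I" "i3 \<in> I" "distinct [i1, i2, i3]"
      "g i1 = t" "g i2 = t" "g i3 = t" using I by (auto elim!: three_elements[rotated])
    obtain x1 x2 x3 where x: "t = {x1, x2, x3}" "distinct [x1, x2, x3]"
      using g[OF i(1)] i(5) by (auto simp: card_3_iff)
    have d: "A i1 \<inter> A i2 = {}" "A i1 \<inter> A i3 = {}" "A i2 \<inter> A i3 = {}" using i disj by auto
    have "t \<inter> (A i1 \<union> A i2 \<union> A i3) = {}" using AN i g by blast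
    moreover have "\<forall>x\<in>t. touches R (A i1) x \<and> touches R (A i2) x \<and> touches R (A i3) x"
      using adj i by blast
    ultimately show False using k conn[OF i(1)] conn[OF i(2)] conn[OF i(3)] d x
      unfolding k33_free_def by blast
  qed
  have "I - J = (\<Union>t\<in>g ` (I - J). {i \<in> I - J. g i = t})" by auto
  hence "card (I - J) \<le> (\<Sum>t\<in>g ` (I - J). card {i \<in> I - J. g i = t})"
    using card_UN_le[of "g ` (I - J)" "\<lambda>t. {i \<in> I - J. g i = t}"] I by simp
  also have "\<dots> \<le> (\<Sum>t\<in>g ` (I - J). 2)" by (rule sum_mono) (rule two)
  finally have "card (I - J) \<le> 578 * card N" using ctri by simp
  moreover have "card I = card J + card (I - J)"
    using card_Un_disjoint[of J "I - J"] J(1) I fJ by (simp add: Un_absorb1)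
  ultimately show ?thesis using cJ by simp
qed

section \<open>Planar graphs\<close>

text \<open>The Jordan curve theorem, with \<open>U\<close> named as the side that contains
  \<open>C\<close>, be it the inside or the outside.\<close>

lemma simple_closed_curve_side:
  fixes g1 g2 :: "real \<Rightarrow> complex"
  assumes "arc g1" "arc g2" "pathstart g1 = a" "pathfinish g1 = b" "pathstart g2 = a" "pathfinish g2 = b"
    and J: "path_image g1 \<inter> path_image g2 \<subseteq> {a, b}"
    and C: "connected C" "C \<inter> (path_image g1 \<union> path_image g2) = {}"
  obtains U V where "V \<noteq> {}" "connected V" "connected U" "C \<subseteq> U" "U \<inter> V = {}"
    "U \<union> V = - (path_image g1 \<union> path_image g2)" "frontier V = path_image g1 \<union> path_image g2"
proof -
  define c where "c = g1 +++ reversepath g2"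
  have c: "simple_path c" unfolding c_def
    by (rule simple_path_join_loop) (use assms in \<open>auto simp: arc_reversepath\<close>)
  have l: "pathfinish c = pathstart c" using assms by (simp add: c_def)
  have im: "path_image c = path_image g1 \<union> path_image g2"
    unfolding c_def using assms by (subst path_image_join) auto
  obtain I O' where io: "I \<noteq> {}" "open I" "connected I" "O' \<noteq> {}" "open O'" "connected O'"
    "I \<inter> O' = {}" "I \<union> O' = - path_image c" "frontier I = path_image c" "frontier O' = path_image c"
    using Jordan_curve[OF c l] by metis
  have "C \<subseteq> I \<union> O'" using C(2) io(8) im by auto
  hence "C \<subseteq> I \<or> C \<subseteq> O'"
    using connectedD[OF C(1) io(2,5)] io(7) by blast
  thus ?thesis
  proof
    assume "C \<subseteq> I"
    thus ?thesis using io im by (intro that[of O' I]) auto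
  next
    assume "C \<subseteq> O'"
    thus ?thesis using io im by (intro that[of I O']) auto
  qed
qed

text \<open>Arcs from \<open>x1\<close> to \<open>x2\<close> through the \<open>W k\<close> form a theta curve. For any two of them, \<open>x3\<close>
  is on the same side of their union as the third one; the other side \<open>V\<close> is a face of
  the theta curve. A point of one such face is thus not separated from \<open>x3\<close> by the
  two other closed curves, and Janiszewski's theorem gives a contradiction.\<close>

lemma no_three_tripods:
  fixes x1 x2 x3 :: complex
  assumes x: "x1 \<noteq> x2"
    and dis: "W1 \<inter> W2 = {}" "W1 \<inter> W3 = {}" "W2 \<inter> W3 = {}"
    and xW: "{x1, x2, x3} \<inter> (W1 \<union> W2 \<union> W3) = {}" "x3 \<notin> {x1, x2}"
    and pc: "path_connected (W1 \<union> {x1, x2})" "path_connected (W2 \<union> {x1, x2})" "path_connected (W3 \<union> {x1, x2})"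
    and cn: "connected (W1 \<union> {x3})" "connected (W2 \<union> {x3})" "connected (W3 \<union> {x3})"
  shows False
proof -
  have arcs: "\<exists>g. arc g \<and> path_image g \<subseteq> W \<union> {x1, x2} \<and> pathstart g = x1 \<and> pathfinish g = x2"
    if "path_connected (W \<union> {x1, x2})" for W
    using that x unfolding path_connected_arcwise by blast
  obtain g1 where g1: "arc g1" "path_image g1 \<subseteq> W1 \<union> {x1, x2}" "pathstart g1 = x1" "pathfinish g1 = x2"
    using arcs[OF pc(1)] by blast
  obtain g2 where g2: "arc g2" "path_image g2 \<subseteq> W2 \<union> {x1, x2}" "pathstart g2 = x1" "pathfinish g2 = x2"
    using arcs[OF pc(2)] by blast
  obtain g3 where g3: "arc g3" "path_image g3 \<subseteq> W3 \<union> {x1, x2}" "pathstart g3 = x1" "pathfinish g3 = x2"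
    using arcs[OF pc(3)] by blast
  let ?a1 = "path_image g1" and ?a2 = "path_image g2" and ?a3 = "path_image g3"
  obtain V12 U12 where 12: "V12 \<noteq> {}" "connected V12" "connected U12" "W3 \<union> {x3} \<subseteq> U12" "U12 \<inter> V12 = {}"
    "U12 \<union> V12 = - (?a1 \<union> ?a2)" "frontier V12 = ?a1 \<union> ?a2"
    by (rule simple_closed_curve_side[OF g1(1) g2(1) g1(3,4) g2(3,4) _ cn(3)])
      (use g1 g2 dis xW in auto)
  obtain V13 U13 where 13: "V13 \<noteq> {}" "connected V13" "connected U13" "W2 \<union> {x3} \<subseteq> U13" "U13 \<inter> V13 = {}"
    "U13 \<union> V13 = - (?a1 \<union> ?a3)" "frontier V13 = ?a1 \<union> ?a3"
    by (rule simple_closed_curve_side[OF g1(1) g3(1) g1(3,4) g3(3,4) _ cn(2)])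
      (use g1 g3 dis xW in auto)
  obtain V23 U23 where 23: "V23 \<noteq> {}" "connected V23" "connected U23" "W1 \<union> {x3} \<subseteq> U23" "U23 \<inter> V23 = {}"
    "U23 \<union> V23 = - (?a2 \<union> ?a3)" "frontier V23 = ?a2 \<union> ?a3"
    by (rule simple_closed_curve_side[OF g2(1) g3(1) g2(3,4) g3(3,4) _ cn(1)])
      (use g2 g3 dis xW in auto)
  have e: "{x1, x2} \<subseteq> ?a1" "{x1, x2} \<subseteq> ?a2" "{x1, x2} \<subseteq> ?a3"
    using g1 g2 g3 by (metis empty_subsetI insert_subset pathstart_in_path_image pathfinish_in_path_image)+
  have "?a3 \<subseteq> U12 \<union> {x1, x2}" "?a2 \<subseteq> U13 \<union> {x1, x2}" "?a1 \<subseteq> U23 \<union> {x1, x2}"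
    using g1(2) g2(2) g3(2) 12(4) 13(4) 23(4) by auto
  moreover have "V12 \<inter> {x1, x2} = {}" "V13 \<inter> {x1, x2} = {}" "V23 \<inter> {x1, x2} = {}"
    using 12(6) 13(6) 23(6) e by auto
  ultimately have free: "V12 \<inter> ?a3 = {}" "V13 \<inter> ?a2 = {}" "V23 \<inter> ?a1 = {}"
    using 12(5) 13(5) 23(5) by auto
  have mid: "\<exists>m. m \<in> path_image g \<and> m \<noteq> x1 \<and> m \<noteq> x2"
    if "arc g" "pathstart g = x1" "pathfinish g = x2" for g :: "real \<Rightarrow> complex"
  proof (intro exI conjI)
    show "g (1/2) \<in> path_image g" by (simp add: path_image_def)
    have i: "inj_on g {0..1}" using that by (simp add: arc_def)
    show "g (1/2) \<noteq> x1" "g (1/2) \<noteq> x2"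
      using that inj_onD[OF i, of "1/2" 0] inj_onD[OF i, of "1/2" 1]
      by (auto simp: pathstart_def pathfinish_def)
  qed
  obtain m1 where m1: "m1 \<in> ?a1" "m1 \<in> W1" using mid[of g1] g1 by blast
  obtain m2 where m2: "m2 \<in> ?a2" "m2 \<in> W2" using mid[of g2] g2 by blast
  obtain p where p: "p \<in> V12" using 12 by auto
  \<comment> \<open>A connected set that meets \<open>V'\<close> but not its frontier lies inside
    \<open>V'\<close>; here this works both ways.\<close>
  have eqV: "V = V'" if "connected V" "connected V'" "p \<in> V" "p \<in> V'" "V \<inter> frontier V' = {}" "V' \<inter> frontier V = {}"
    for V V' :: "complex set"
    using connected_Int_frontier[OF that(1), of V'] connected_Int_frontier[OF that(2), of V] that(3-6) by blast
  \<comment> \<open>Equal faces would have equal frontiers, but the point \<open>m2\<close> in the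
    interior of \<open>g2\<close> lies only on the first.\<close>
  have "p \<notin> V13"
  proof
    assume "p \<in> V13"
    have f: "V12 \<inter> (?a1 \<union> ?a3) = {}" "V13 \<inter> (?a1 \<union> ?a2) = {}" using 12(6) 13(6) free by auto
    have "V12 = V13" by (rule eqV[OF 12(2) 13(2) p \<open>p \<in> V13\<close>]) (simp_all only: 12(7) 13(7) f)
    hence "m2 \<in> ?a1 \<union> ?a3" using 12(7) 13(7) m2 by auto
    thus False using m2(2) g1 g3 dis xW by auto
  qed
  moreover have "p \<notin> ?a1 \<union> ?a3" using p free 12(6) by auto
  ultimately have "p \<in> U13" using 13(6) by auto
  hence c13: "connected_component (- (?a1 \<union> ?a3)) p x3"
    using 13(3,4,6) unfolding connected_component_def by (intro exI[of _ U13]) auto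
  have "p \<notin> V23"
  proof
    assume "p \<in> V23"
    have f: "V12 \<inter> (?a2 \<union> ?a3) = {}" "V23 \<inter> (?a1 \<union> ?a2) = {}" using 12(6) 23(6) free by auto
    have "V12 = V23" by (rule eqV[OF 12(2) 23(2) p \<open>p \<in> V23\<close>]) (simp_all only: 12(7) 23(7) f)
    hence "m1 \<in> ?a2 \<union> ?a3" using 12(7) 23(7) m1 by auto
    thus False using m1(2) g2 g3 dis xW by auto
  qed
  moreover have "p \<notin> ?a2 \<union> ?a3" using p free 12(6) by auto
  ultimately have "p \<in> U23" using 23(6) by auto
  hence c23: "connected_component (- (?a2 \<union> ?a3)) p x3"
    using 23(3,4,6) unfolding connected_component_def by (intro exI[of _ U23]) auto
  have cp: "compact (?a1 \<union> ?a3)" "closed (?a2 \<union> ?a3)"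
    using g1(1) g2(1) g3(1) by (auto simp: arc_def compact_Un compact_path_image closed_path_image)
  have "?a1 \<inter> ?a2 \<subseteq> {x1, x2}" using g1(2) g2(2) dis(1) xW by blast
  \<comment> \<open>The two closed curves meet in exactly the third arc. Its connectedness is the
    hypothesis of Janiszewski's theorem.\<close>
  hence "(?a1 \<union> ?a3) \<inter> (?a2 \<union> ?a3) = ?a3" using e by blast
  hence cni: "connected ((?a1 \<union> ?a3) \<inter> (?a2 \<union> ?a3))"
    using g3(1) by (simp add: arc_def connected_path_image)
  have "connected_component (- ((?a1 \<union> ?a3) \<union> (?a2 \<union> ?a3))) p x3"
    by (rule Janiszewski[OF cp cni c13 c23])
  then obtain K where K: "connected K" "K \<subseteq> - ((?a1 \<union> ?a3) \<union> (?a2 \<union> ?a3))" "p \<in> K" "x3 \<in> K"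
    unfolding connected_component_def by auto
  \<comment> \<open>\<open>K\<close> joins a point of \<open>V12\<close> to a point outside it, yet
    avoids all three arcs and thus the frontier of \<open>V12\<close>.\<close>
  have "x3 \<notin> V12" using 12 by auto
  hence "K \<inter> frontier V12 \<noteq> {}" using connected_Int_frontier[OF K(1), of V12] K p by blast
  thus False using K(2) 12(7) by blast
qed

text \<open>What remains is the image of a half-open interval. The legs of tripods are taken without
  their tips, so that tripods of different sets can be disjoint.\<close>

lemma path_connected_arc_minus_end:
  fixes g :: "real \<Rightarrow> complex"
  assumes "arc g" "v \<in> {pathstart g, pathfinish g}"
  shows "path_connected (path_image g - {v})"
proof -
  have i: "inj_on g {0..1}" and c: "continuous_on {0..1} g"
    using assms by (auto simp: arc_def path_def)
  have "\<exists>S. convex S \<and> S \<subseteq> {0..1} \<and> path_image g - {v} = g ` S"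
  proof (cases "v = pathfinish g")
    case True
    have "{0..1} = insert 1 {0..<1::real}" by auto
    hence "path_image g = insert (g 1) (g ` {0..<1})" by (auto simp: path_image_def)
    moreover have "g 1 \<notin> g ` {0..<1}" by (subst inj_on_image_mem_iff[OF i]) auto
    ultimately have "path_image g - {v} = g ` {0..<1}" using True by (simp add: pathfinish_def)
    thus ?thesis by (intro exI[of _ "{0..<1}"]) auto
  next
    case False
    hence v: "v = g 0" using assms by (auto simp: pathstart_def)
    have "{0..1} = insert 0 {0<..1::real}" by auto
    hence "path_image g = insert (g 0) (g ` {0<..1})" by (auto simp: path_image_def)
    moreover have "g 0 \<notin> g ` {0<..1}" by (subst inj_on_image_mem_iff[OF i]) auto
    ultimately have "path_image g - {v} = g ` {0<..1}" using v by simp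
    thus ?thesis by (intro exI[of _ "{0<..1}"]) auto
  qed
  then obtain S where "convex S" "S \<subseteq> {0..1}" "path_image g - {v} = g ` S" by blast
  thus ?thesis using path_connected_continuous_image[OF continuous_on_subset[OF c]]
      convex_imp_path_connected by metis
qed

section \<open>Tripods in a plane drawing\<close>

abbreviation nbr :: "'a graph \<Rightarrow> 'a \<Rightarrow> 'a \<Rightarrow> bool" where
  "nbr G \<equiv> \<lambda>u v. {u, v} \<in> edges G"

lemma symp_nbr: "symp (nbr G)"
  by (auto simp: symp_def insert_commute)

lemma irreflp_nbr: "simple_graph G \<Longrightarrow> irreflp (nbr G)"
  by (fastforce simp: irreflp_def simple_graph_def)

lemma nbr_verts: "simple_graph G \<Longrightarrow> nbr G u v \<Longrightarrow> u \<in> verts G \<and> v \<in> verts G \<and> u \<noteq> v"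
  by (fastforce simp: simple_graph_def)

text \<open>\<open>sconn\<close> alone does not place a set inside the graph, as every singleton
  satisfies it; an edge to \<open>x\<close> does.\<close>

lemma sconn_touching_verts:
  assumes "simple_graph G" "sconn (nbr G) B" "touches (nbr G) B x"
  shows "B \<subseteq> verts G"
proof
  fix b assume b: "b \<in> B"
  obtain y where y: "y \<in> B" "nbr G y x" using assms by (auto simp: touches_def)
  show "b \<in> verts G"
  proof (cases "b = y")
    case False
    obtain x' y' where "x' \<in> {b}" "y' \<in> B - {b}" "nbr G x' y'"
      by (rule sconn_cut[OF assms(2), of "{b}"]) (use b y False in auto)
    thus ?thesis using nbr_verts[OF assms(1)] by blast
  qed (use y nbr_verts[OF assms(1)] in blast)
qed

text \<open>The tripod consists of the drawing of \<open>B\<close> and the edges inside it, with one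
  leg towards each of the three points. The last conclusion records on which arcs a point of
  \<open>W\<close> can lie; disjointness of different tripods is read off from it.\<close>

lemma tripod_of_connected_set:
  assumes G: "simple_graph G" and pd: "plane_drawing G p \<gamma>" and B: "sconn (nbr G) B"
    and X: "{x1, x2, x3} \<inter> B = {}" "distinct [x1, x2, x3]"
    and t: "\<And>x. x \<in> {x1, x2, x3} \<Longrightarrow> touches (nbr G) B x"
  obtains W where "path_connected (W \<union> {p x1, p x2})" "connected (W \<union> {p x3})"
    "\<And>z. z \<in> W \<Longrightarrow> z \<notin> p ` {x1, x2, x3} \<and> (z \<in> p ` B \<or>
       (\<exists>e\<in>edges G. z \<in> path_image (\<gamma> e) \<and> e \<subseteq> B \<union> {x1, x2, x3} \<and> e \<inter> B \<noteq> {}))"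
proof -
  let ?X = "{x1, x2, x3}"
  have inj: "inj_on p (verts G)"
    and ed: "\<And>e. e \<in> edges G \<Longrightarrow> arc (\<gamma> e)"
      "\<And>e. e \<in> edges G \<Longrightarrow> {pathstart (\<gamma> e), pathfinish (\<gamma> e)} = p ` e"
      "\<And>e. e \<in> edges G \<Longrightarrow> path_image (\<gamma> e) \<inter> p ` verts G \<subseteq> p ` e"
    using pd by (auto simp: plane_drawing_def)
  have BV: "B \<subseteq> verts G" using sconn_touching_verts[OF G B] t by blast
  have XV: "?X \<subseteq> verts G" using t nbr_verts[OF G] by (auto simp: touches_def)
  have en: "p u \<in> path_image (\<gamma> e)" if "e \<in> edges G" "u \<in> e" for u e
  proof -
    have "p u \<in> {pathstart (\<gamma> e), pathfinish (\<gamma> e)}" unfolding ed(2)[OF that(1)] using that(2) by (rule imageI)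
    thus ?thesis by auto
  qed
  have ends: "u \<in> e" if "e \<in> edges G" "p u \<in> path_image (\<gamma> e)" "u \<in> verts G" for u e
  proof -
    have "p u \<in> p ` e" using ed(3)[OF that(1)] that by blast
    moreover have "e \<subseteq> verts G" using G that by (auto simp: simple_graph_def)
    ultimately show ?thesis using inj that(3) by (meson inj_on_image_mem_iff)
  qed
  define core where "core = p ` B \<union> (\<Union>e\<in>{e \<in> edges G. e \<subseteq> B}. path_image (\<gamma> e))"
  have pcore: "path_connected core"
  proof -
    have step: "path_component core (p u) (p w)" if "u \<in> B" "w \<in> B" for u w
    proof -
      have "(\<lambda>a b. a \<in> B \<and> b \<in> B \<and> nbr G a b)\<^sup>*\<^sup>* u w" using B that by (auto simp: sconn_def)
      thus ?thesis
      proof (induction rule: rtranclp_induct)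
        case base
        show ?case using that by (auto simp: core_def intro: path_component_refl)
      next
        case (step y z)
        let ?e = "{y, z}"
        have "path_component (path_image (\<gamma> ?e)) (p y) (p z)"
          using path_connected_path_image[of "\<gamma> ?e"] ed(1)[of ?e] step en[of ?e]
          by (auto simp: path_connected_component arc_imp_path)
        hence "path_component core (p y) (p z)"
          by (rule path_component_of_subset[rotated]) (use step in \<open>auto simp: core_def\<close>)
        thus ?case using step path_component_trans by blast
      qed
    qed
    have "\<exists>u\<in>B. path_component core z (p u)" if "z \<in> core" for z
    proof (cases "z \<in> p ` B")
      case True
      thus ?thesis by (auto simp: core_def intro!: path_component_refl)
    next
      case False
      then obtain e where e: "e \<in> edges G" "e \<subseteq> B" "z \<in> path_image (\<gamma> e)" using \<open>z \<in> core\<close> by (auto simp: core_def)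
      obtain u where u: "u \<in> e" using G e by (fastforce simp: simple_graph_def)
      have "path_component (path_image (\<gamma> e)) z (p u)"
        using path_connected_path_image[of "\<gamma> e"] ed(1)[OF e(1)] e en[OF e(1) u]
        by (auto simp: path_connected_component arc_imp_path)
      hence "path_component core z (p u)"
        by (rule path_component_of_subset[rotated]) (use e in \<open>auto simp: core_def\<close>)
      thus ?thesis using u e by blast
    qed
    thus ?thesis using step unfolding path_connected_component
      by (meson path_component_trans path_component_sym)
  qed
  have "\<exists>b. b \<in> B \<and> nbr G b x" if "x \<in> ?X" for x using t[OF that] by (auto simp: touches_def)
  then obtain b where b: "\<And>x. x \<in> ?X \<Longrightarrow> b x \<in> B \<and> nbr G (b x) x" by metis
  define f where "f x = path_image (\<gamma> {b x, x})" for x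
  define h where "h x = f x - {p x}" for x
  have f: "path_connected (f x)" "path_connected (h x)" "p (b x) \<in> h x" "p x \<in> f x" if x: "x \<in> ?X" for x
  proof -
    have e: "{b x, x} \<in> edges G" using b[OF x] by auto
    show "path_connected (f x)" unfolding f_def using ed(1)[OF e]
      by (simp add: arc_imp_path path_connected_path_image)
    show "path_connected (h x)" unfolding f_def h_def
      by (rule path_connected_arc_minus_end[OF ed(1)[OF e]]) (use ed(2)[OF e] in auto)
    show "p x \<in> f x" unfolding f_def using en[OF e] by auto
    have "b x \<noteq> x" "b x \<in> verts G" "x \<in> verts G" using nbr_verts[OF G e] by auto
    hence "p (b x) \<noteq> p x" using inj by (auto dest: inj_onD)
    thus "p (b x) \<in> h x" unfolding h_def f_def using en[OF e] by auto
  qed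
  have bc: "p (b x) \<in> core" if "x \<in> ?X" for x using b[OF that] by (auto simp: core_def)
  have pun: "path_connected (S \<union> h x)" "path_connected (S \<union> f x)"
    if "path_connected S" "core \<subseteq> S" "x \<in> ?X" for S x
    using f[OF that(3)] bc[OF that(3)] that by (auto intro!: path_connected_Un simp: h_def)
  define W where "W = core \<union> h x1 \<union> h x2 \<union> h x3"
  show thesis
  proof (rule that[of W])
    have "W \<union> {p x1, p x2} = core \<union> f x1 \<union> f x2 \<union> h x3"
      using f(4)[of x1] f(4)[of x2] by (auto simp: W_def h_def)
    thus "path_connected (W \<union> {p x1, p x2})" using pcore by (auto intro!: pun)
    have "W \<union> {p x3} = core \<union> h x1 \<union> h x2 \<union> f x3"
      using f(4)[of x3] by (auto simp: W_def h_def)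
    hence "path_connected (W \<union> {p x3})" using pcore by (auto intro!: pun)
    thus "connected (W \<union> {p x3})" by (rule path_connected_imp_connected)
    fix z assume z: "z \<in> W"
    have "z \<in> p ` B \<or> (\<exists>e\<in>edges G. z \<in> path_image (\<gamma> e) \<and> e \<subseteq> B) \<or> (\<exists>x\<in>?X. z \<in> h x)"
      using z by (auto simp: W_def core_def)
    moreover have "z \<notin> p ` ?X \<and> (\<exists>e\<in>edges G. z \<in> path_image (\<gamma> e) \<and> e \<subseteq> B \<union> ?X \<and> e \<inter> B \<noteq> {})"
      if e: "e \<in> edges G" "z \<in> path_image (\<gamma> e)" "e \<subseteq> B" for e
    proof -
      have "e \<noteq> {}" using G e by (auto simp: simple_graph_def)
      moreover have "z \<notin> p ` ?X" using ends[OF e(1)] e XV X(1) by blast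
      ultimately show ?thesis using e by blast
    qed
    moreover have "z \<notin> p ` ?X \<and> (\<exists>e\<in>edges G. z \<in> path_image (\<gamma> e) \<and> e \<subseteq> B \<union> ?X \<and> e \<inter> B \<noteq> {})"
      if x: "x \<in> ?X" "z \<in> h x" for x
    proof -
      have e: "{b x, x} \<in> edges G" "b x \<in> B" "z \<in> path_image (\<gamma> {b x, x})" "z \<noteq> p x"
        using b[OF x(1)] x(2) by (auto simp: h_def f_def)
      have "z \<notin> p ` ?X"
      proof
        assume "z \<in> p ` ?X"
        then obtain y where y: "y \<in> ?X" "z = p y" by blast
        hence "y \<in> {b x, x}" using ends[OF e(1), of y] e(3) XV by blast
        thus False using y e X(1) by auto
      qed
      thus ?thesis using e x(1) by (intro conjI bexI[of _ "{b x, x}"]) auto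
    qed
    moreover have "z \<notin> p ` ?X" if "z \<in> p ` B"
      using that X(1) inj BV XV by (auto dest: inj_onD)
    ultimately show "z \<notin> p ` ?X \<and> (z \<in> p ` B \<or>
       (\<exists>e\<in>edges G. z \<in> path_image (\<gamma> e) \<and> e \<subseteq> B \<union> ?X \<and> e \<inter> B \<noteq> {}))" by blast
  qed
qed

lemma planar_k33_free:
  assumes G: "simple_graph G" and "planar G"
  shows "k33_free (nbr G)"
  unfolding k33_free_def
proof (rule notI, elim exE conjE)
  fix B1 B2 B3 x1 x2 x3
  assume B: "sconn (nbr G) B1" "sconn (nbr G) B2" "sconn (nbr G) B3"
    and d: "B1 \<inter> B2 = {}" "B1 \<inter> B3 = {}" "B2 \<inter> B3 = {}"
    and x: "distinct [x1, x2, x3]" "{x1, x2, x3} \<inter> (B1 \<union> B2 \<union> B3) = {}"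
    and t: "\<forall>x\<in>{x1, x2, x3}. touches (nbr G) B1 x \<and> touches (nbr G) B2 x \<and> touches (nbr G) B3 x"
  let ?X = "{x1, x2, x3}"
  obtain p \<gamma> where pd: "plane_drawing G p \<gamma>" using assms by (auto simp: planar_def)
  define Q where "Q B z \<longleftrightarrow> z \<notin> p ` ?X \<and> (z \<in> p ` B \<or>
       (\<exists>e\<in>edges G. z \<in> path_image (\<gamma> e) \<and> e \<subseteq> B \<union> ?X \<and> e \<inter> B \<noteq> {}))" for B z
  have trip: "\<exists>W. path_connected (W \<union> {p x1, p x2}) \<and> connected (W \<union> {p x3}) \<and> (\<forall>z\<in>W. Q B z)"
    if "B \<in> {B1, B2, B3}" for B
  proof -
    have b: "sconn (nbr G) B" "?X \<inter> B = {}" using that B x by auto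
    have tt: "touches (nbr G) B y" if "y \<in> ?X" for y using t \<open>B \<in> {B1, B2, B3}\<close> that by auto
    show ?thesis
      unfolding Q_def by (rule tripod_of_connected_set[OF G pd b(1) b(2) x(1) tt]) blast+
  qed
  obtain W1 where W1: "path_connected (W1 \<union> {p x1, p x2})" "connected (W1 \<union> {p x3})" "\<And>z. z \<in> W1 \<Longrightarrow> Q B1 z"
    using trip[of B1] by blast
  obtain W2 where W2: "path_connected (W2 \<union> {p x1, p x2})" "connected (W2 \<union> {p x3})" "\<And>z. z \<in> W2 \<Longrightarrow> Q B2 z"
    using trip[of B2] by blast
  obtain W3 where W3: "path_connected (W3 \<union> {p x1, p x2})" "connected (W3 \<union> {p x3})" "\<And>z. z \<in> W3 \<Longrightarrow> Q B3 z"
    using trip[of B3] by blast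
  have inj: "inj_on p (verts G)"
    and ev: "\<And>e. e \<in> edges G \<Longrightarrow> path_image (\<gamma> e) \<inter> p ` verts G \<subseteq> p ` e"
    and ee: "\<And>e e'. e \<in> edges G \<Longrightarrow> e' \<in> edges G \<Longrightarrow> e \<noteq> e' \<Longrightarrow>
        path_image (\<gamma> e) \<inter> path_image (\<gamma> e') \<subseteq> p ` (e \<inter> e')"
    using pd by (auto simp: plane_drawing_def)
  have BV: "B1 \<subseteq> verts G" "B2 \<subseteq> verts G" "B3 \<subseteq> verts G"
    using sconn_touching_verts[OF G] B t by blast+
  have XV: "?X \<subseteq> verts G" using t nbr_verts[OF G] by (auto simp: touches_def)
  have vo: False if "z \<in> p ` B" "e \<in> edges G" "z \<in> path_image (\<gamma> e)" "e \<subseteq> B' \<union> ?X"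
    "B \<inter> B' = {}" "B \<subseteq> verts G" "?X \<inter> B = {}" for z B B' e
  proof -
    have eV: "e \<subseteq> verts G" using G that by (auto simp: simple_graph_def)
    obtain u where u: "u \<in> B" "z = p u" using \<open>z \<in> p ` B\<close> by auto
    have "p u \<in> p ` e" using ev[OF that(2)] that(3,6) u by blast
    hence "u \<in> e" using inj eV u that by (meson inj_on_image_mem_iff subsetD)
    thus False using that u by blast
  qed
  \<comment> \<open>Arcs of distinct edges meet only in a common end. For two edges that belong to
    disjoint sets \<open>B\<close> and \<open>B'\<close> this end lies in \<open>?X\<close>, where
    \<open>Q\<close> admits no point.\<close>
  have QQ: False if q: "Q B z" "Q B' z" and d: "B \<inter> B' = {}" "B \<subseteq> verts G" "B' \<subseteq> verts G" "?X \<inter> B = {}" "?X \<inter> B' = {}"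
    for B B' z
  proof -
    have zX: "z \<notin> p ` ?X" using q by (simp add: Q_def)
    have "\<not> (z \<in> p ` B \<and> z \<in> p ` B')" using inj d by (fastforce dest: inj_onD)
    then consider e where "z \<in> p ` B" "e \<in> edges G" "z \<in> path_image (\<gamma> e)" "e \<subseteq> B' \<union> ?X"
      | e where "z \<in> p ` B'" "e \<in> edges G" "z \<in> path_image (\<gamma> e)" "e \<subseteq> B \<union> ?X"
      | e e' where "e \<in> edges G" "z \<in> path_image (\<gamma> e)" "e \<subseteq> B \<union> ?X" "e \<inter> B \<noteq> {}"
          "e' \<in> edges G" "z \<in> path_image (\<gamma> e')" "e' \<subseteq> B' \<union> ?X" "e' \<inter> B' \<noteq> {}"
      using q unfolding Q_def by blast
    thus False
    proof cases
      case 1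
      thus ?thesis using vo[of z B e B'] d by blast
    next
      case 2
      thus ?thesis using vo[of z B' e B] d by blast
    next
      case 3
      have "e \<noteq> e'" using 3 d by blast
      hence "z \<in> p ` (e \<inter> e')" using ee[OF 3(1,5)] 3 by blast
      thus False using 3 d zX by blast
    qed
  qed
  have px: "p x1 \<noteq> p x2" "p x3 \<notin> {p x1, p x2}" using inj XV x(1) by (auto dest: inj_onD)
  have X0: "?X \<inter> B1 = {}" "?X \<inter> B2 = {}" "?X \<inter> B3 = {}" using x(2) by blast+
  have "W1 \<inter> W2 = {}" using QQ[of B1 _ B2] W1(3) W2(3) d(1) BV X0 by blast
  moreover have "W1 \<inter> W3 = {}" using QQ[of B1 _ B3] W1(3) W3(3) d(2) BV X0 by blast
  moreover have "W2 \<inter> W3 = {}" using QQ[of B2 _ B3] W2(3) W3(3) d(3) BV X0 by blast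
  moreover have "{p x1, p x2, p x3} \<inter> (W1 \<union> W2 \<union> W3) = {}"
    using W1(3) W2(3) W3(3) by (auto simp: Q_def)
  ultimately show False
    using no_three_tripods[of "p x1" "p x2" W1 W2 W3 "p x3"] px W1 W2 W3 by blast
qed

section \<open>Cycles and forests\<close>

lemma copies_cycle_graph_nonempty:
  assumes G: "simple_graph G" and xs: "distinct xs" "length xs = t" "3 \<le> t"
    and e: "\<And>i. i < t \<Longrightarrow> {xs ! i, xs ! (Suc i mod t)} \<in> edges G"
  shows "copies (cycle_graph t) G \<noteq> {}"
proof -
  define E where "E = {{xs ! i, xs ! (Suc i mod t)} | i. i < t}"
  have t: "Suc i mod t < t" for i using xs by (intro mod_less_divisor) auto
  have E: "E \<subseteq> edges G" using e by (auto simp: E_def)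
  have "e' \<subseteq> set xs \<and> card e' = 2" if "e' \<in> E" for e'
  proof -
    have "card e' = 2" using that E G by (auto simp: simple_graph_def)
    thus ?thesis using that t xs(2) by (auto simp: E_def)
  qed
  hence s: "simple_graph (set xs, E)" by (auto simp: simple_graph_def)
  have "set xs \<subseteq> verts G"
  proof
    fix x assume "x \<in> set xs"
    then obtain i where "i < t" "x = xs ! i" using xs by (auto simp: in_set_conv_nth)
    thus "x \<in> verts G" using e[of i] G by (auto simp: simple_graph_def)
  qed
  hence "subgraph (set xs, E) G" using s E by (simp add: subgraph_def)
  moreover have "iso (cycle_graph t) (set xs, E)"
    unfolding iso_def
  proof (intro exI conjI)
    show "bij_betw ((!) xs) (verts (cycle_graph t)) (verts (set xs, E))"
      using bij_betw_nth[OF xs(1), of "{..<t}" "set xs"] xs(2) by (simp add: cycle_graph_def)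
    show "(\<lambda>e. (!) xs ` e) ` edges (cycle_graph t) = edges (set xs, E)"
    proof -
      have "(\<lambda>e. (!) xs ` e) ` {{i, Suc i mod t} | i. i < t} = {(!) xs ` {i, Suc i mod t} | i. i < t}" by blast
      thus ?thesis by (simp add: cycle_graph_def E_def)
    qed
  qed
  ultimately show ?thesis by (auto simp: copies_def)
qed

text \<open>In a longest path inside \<open>Z\<close>, all neighbours in \<open>Z\<close> of the
  first vertex lie on the path. One of two such neighbours is not the second vertex and closes a
  cycle.\<close>

lemma min_degree_two_cycle:
  assumes G: "simple_graph G" and Z: "finite Z" "Z \<noteq> {}" and d: "\<And>z. z \<in> Z \<Longrightarrow> 2 \<le> dg (nbr G) Z z"
  shows "\<exists>t\<ge>3. copies (cycle_graph t) G \<noteq> {}"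
proof -
  define P where "P xs \<longleftrightarrow> xs \<noteq> [] \<and> distinct xs \<and> set xs \<subseteq> Z \<and>
    (\<forall>i. Suc i < length xs \<longrightarrow> nbr G (xs ! i) (xs ! Suc i))" for xs
  obtain z where "z \<in> Z" using Z by auto
  hence P1: "P [z]" by (simp add: P_def)
  have "\<forall>xs. P xs \<longrightarrow> length xs < Suc (card Z)"
    using Z by (auto simp: P_def less_Suc_eq_le distinct_card[symmetric] intro: card_mono)
  from ex_has_greatest_nat[OF P1 this] obtain xs where
    P: "P xs" and max: "\<And>ys. P ys \<Longrightarrow> length ys \<le> length xs" by blast
  have h: "xs ! 0 \<in> Z" using P by (auto simp: P_def)
  have inxs: "a \<in> set xs" if "a \<in> Z" "nbr G (xs ! 0) a" for a
  proof (rule ccontr)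
    assume "a \<notin> set xs"
    hence "P (a # xs)" using P that
      by (auto simp: P_def nth_Cons insert_commute split: nat.splits)
    from max[OF this] show False by simp
  qed
  have "\<exists>a b. a \<noteq> b \<and> {a, b} \<subseteq> {y \<in> Z. nbr G (xs ! 0) y}"
  proof (rule ccontr)
    assume "\<not> ?thesis"
    hence "card {y \<in> Z. nbr G (xs ! 0) y} \<le> Suc 0"
      using Z by (subst card_le_Suc0_iff_eq) auto
    thus False using d[OF h] by (simp add: dg_def)
  qed
  then obtain a b where ab: "a \<noteq> b" "a \<in> Z" "b \<in> Z" "nbr G (xs ! 0) a" "nbr G (xs ! 0) b" by blast
  obtain i j where ij: "i < length xs" "xs ! i = a" "j < length xs" "xs ! j = b"
    using inxs[of a] inxs[of b] ab by (auto simp: in_set_conv_nth)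
  have "i \<noteq> 0" "j \<noteq> 0" "i \<noteq> j" using ij ab nbr_verts[OF G] by metis+
  then obtain k where k: "2 \<le> k" "k < length xs" "nbr G (xs ! 0) (xs ! k)"
    using ij ab by (cases "i \<ge> 2") (metis One_nat_def Suc_1 less_2_cases not_le)+
  have "copies (cycle_graph (Suc k)) G \<noteq> {}"
  proof (rule copies_cycle_graph_nonempty[OF G, of "take (Suc k) xs"])
    show "distinct (take (Suc k) xs)" using P by (simp add: P_def)
    show "length (take (Suc k) xs) = Suc k" "3 \<le> Suc k" using k by auto
    fix i assume i: "i < Suc k"
    show "{take (Suc k) xs ! i, take (Suc k) xs ! (Suc i mod Suc k)} \<in> edges G"
    proof (cases "i = k")
      case True
      thus ?thesis using k by (simp add: insert_commute)
    next
      case False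
      thus ?thesis using i k P by (simp add: P_def)
    qed
  qed
  thus ?thesis using k by (intro exI[of _ "Suc k"]) auto
qed

section \<open>Edge counts in forests\<close>

text \<open>Acyclicity as 1-degeneracy: it passes to subsets and allows vertices to be peeled off,
  without cycles as objects.\<close>

definition forest :: "('b \<Rightarrow> 'b \<Rightarrow> bool) \<Rightarrow> 'b set \<Rightarrow> bool" where
  "forest R V \<longleftrightarrow> finite V \<and> symp R \<and> irreflp R \<and> (\<forall>Z. Z \<noteq> {} \<and> Z \<subseteq> V \<longrightarrow> (\<exists>z\<in>Z. dg R Z z \<le> 1))"

lemma forest_leaf: "forest R V \<Longrightarrow> Z \<noteq> {} \<Longrightarrow> Z \<subseteq> V \<Longrightarrow> \<exists>z\<in>Z. dg R Z z \<le> 1"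
  by (simp add: forest_def)

lemma forest_tree: "tree T \<Longrightarrow> forest (nbr T) (verts T)"
  unfolding forest_def
proof (intro conjI allI impI)
  assume T: "tree T"
  hence G: "simple_graph T" by (simp add: tree_def)
  show fin: "finite (verts T)" using G by (simp add: simple_graph_def)
  show "symp (nbr T)" by (rule symp_nbr)
  show "irreflp (nbr T)" by (rule irreflp_nbr[OF G])
  fix Z assume Z: "Z \<noteq> {} \<and> Z \<subseteq> verts T"
  hence fZ: "finite Z" using fin finite_subset by blast
  show "\<exists>z\<in>Z. dg (nbr T) Z z \<le> 1"
  proof (rule ccontr)
    assume "\<not> ?thesis"
    hence "\<And>z. z \<in> Z \<Longrightarrow> 2 \<le> dg (nbr T) Z z" by (auto simp: not_le)
    from min_degree_two_cycle[OF G fZ _ this] show False using T Z by (auto simp: tree_def)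
  qed
qed

lemma sconn_tree: "tree T \<Longrightarrow> sconn (nbr T) (verts T)"
  unfolding sconn_def
proof (intro conjI ballI)
  assume T: "tree T"
  thus "verts T \<noteq> {}" by (simp add: tree_def connected_graph_def)
  have G: "simple_graph T" using T by (simp add: tree_def)
  fix x y assume xy: "x \<in> verts T" "y \<in> verts T"
  hence "(x, y) \<in> (adj T)\<^sup>*" using T by (auto simp: tree_def connected_graph_def)
  thus "(\<lambda>a b. a \<in> verts T \<and> b \<in> verts T \<and> nbr T a b)\<^sup>*\<^sup>* x y"
  proof (induction rule: rtrancl_induct)
    case (step y z)
    hence "nbr T y z" by (simp add: adj_def)
    thus ?case using step nbr_verts[OF G, of y z] by (auto intro: rtranclp.rtrancl_into_rtrancl)
  qed simp
qed

lemma degree_dg: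
  assumes "simple_graph G"
  shows "degree G v = dg (nbr G) (verts G) v"
proof -
  have "{e \<in> edges G. v \<in> e} = (\<lambda>u. {v, u}) ` {u \<in> verts G. nbr G v u}"
  proof (intro set_eqI iffI)
    fix e assume e: "e \<in> {e \<in> edges G. v \<in> e}"
    hence "card e = 2" "e \<subseteq> verts G" using assms by (auto simp: simple_graph_def)
    then obtain a b where "e = {a, b}" by (auto simp: card_2_iff)
    hence "\<exists>u. e = {v, u}" using e by auto
    thus "e \<in> (\<lambda>u. {v, u}) ` {u \<in> verts G. nbr G v u}" using e \<open>e \<subseteq> verts G\<close> by auto
  qed auto
  moreover have "inj_on (\<lambda>u. {v, u}) {u \<in> verts G. nbr G v u}"
    by (auto simp: inj_on_def doubleton_eq_iff)
  ultimately show ?thesis by (simp add: degree_def dg_def card_image)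
qed

lemma e2_insert:
  assumes "finite X" "y \<notin> X" "symp R" "irreflp R"
  shows "e2 R (insert y X) = e2 R X + 2 * dg R X y"
proof -
  have "{z \<in> insert y X. R y z} = {z \<in> X. R y z}" using assms(4) by (auto simp: irreflp_def)
  hence "dg R (insert y X) y = dg R X y" by (simp add: dg_def)
  thus ?thesis using e2_remove[of "insert y X" y R] assms by simp
qed

lemma forest_finite: "forest R V \<Longrightarrow> K \<subseteq> V \<Longrightarrow> finite K"
  by (auto simp: forest_def intro: finite_subset)

text \<open>Vertices of degree at most one are peeled off. The bound is the usual one, edges at most
  vertices minus one, doubled and free of subtraction.\<close>

lemma forest_e2_le:
  assumes "forest R V" "K \<subseteq> V" "K \<noteq> {}"
  shows "e2 R K + 2 \<le> 2 * card K"
  using assms(2,3)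
proof (induction "card K" arbitrary: K rule: less_induct)
  case less
  have R: "symp R" "irreflp R" using assms(1) by (auto simp: forest_def)
  have fK: "finite K" by (rule forest_finite[OF assms(1) less.prems(1)])
  obtain z where z: "z \<in> K" "dg R K z \<le> 1" using assms(1) less.prems by (auto simp: forest_def)
  have e: "e2 R K = e2 R (K - {z}) + 2 * dg R K z" by (rule e2_remove[OF fK z(1) R])
  have c: "card K = Suc (card (K - {z}))" using fK z by (metis card_Suc_Diff1)
  show ?case
  proof (cases "K - {z} = {}")
    case True
    hence "K = {z}" using z by auto
    hence "dg R K z = 0" using R by (auto simp: dg_def irreflp_def)
    thus ?thesis using e True c by (simp add: e2_def)
  next
    case False
    have "e2 R (K - {z}) + 2 \<le> 2 * card (K - {z})"
      by (rule less.hyps) (use c less.prems False in auto)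
    thus ?thesis using e c z(2) by simp
  qed
qed

text \<open>A subset grows from one vertex along cut edges, and each new vertex brings at least one
  edge.\<close>

lemma sconn_e2_ge:
  assumes R: "symp R" "irreflp R" and K: "finite K" "sconn R K"
  shows "2 * card K \<le> e2 R K + 2"
proof -
  have "\<exists>X\<subseteq>K. card X = m \<and> 2 * m \<le> e2 R X + 2" if "1 \<le> m" "m \<le> card K" for m
    using that
  proof (induction m rule: nat_induct_at_least)
    case base
    obtain r where "r \<in> K" using K(2) by (auto simp: sconn_def)
    thus ?case by (intro exI[of _ "{r}"]) auto
  next
    case (Suc m)
    then obtain X where X: "X \<subseteq> K" "card X = m" "2 * m \<le> e2 R X + 2" by auto
    have fX: "finite X" using X K finite_subset by blast
    have "X \<noteq> {}" "X \<noteq> K" using X Suc by auto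
    then obtain x y where xy: "x \<in> X" "y \<in> K - X" "R x y" using sconn_cut[OF K(2) X(1)] by metis
    have "0 < dg R X y" unfolding dg_def using xy fX R by (auto simp: card_gt_0_iff dest: sympD)
    thus ?case using X xy fX e2_insert[OF fX _ R, of y] by (intro exI[of _ "insert y X"]) auto
  qed
  from this[of "card K"] obtain X where "X \<subseteq> K" "card X = card K" "2 * card K \<le> e2 R X + 2"
    using K by (auto simp: sconn_def card_gt_0_iff Suc_le_eq)
  thus ?thesis using K(1) card_subset_eq by metis
qed

lemma forest_sconn_e2:
  assumes "forest R V" "K \<subseteq> V" "sconn R K"
  shows "e2 R K + 2 = 2 * card K"
  using forest_e2_le[OF assms(1,2)] sconn_e2_ge[of R K] assms forest_finite[OF assms(1,2)] sconn_nonempty[OF assms(3)]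
  by (auto simp: forest_def)

text \<open>Two edges from \<open>w\<close> into the connected set \<open>K\<close> would give
  \<open>insert w K\<close> more edges than a forest allows.\<close>

lemma forest_outside_degree:
  assumes "forest R V" "K \<subseteq> V" "sconn R K" "w \<in> V - K"
  shows "dg R K w \<le> 1"
proof -
  have fK: "finite K" by (rule forest_finite[OF assms(1,2)])
  have "e2 R (insert w K) + 2 \<le> 2 * card (insert w K)"
    by (rule forest_e2_le[OF assms(1)]) (use assms in auto)
  thus ?thesis using forest_sconn_e2[OF assms(1-3)] e2_insert[OF fK, of w R] assms fK
    by (auto simp: forest_def)
qed

lemma dg_le_1D: "dg R K w \<le> 1 \<Longrightarrow> finite K \<Longrightarrow> a \<in> K \<Longrightarrow> b \<in> K \<Longrightarrow> R w a \<Longrightarrow> R w b \<Longrightarrow> a = b"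
  unfolding dg_def using card_le_Suc0_iff_eq[of "{y \<in> K. R w y}"] by auto

text \<open>The last clause leaves no edges besides those to parents. Depth and parent order the
  planar drawing of the lower bound.\<close>

definition rooted :: "('b \<Rightarrow> 'b \<Rightarrow> bool) \<Rightarrow> 'b set \<Rightarrow> 'b \<Rightarrow> ('b \<Rightarrow> 'b) \<Rightarrow> ('b \<Rightarrow> nat) \<Rightarrow> bool" where
  "rooted R K r par dep \<longleftrightarrow> r \<in> K \<and> dep r = 0 \<and>
     (\<forall>v\<in>K - {r}. par v \<in> K \<and> R v (par v) \<and> dep v = Suc (dep (par v))) \<and>
     (\<forall>u\<in>K. \<forall>v\<in>K. R u v \<longrightarrow> u \<noteq> r \<and> v = par u \<or> v \<noteq> r \<and> u = par v)"

text \<open>The tree is grown along cut edges. A new vertex has a single neighbour in the connected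
  part already built, which becomes its parent.\<close>

lemma rooted_exists:
  assumes V: "forest R V" and K: "sconn R V" and r: "r \<in> V"
  obtains par dep where "rooted R V r par dep"
proof -
  have R: "symp R" "irreflp R" "finite V" using V by (auto simp: forest_def)
  have "\<exists>X\<subseteq>V. card X = m \<and> sconn R X \<and> (\<exists>par dep. rooted R X r par dep)" if "1 \<le> m" "m \<le> card V" for m
    using that
  proof (induction m rule: nat_induct_at_least)
    case base
    have "rooted R {r} r id (\<lambda>_. 0)" using R(2) by (auto simp: rooted_def irreflp_def)
    thus ?case using r sconn_singleton by (intro exI[of _ "{r}"]) auto
  next
    case (Suc m)
    then obtain X par dep where X: "X \<subseteq> V" "card X = m" "sconn R X" "rooted R X r par dep" by auto
    have fX: "finite X" using X R(3) finite_subset by blast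
    have "X \<noteq> {}" "X \<noteq> V" using X Suc by auto
    then obtain x y where xy: "x \<in> X" "y \<in> V - X" "R x y" using sconn_cut[OF K X(1)] by metis
    have yx: "R y x" using xy R by (auto dest: sympD)
    have only: "z = x" if "z \<in> X" "R y z \<or> R z y" for z
      using dg_le_1D[OF forest_outside_degree[OF V X(1,3) xy(2)] fX that(1) xy(1)] that(2) yx R(1)
      by (auto dest: sympD)
    have ry: "r \<noteq> y" "r \<in> X" using X(4) xy by (auto simp: rooted_def)
    have "rooted R (insert y X) r (par(y := x)) (dep(y := Suc (dep x)))"
      unfolding rooted_def
    proof (intro conjI ballI impI)
      show "r \<in> insert y X" "(dep(y := Suc (dep x))) r = 0" using ry X(4) by (auto simp: rooted_def)
      fix v assume v: "v \<in> insert y X - {r}"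
      have px: "par v \<in> X" if "v \<noteq> y" using X(4) v that by (auto simp: rooted_def)
      show "(par(y := x)) v \<in> insert y X" using px xy by auto
      show "R v ((par(y := x)) v)" using X(4) v yx by (auto simp: rooted_def)
      show "(dep(y := Suc (dep x))) v = Suc ((dep(y := Suc (dep x))) ((par(y := x)) v))"
        using X(4) v xy px by (auto simp: rooted_def)
    next
      fix u v assume uv: "u \<in> insert y X" "v \<in> insert y X" "R u v"
      have "\<not> R y y" using R(2) by (auto simp: irreflp_def)
      then consider "u = y" "v \<in> X" | "v = y" "u \<in> X" | "u \<in> X" "v \<in> X" "u \<noteq> y" "v \<noteq> y" using uv xy by blast
      thus "u \<noteq> r \<and> v = (par(y := x)) u \<or> v \<noteq> r \<and> u = (par(y := x)) v"
      proof cases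
        case 3
        thus ?thesis using X(4) uv by (auto simp: rooted_def)
      qed (use only uv ry in auto)
    qed
    moreover have "sconn R (insert y X)" by (rule sconn_insert[OF R(1) X(3)]) (use xy in \<open>auto simp: touches_def\<close>)
    ultimately show ?case using X xy fX by (intro exI[of _ "insert y X"]) auto
  qed
  from this[of "card V"] obtain X where X: "X \<subseteq> V" "card X = card V" "\<exists>par dep. rooted R X r par dep"
    using r R(3) by (auto simp: card_gt_0_iff Suc_le_eq)
  have "X = V" using X R(3) card_subset_eq by metis
  thus ?thesis using X that by blast
qed

section \<open>Boundaries of connected sets in a forest\<close>

definition boundary :: "('b \<Rightarrow> 'b \<Rightarrow> bool) \<Rightarrow> 'b set \<Rightarrow> 'b set \<Rightarrow> 'b set" where
  "boundary R V K = {w \<in> V - K. touches R K w}"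

text \<open>Edges leaving \<open>K\<close> correspond to boundary vertices, because a vertex outside
  has at most one neighbour in \<open>K\<close>; inside there are \<open>card K - 1\<close>
  edges.\<close>

lemma forest_degree_sum:
  assumes V: "forest R V" and K: "K \<subseteq> V" "sconn R K"
  shows "(\<Sum>x\<in>K. dg R V x) + 2 = 2 * card K + card (boundary R V K)"
proof -
  have R: "symp R" "irreflp R" "finite V" using V by (auto simp: forest_def)
  have fK: "finite K" using forest_finite V K by blast
  have "dg R V x = dg R K x + dg R (V - K) x" for x
    using dg_split[OF R(3), of R x K] K by (simp add: Int_absorb1)
  hence "(\<Sum>x\<in>K. dg R V x) = e2 R K + (\<Sum>x\<in>K. dg R (V - K) x)" by (simp add: e2_def sum.distrib)
  also have "(\<Sum>x\<in>K. dg R (V - K) x) = (\<Sum>w\<in>V - K. dg R K w)"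
  proof -
    have "R x w \<longleftrightarrow> R w x" for x w using R by (auto dest: sympD)
    thus ?thesis
      using sum.swap_restrict[OF fK, of "V - K" "\<lambda>_ _. 1::nat" R] R(3) by (simp add: dg_def)
  qed
  also have "\<dots> = (\<Sum>w\<in>V - K. if touches R K w then 1 else 0)"
  proof (rule sum.cong[OF refl])
    fix w assume w: "w \<in> V - K"
    have "dg R K w \<le> 1" by (rule forest_outside_degree[OF V K w])
    moreover have "0 < dg R K w \<longleftrightarrow> touches R K w"
      using fK R by (auto simp: dg_def touches_def card_gt_0_iff dest: sympD)
    ultimately show "dg R K w = (if touches R K w then 1 else 0)" by auto
  qed
  also have "\<dots> = card (boundary R V K)"
    using R(3) by (simp add: sum.If_cases boundary_def Int_def)
  finally show ?thesis using forest_sconn_e2[OF V K] by simp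
qed

text \<open>If all degrees on \<open>K\<close> are at least 2, the degree sum shows that the
  boundary has at least 2 vertices, and exactly 2 only if all degrees are 2.\<close>

lemma forest_subtree_cases:
  assumes V: "forest R V" and K: "K \<subseteq> V" "sconn R K"
  obtains (leaf) x where "x \<in> K" "dg R V x \<le> 1"
    | (branch) "3 \<le> card (boundary R V K)"
    | (path) "card (boundary R V K) = 2" "\<And>x. x \<in> K \<Longrightarrow> dg R V x = 2"
proof -
  have fK: "finite K" using forest_finite V K by blast
  have s: "(\<Sum>x\<in>K. dg R V x) + 2 = 2 * card K + card (boundary R V K)" by (rule forest_degree_sum[OF V K])
  have "(\<exists>x\<in>K. dg R V x \<le> 1) \<or> 3 \<le> card (boundary R V K) \<or>
    card (boundary R V K) = 2 \<and> (\<forall>x\<in>K. dg R V x = 2)"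
  proof (rule ccontr)
    assume n: "\<not> ?thesis"
    hence d: "2 \<le> dg R V x" if "x \<in> K" for x using that by force
    have "(\<Sum>x\<in>K. 2) \<le> (\<Sum>x\<in>K. dg R V x)" by (rule sum_mono) (rule d)
    hence b: "card (boundary R V K) = 2" using s n by simp
    then obtain x where x: "x \<in> K" "dg R V x \<noteq> 2" using n by auto
    have "(\<Sum>x\<in>K. 2) < (\<Sum>x\<in>K. dg R V x)"
      by (rule sum_strict_mono_ex1[OF fK]) (use d x in \<open>auto intro!: bexI[of _ x] simp: le_neq_implies_less\<close>)
    thus False using s b by simp
  qed
  thus ?thesis using that by blast
qed

definition induced_path :: "('b \<Rightarrow> 'b \<Rightarrow> bool) \<Rightarrow> 'b list \<Rightarrow> bool" where
  "induced_path R ys \<longleftrightarrow> distinct ys \<and> (\<forall>i. Suc i < length ys \<longrightarrow> R (ys ! i) (ys ! Suc i)) \<and>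
     (\<forall>i j. i < length ys \<and> j < length ys \<and> R (ys ! i) (ys ! j) \<longrightarrow> i = Suc j \<or> j = Suc i)"

lemma dg_ge_3:
  assumes "finite V" "{a, b, c} \<subseteq> V" "distinct [a, b, c]" "R x a" "R x b" "R x c"
  shows "3 \<le> dg R V x"
proof -
  have "card {a, b, c} \<le> card {y \<in> V. R x y}" using assms by (intro card_mono) auto
  thus ?thesis using assms by (simp add: dg_def)
qed

text \<open>The path starts at \<open>w\<close> and grows along edges to the rest of
  \<open>K\<close>. Such an edge leaves from the last vertex, as the earlier ones already have their
  two neighbours, and the new vertex has no other neighbour on the path, which is connected.\<close>

lemma degree_two_path:
  assumes V: "forest R V" and K: "K \<subseteq> V" "sconn R K" and d: "\<And>x. x \<in> K \<Longrightarrow> dg R V x = 2"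
    and w: "w \<in> boundary R V K"
  obtains xs where "set xs = K" "xs \<noteq> []" "induced_path R (w # xs)"
    "\<And>v. v \<in> boundary R V K \<Longrightarrow> v \<noteq> w \<Longrightarrow> R (last xs) v"
proof -
  have R: "symp R" "irreflp R" "finite V" using V by (auto simp: forest_def)
  have fK: "finite K" using forest_finite V K by blast
  have wK: "w \<in> V" "w \<notin> K" using w by (auto simp: boundary_def)
  have sy: "R a b \<Longrightarrow> R b a" for a b using R(1) by (auto dest: sympD)
  \<comment> \<open>\<open>(w # xs) ! i\<close> is the predecessor of \<open>xs ! i\<close>;
    together with the successor, \<open>y\<close> would be a third neighbour.\<close>
  have inner: False if xs: "induced_path R (w # xs)" "set xs \<subseteq> K" "Suc i < length xs"
    and y: "R (xs ! i) y" "y \<in> V" "y \<noteq> w" "y \<notin> set xs" for xs i y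
  proof -
    have "3 \<le> dg R V (xs ! i)"
    proof (rule dg_ge_3[OF R(3)])
      have ic: "\<And>i. i < length xs \<Longrightarrow> R ((w # xs) ! i) (xs ! i)" "distinct (w # xs)"
        using xs(1) by (auto simp: induced_path_def)
      show "R (xs ! i) ((w # xs) ! i)" using ic(1)[of i] xs sy by auto
      show "R (xs ! i) (xs ! Suc i)" using ic(1)[of "Suc i"] xs by auto
      show "R (xs ! i) y" by (rule y)
      have m: "(w # xs) ! i \<in> set (w # xs)" "xs ! Suc i \<in> set xs" using xs(3) nth_mem[of i "w # xs"] by auto
      thus "{(w # xs) ! i, xs ! Suc i, y} \<subseteq> V" using xs(2) K wK y by auto
      have "(w # xs) ! i \<noteq> (w # xs) ! Suc (Suc i)"
        using ic(2) xs(3) by (subst nth_eq_iff_index_eq) auto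
      thus "distinct [(w # xs) ! i, xs ! Suc i, y]" using m y by auto
    qed
    moreover have "xs ! i \<in> K" using xs by auto
    ultimately show False using d by force
  qed
  have "\<exists>xs. length xs = m \<and> set xs \<subseteq> K \<and> induced_path R (w # xs) \<and> sconn R (set (w # xs))"
    if "1 \<le> m" "m \<le> card K" for m
    using that
  proof (induction m rule: nat_induct_at_least)
    case base
    obtain k where k: "k \<in> K" "R k w" using w by (auto simp: boundary_def touches_def)
    have "\<not> R w w" "\<not> R k k" using R(2) by (auto simp: irreflp_def)
    hence "induced_path R [w, k]" using k wK sy by (auto simp: induced_path_def less_Suc_eq)
    moreover have "sconn R (insert w {k})"
      by (rule sconn_insert[OF R(1) sconn_singleton]) (use k in \<open>auto simp: touches_def\<close>)
    ultimately show ?case using k by (intro exI[of _ "[k]"]) auto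
  next
    case (Suc m)
    then obtain xs where xs: "length xs = m" "set xs \<subseteq> K" "induced_path R (w # xs)" "sconn R (set (w # xs))" by auto
    have dx: "distinct (w # xs)" using xs by (auto simp: induced_path_def)
    have "card (set xs) = m" using dx xs(1) distinct_card[of xs] by auto
    hence "set xs \<noteq> {}" "set xs \<noteq> K" using Suc by auto
    then obtain x y where xy: "x \<in> set xs" "y \<in> K - set xs" "R x y" using sconn_cut[OF K(2) xs(2)] by metis
    have yw: "y \<noteq> w" "y \<in> V" using xy wK K by auto
    obtain i where i: "i < m" "x = xs ! i" using xy xs(1) by (auto simp: in_set_conv_nth)
    have im: "m = Suc i" using inner[OF xs(3,2), of i y] xs(1) i xy yw by (metis DiffD2 Suc_lessI)
    have nth: "(w # xs @ [y]) ! j = (if j = Suc m then y else (w # xs) ! j)" if "j \<le> Suc m" for j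
      using that xs(1) by (auto simp: nth_Cons nth_append split: nat.splits)
    have only: "j = m" if j: "j \<le> m" "R y ((w # xs) ! j)" for j
    proof -
      have sub: "set (w # xs) \<subseteq> V" using xs(2) K wK by auto
      have yo: "y \<in> V - set (w # xs)" using xy yw by auto
      have "(w # xs) ! j = (w # xs) ! m"
      proof (rule dg_le_1D[OF forest_outside_degree[OF V sub xs(4) yo]])
        show "(w # xs) ! j \<in> set (w # xs)" "(w # xs) ! m \<in> set (w # xs)"
          using j xs(1) by (auto intro!: nth_mem simp del: set_simps)
        show "R y ((w # xs) ! m)" using xy i im sy by auto
      qed (use j in auto)
      thus ?thesis using dx j xs(1) by (subst (asm) nth_eq_iff_index_eq) auto
    qed
    have "induced_path R (w # xs @ [y])"
      unfolding induced_path_def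
    proof (intro conjI allI impI)
      show "distinct (w # xs @ [y])" using dx xy yw by auto
      fix j assume j: "Suc j < length (w # xs @ [y])"
      show "R ((w # xs @ [y]) ! j) ((w # xs @ [y]) ! Suc j)"
      proof (cases "j = m")
        case True
        thus ?thesis using nth[of m] nth[of "Suc m"] xy i im by simp
      next
        case False
        have "R ((w # xs) ! j) ((w # xs) ! Suc j)"
          using xs(1,3) j False unfolding induced_path_def by (simp del: nth_Cons_Suc)
        thus ?thesis using nth[of j] nth[of "Suc j"] j False xs(1) by simp
      qed
    next
      fix a b assume ab: "a < length (w # xs @ [y]) \<and> b < length (w # xs @ [y]) \<and> R ((w # xs @ [y]) ! a) ((w # xs @ [y]) ! b)"
      hence ab': "a \<le> Suc m" "b \<le> Suc m" "R ((w # xs @ [y]) ! a) ((w # xs @ [y]) ! b)" using xs(1) by auto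
      show "a = Suc b \<or> b = Suc a"
      proof (cases "a = Suc m"; cases "b = Suc m")
        assume "a = Suc m" "b = Suc m"
        thus ?thesis using ab' R(2) by (auto simp: irreflp_def)
      next
        assume "a = Suc m" "b \<noteq> Suc m"
        thus ?thesis using ab' nth[of a] nth[of b] only[of b] by simp
      next
        assume "a \<noteq> Suc m" "b = Suc m"
        thus ?thesis using ab' nth[of a] nth[of b] only[of a] sy by simp
      next
        assume "a \<noteq> Suc m" "b \<noteq> Suc m"
        thus ?thesis using ab' nth[of a] nth[of b] xs(1,3) unfolding induced_path_def by simp
      qed
    qed
    moreover have "sconn R (insert y (set (w # xs)))"
      by (rule sconn_insert[OF R(1) xs(4)]) (use xy in \<open>auto simp: touches_def\<close>)
    hence "sconn R (set (w # xs @ [y]))" by (simp add: insert_commute)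
    ultimately show ?case using xs xy by (intro exI[of _ "xs @ [y]"]) auto
  qed
  from this[of "card K"] obtain xs where xs: "length xs = card K" "set xs \<subseteq> K" "induced_path R (w # xs)"
    using K(2) fK by (auto simp: sconn_def card_gt_0_iff Suc_le_eq)
  have "card (set xs) = card K" using xs distinct_card[of xs] by (auto simp: induced_path_def)
  hence eq: "set xs = K" using xs fK card_subset_eq by metis
  show thesis
  proof (rule that[OF eq])
    show ne: "xs \<noteq> []" using eq sconn_nonempty[OF K(2)] by auto
    fix v assume v: "v \<in> boundary R V K" "v \<noteq> w"
    then obtain k where k: "k \<in> K" "R k v" "v \<in> V" "v \<notin> K" by (auto simp: boundary_def touches_def)
    obtain i where i: "i < length xs" "k = xs ! i" using k eq by (auto simp: in_set_conv_nth)
    have "\<not> Suc i < length xs" using inner[OF xs(3,2), of i v] k v i eq by auto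
    hence "i = length xs - 1" using i by auto
    thus "R (last xs) v" using k i ne by (simp add: last_conv_nth)
  qed (rule xs)
qed

section \<open>Lower bounds for the exponent\<close>

lemma adj_induced: "adj (induced H S) = {(u, v). u \<in> S \<and> v \<in> S \<and> nbr H u v}"
  by (auto simp: adj_def induced_def)

text \<open>A walk in the induced subgraph cannot leave a member of \<open>F\<close>, since
  \<open>sep\<close> excludes steps between different members; its case \<open>x = y\<close> makes
  them disjoint.\<close>

lemma components_of_family:
  assumes con: "\<And>C. C \<in> F \<Longrightarrow> sconn (nbr H) C"
    and sep: "\<And>C C' x y. C \<in> F \<Longrightarrow> C' \<in> F \<Longrightarrow> x \<in> C \<Longrightarrow> y \<in> C' \<Longrightarrow> x = y \<or> nbr H x y \<Longrightarrow> C = C'"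
  shows "components (induced H (\<Union>F)) = F"
proof -
  have comp: "{v. (u, v) \<in> (adj (induced H (\<Union>F)))\<^sup>*} = C" if C: "C \<in> F" "u \<in> C" for C u
  proof (intro set_eqI iffI)
    fix v assume "v \<in> {v. (u, v) \<in> (adj (induced H (\<Union>F)))\<^sup>*}"
    hence "(u, v) \<in> (adj (induced H (\<Union>F)))\<^sup>*" by simp
    thus "v \<in> C"
    proof (induction rule: rtrancl_induct)
      case (step y z)
      then obtain C' where "C' \<in> F" "z \<in> C'" "nbr H y z" by (auto simp: adj_induced)
      thus ?case using sep[of C C' y z] step C by auto
    qed (rule C)
  next
    fix v assume "v \<in> C"
    hence "(\<lambda>a b. a \<in> C \<and> b \<in> C \<and> nbr H a b)\<^sup>*\<^sup>* u v" using con C by (auto simp: sconn_def)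
    hence "(u, v) \<in> (adj (induced H (\<Union>F)))\<^sup>*"
    proof (induction rule: rtranclp_induct)
      case (step y z)
      hence "(y, z) \<in> adj (induced H (\<Union>F))" using C by (auto simp: adj_induced)
      thus ?case using step by (auto intro: rtrancl_into_rtrancl)
    qed simp
    thus "v \<in> {v. (u, v) \<in> (adj (induced H (\<Union>F)))\<^sup>*}" by simp
  qed
  have "verts (induced H (\<Union>F)) = \<Union>F" by (simp add: induced_def)
  hence "components (induced H (\<Union>F)) = {C. \<exists>u\<in>\<Union>F. C = {v. (u, v) \<in> (adj (induced H (\<Union>F)))\<^sup>*}}"
    by (auto simp: components_def)
  also have "\<dots> = F"
  proof (intro set_eqI iffI)
    fix C assume "C \<in> F"
    moreover obtain u where "u \<in> C" using con[OF \<open>C \<in> F\<close>] by (auto simp: sconn_def)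
    ultimately show "C \<in> {C. \<exists>u\<in>\<Union>F. C = {v. (u, v) \<in> (adj (induced H (\<Union>F)))\<^sup>*}}"
      using comp by auto
  qed (use comp in auto)
  finally show ?thesis .
qed

lemma finite_beta_set:
  "finite (verts H) \<Longrightarrow> finite {card (components (induced H S)) | S.
     S \<subseteq> verts H \<and> (\<forall>C\<in>components (induced H S). admissible_component i H C)}"
  by (rule finite_subset[of _ "(\<lambda>S. card (components (induced H S))) ` Pow (verts H)"]) auto

lemma beta_ge:
  assumes "finite (verts H)" and F: "\<And>C. C \<in> F \<Longrightarrow> C \<subseteq> verts H \<and> admissible_component i H C"
    and con: "\<And>C. C \<in> F \<Longrightarrow> sconn (nbr H) C"
    and sep: "\<And>C C' x y. C \<in> F \<Longrightarrow> C' \<in> F \<Longrightarrow> x \<in> C \<Longrightarrow> y \<in> C' \<Longrightarrow> x = y \<or> nbr H x y \<Longrightarrow> C = C'"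
  shows "card F \<le> beta i H"
  unfolding beta_def
proof (rule Max_ge[OF finite_beta_set[OF assms(1)]])
  have "components (induced H (\<Union>F)) = F" by (rule components_of_family[OF con sep])
  thus "card F \<in> {card (components (induced H S)) | S.
     S \<subseteq> verts H \<and> (\<forall>C\<in>components (induced H S). admissible_component i H C)}"
    using F by (intro CollectI exI[of _ "\<Union>F"]) auto
qed

lemma admissible_path:
  assumes G: "simple_graph H" and xs: "induced_path (nbr H) xs" "length xs = l"
    and d: "\<And>x. x \<in> set xs \<Longrightarrow> degree H x = 2"
  shows "admissible_component l H (set xs)"
proof -
  have "iso (path_graph l) (induced H (set xs))"
    unfolding iso_def
  proof (intro exI conjI)
    show "bij_betw ((!) xs) (verts (path_graph l)) (verts (induced H (set xs)))"
      using bij_betw_nth[of xs "{..<l}" "set xs"] xs by (simp add: path_graph_def induced_def induced_path_def)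
    show "(\<lambda>e. (!) xs ` e) ` edges (path_graph l) = edges (induced H (set xs))"
    proof (intro set_eqI iffI)
      fix e assume "e \<in> (\<lambda>e. (!) xs ` e) ` edges (path_graph l)"
      then obtain i where "Suc i < l" "e = {xs ! i, xs ! Suc i}" by (auto simp: path_graph_def)
      thus "e \<in> edges (induced H (set xs))" using xs by (auto simp: induced_def induced_path_def)
    next
      fix e assume e: "e \<in> edges (induced H (set xs))"
      hence e': "e \<in> edges H" "e \<subseteq> set xs" by (auto simp: induced_def)
      then obtain a b where "e = {a, b}" using G by (auto simp: simple_graph_def card_2_iff)
      then obtain i j where ij: "i < l" "j < l" "e = {xs ! i, xs ! j}"
        using e' xs(2) by (auto simp: in_set_conv_nth)
      hence "i = Suc j \<or> j = Suc i" using xs e' by (auto simp: induced_path_def)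
      hence "\<exists>i. Suc i < l \<and> e = (!) xs ` {i, Suc i}" using ij by (auto simp: insert_commute)
      thus "e \<in> (\<lambda>e. (!) xs ` e) ` edges (path_graph l)" by (unfold path_graph_def snd_conv, blast)
    qed
  qed
  thus ?thesis using d by (auto simp: admissible_component_def)
qed

lemma sconn_induced_path:
  assumes "symp R" "induced_path R xs" "xs \<noteq> []"
  shows "sconn R (set xs)"
proof (rule sconn_rootI[OF assms(1), of "xs ! 0"])
  let ?r = "\<lambda>a b. a \<in> set xs \<and> b \<in> set xs \<and> R a b"
  show "xs ! 0 \<in> set xs" using assms by simp
  have "?r\<^sup>*\<^sup>* (xs ! 0) (xs ! i)" if "i < length xs" for i
    using that
  proof (induction i)
    case (Suc i)
    hence "?r (xs ! i) (xs ! Suc i)" using assms(2) by (auto simp: induced_path_def)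
    thus ?case using Suc by (auto intro: rtranclp.rtrancl_into_rtrancl)
  qed simp
  thus "?r\<^sup>*\<^sup>* (xs ! 0) x" if "x \<in> set xs" for x using that by (auto simp: in_set_conv_nth)
qed

section \<open>The upper bound\<close>

lemma sconn_image:
  assumes "sconn R K" and f: "\<And>x y. x \<in> K \<Longrightarrow> y \<in> K \<Longrightarrow> R x y \<Longrightarrow> R' (f x) (f y)"
  shows "sconn R' (f ` K)"
  unfolding sconn_def
proof (intro conjI ballI)
  show "f ` K \<noteq> {}" using assms by (auto simp: sconn_def)
  fix a b assume "a \<in> f ` K" "b \<in> f ` K"
  then obtain x y where xy: "x \<in> K" "a = f x" "y \<in> K" "b = f y" by auto
  have "(\<lambda>a b. a \<in> K \<and> b \<in> K \<and> R a b)\<^sup>*\<^sup>* x y" using assms(1) xy by (auto simp: sconn_def)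
  hence "(\<lambda>a b. a \<in> f ` K \<and> b \<in> f ` K \<and> R' a b)\<^sup>*\<^sup>* (f x) (f y)"
  proof (induction rule: rtranclp_induct)
    case (step y z)
    thus ?case using f by (auto intro: rtranclp.rtrancl_into_rtrancl)
  qed simp
  thus "(\<lambda>a b. a \<in> f ` K \<and> b \<in> f ` K \<and> R' a b)\<^sup>*\<^sup>* a b" using xy by simp
qed

lemma closed_walk_cycle:
  assumes G: "simple_graph G" and ys: "successively (nbr G) ys" "distinct ys" "3 \<le> length ys"
    and cl: "nbr G (last ys) (hd ys)"
  shows "copies (cycle_graph (length ys)) G \<noteq> {}"
proof (rule copies_cycle_graph_nonempty[OF G ys(2) refl ys(3)])
  fix i assume i: "i < length ys"
  show "{ys ! i, ys ! (Suc i mod length ys)} \<in> edges G"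
  proof (cases "Suc i < length ys")
    case True
    thus ?thesis using ys(1) by (simp add: successively_conv_nth)
  next
    case False
    hence "Suc i = length ys" using i by simp
    moreover have "ys \<noteq> []" using i by auto
    moreover from calculation have "last ys = ys ! i" by (metis diff_Suc_1 last_conv_nth)
    ultimately show ?thesis using cl by (simp add: hd_conv_nth)
  qed
qed

text \<open>The homomorphisms are restricted to those compatible with a colouring of \<open>G\<close> by the vertices
  of \<open>T\<close>. Then images of distinct vertices under any two of them are distinct.\<close>

locale coloured_homs =
  fixes T :: "'a graph" and G :: "'b graph" and col :: "'b \<Rightarrow> 'a" and l :: nat
  assumes T: "tree T" and G: "simple_graph G" and k33: "k33_free (nbr G)"
    and l: "1 \<le> l" and even: "\<And>s. 2 \<le> s \<Longrightarrow> s \<le> l \<Longrightarrow> copies (cycle_graph (2 * s)) G = {}"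
begin

definition homs :: "('a \<Rightarrow> 'b) set" where
  "homs = {f \<in> verts T \<rightarrow>\<^sub>E verts G. (\<forall>v\<in>verts T. col (f v) = v) \<and>
     (\<forall>u v. nbr T u v \<longrightarrow> nbr G (f u) (f v))}"

definition arcs :: "('a \<Rightarrow> 'b) set \<Rightarrow> ('a \<times> 'a) set" where
  "arcs \<Phi> = {(u, v). nbr T u v \<and> (\<forall>f\<in>\<Phi>. \<forall>g\<in>\<Phi>. f u = g u \<longrightarrow> f v = g v)}"

abbreviation "refinable \<Phi> \<equiv> \<exists>\<kappa>. \<kappa> ` \<Phi> \<subseteq> {..<5277::nat} \<and> (\<forall>k. arcs \<Phi> \<subset> arcs {f \<in> \<Phi>. \<kappa> f = k})"

lemma sT: "simple_graph T" and finT: "finite (verts T)" and finG: "finite (verts G)"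
  using T G by (auto simp: tree_def simple_graph_def)

lemma homs_col: "f \<in> homs \<Longrightarrow> v \<in> verts T \<Longrightarrow> col (f v) = v"
  by (auto simp: homs_def)

lemma homs_nbr: "f \<in> homs \<Longrightarrow> nbr T u v \<Longrightarrow> nbr G (f u) (f v)"
  by (auto simp: homs_def)

lemma finite_homs: "\<Phi> \<subseteq> homs \<Longrightarrow> finite \<Phi>"
  by (rule finite_subset[of _ "verts T \<rightarrow>\<^sub>E verts G"]) (auto simp: homs_def finT finG intro: finite_PiE)

lemma homs_eq: "f \<in> homs \<Longrightarrow> g \<in> homs \<Longrightarrow> x \<in> verts T \<Longrightarrow> y \<in> verts T \<Longrightarrow> f x = g y \<Longrightarrow> x = y"
  using homs_col by metis

section \<open>Splitting by bounded choices\<close>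

text \<open>The set \<open>S (p f)\<close> chooses one of its members, with a label. A class fixes
  the label and the vertex \<open>w\<close> whose image was chosen. There \<open>f w\<close>
  determines \<open>p f\<close>, and both determine \<open>f (v w)\<close>, so
  \<open>(w, v w)\<close> becomes an arc.\<close>

lemma refine_by_choice:
  fixes p :: "('a \<Rightarrow> 'b) \<Rightarrow> 'i" and b c :: nat
  assumes \<Phi>: "\<Phi> \<subseteq> homs" and W: "W \<subseteq> verts T" "W \<noteq> {}" "card W \<le> b"
    and S: "\<And>f. f \<in> \<Phi> \<Longrightarrow> S (p f) = f ` W"
    and sparse: "\<And>J. J \<subseteq> p ` \<Phi> \<Longrightarrow> card J \<le> c * card (\<Union>i\<in>J. S i)"
    and arc: "\<And>w. w \<in> W \<Longrightarrow> nbr T w (v w) \<and> (w, v w) \<notin> arcs \<Phi>"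
    and det: "\<And>w f g. w \<in> W \<Longrightarrow> f \<in> \<Phi> \<Longrightarrow> g \<in> \<Phi> \<Longrightarrow> p f = p g \<Longrightarrow> f w = g w \<Longrightarrow> f (v w) = g (v w)"
    and bc: "Suc (b * c) * b \<le> 5277"
  shows "refinable \<Phi>"
proof -
  have fW: "finite W" using W finT finite_subset by blast
  have "\<exists>\<phi> lab. (\<forall>i\<in>p ` \<Phi>. \<phi> i \<in> S i \<and> lab i < Suc (b * c)) \<and> inj_on (\<lambda>i. (\<phi> i, lab i :: nat)) (p ` \<Phi>)"
  proof (rule bounded_choice[OF _ _ sparse])
    show "finite (p ` \<Phi>)" using finite_homs[OF \<Phi>] by simp
    fix i assume "i \<in> p ` \<Phi>"
    then obtain f where "f \<in> \<Phi>" "i = p f" by auto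
    hence "S i = f ` W" using S by auto
    thus "finite (S i) \<and> card (S i) \<le> b \<and> S i \<noteq> {}"
      using fW W card_image_le[OF fW, of f] by auto
  qed
  then obtain \<phi> lab where pl: "\<forall>i\<in>p ` \<Phi>. \<phi> i \<in> S i \<and> lab i < Suc (b * c)"
    and inj: "inj_on (\<lambda>i. (\<phi> i, lab i :: nat)) (p ` \<Phi>)" by blast
  have ph: "\<And>f. f \<in> \<Phi> \<Longrightarrow> \<phi> (p f) \<in> f ` W" "\<And>f. f \<in> \<Phi> \<Longrightarrow> lab (p f) < Suc (b * c)"
    using pl S by auto
  obtain idx where bij: "bij_betw idx W {0..<card W}" using ex_bij_betw_finite_nat[OF fW] by auto
  hence idx: "inj_on idx W" "\<And>w. w \<in> W \<Longrightarrow> idx w < b"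
    using W(3) bij_betwE[OF bij] by (auto simp: bij_betw_def)
  \<comment> \<open>Label and chosen vertex form a two-digit number with last digit below
    \<open>b\<close>, hence the bound \<open>Suc (b * c) * b\<close>. The colour reveals the
    vertex.\<close>
  define \<kappa> where "\<kappa> f = lab (p f) * b + idx (col (\<phi> (p f)))" for f
  have cw: "col (\<phi> (p f)) \<in> W" "\<phi> (p f) = f (col (\<phi> (p f)))" if "f \<in> \<Phi>" for f
  proof -
    obtain w where w: "\<phi> (p f) = f w" "w \<in> W" using ph(1)[OF \<open>f \<in> \<Phi>\<close>] by (rule imageE)
    have "f \<in> homs" using that \<Phi> by auto
    hence "col (\<phi> (p f)) = w" using w W homs_col[of f w] by auto
    thus "col (\<phi> (p f)) \<in> W" "\<phi> (p f) = f (col (\<phi> (p f)))" using w by auto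
  qed
  have "\<kappa> ` \<Phi> \<subseteq> {..<5277}"
  proof
    fix k assume "k \<in> \<kappa> ` \<Phi>"
    then obtain f where f: "f \<in> \<Phi>" "k = \<kappa> f" by auto
    have "lab (p f) * b \<le> (b * c) * b" using ph(2)[OF f(1)] by (intro mult_le_mono) auto
    hence "k < Suc (b * c) * b" using idx(2)[OF cw(1)[OF f(1)]] f(2) unfolding \<kappa>_def mult_Suc by linarith
    thus "k \<in> {..<5277}" using bc by simp
  qed
  moreover have "arcs \<Phi> \<subset> arcs {f \<in> \<Phi>. \<kappa> f = k}" for k
  proof -
    let ?\<Psi> = "{f \<in> \<Phi>. \<kappa> f = k}"
    have "arcs \<Phi> \<subseteq> arcs ?\<Psi>" by (auto simp: arcs_def)
    moreover have "\<exists>w\<in>W. (w, v w) \<in> arcs ?\<Psi>"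
    proof (cases "?\<Psi> = {}")
      case True
      obtain w where "w \<in> W" using W by auto
      moreover have "(w, v w) \<in> arcs ?\<Psi>" unfolding True using arc[OF \<open>w \<in> W\<close>] by (simp add: arcs_def)
      ultimately show ?thesis by blast
    next
      case False
      then obtain h where h: "h \<in> \<Phi>" "\<kappa> h = k" by auto
      define w where "w = col (\<phi> (p h))"
      have w: "w \<in> W" using cw h by (simp add: w_def)
      have same: "col (\<phi> (p f)) = w \<and> lab (p f) = lab (p h)" if "f \<in> ?\<Psi>" for f
      proof -
        have "idx (col (\<phi> (p f))) < b" "idx (col (\<phi> (p h))) < b" using idx(2) cw(1) that h by auto
        moreover have "lab (p f) * b + idx (col (\<phi> (p f))) = lab (p h) * b + idx (col (\<phi> (p h)))"
          using that h by (simp add: \<kappa>_def)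
        ultimately have "lab (p f) = lab (p h) \<and> idx (col (\<phi> (p f))) = idx (col (\<phi> (p h)))"
          by (metis add.commute add_right_cancel div_mult_self1 div_less add_0 less_nat_zero_code)
        thus ?thesis using inj_onD[OF idx(1)] cw(1) that h by (auto simp: w_def)
      qed
      have "f (v w) = g (v w)" if fg: "f \<in> ?\<Psi>" "g \<in> ?\<Psi>" "f w = g w" for f g
      proof -
        have "\<phi> (p f) = \<phi> (p g)" "lab (p f) = lab (p g)"
          using same[OF fg(1)] same[OF fg(2)] cw(2)[of f] cw(2)[of g] fg by auto
        hence "p f = p g" using inj_onD[OF inj, of "p f" "p g"] fg by auto
        thus ?thesis using det[OF w, of f g] fg by auto
      qed
      hence "(w, v w) \<in> arcs ?\<Psi>" using arc[OF w] by (simp add: arcs_def)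
      thus ?thesis using w by blast
    qed
    ultimately show ?thesis using arc by blast
  qed
  ultimately show ?thesis by blast
qed

text \<open>Here \<open>p f\<close> is the image of the edge itself. The choice orients edges of
  \<open>G\<close> with bounded outdegree, so that in a class one end of the image edge determines
  the other.\<close>

lemma refine_undirected_edge:
  assumes \<Phi>: "\<Phi> \<subseteq> homs" and e: "nbr T u v" "(u, v) \<notin> arcs \<Phi>" "(v, u) \<notin> arcs \<Phi>"
  shows "refinable \<Phi>"
proof (rule refine_by_choice[OF \<Phi>, of "{u, v}" 2 "\<lambda>X. X" "\<lambda>f. f ` {u, v}" 8 "\<lambda>w. if w = u then v else u"])
  have uv: "u \<in> verts T" "v \<in> verts T" "u \<noteq> v" using nbr_verts[OF sT e(1)] by auto
  show "{u, v} \<subseteq> verts T" "{u, v} \<noteq> {}" "card {u, v} \<le> 2" using uv by auto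
  show "f ` {u, v} = f ` {u, v}" for f :: "'a \<Rightarrow> 'b" by (rule refl)
  show "Suc (2 * 8) * 2 \<le> (5277::nat)" by simp
  show "nbr T w (if w = u then v else u) \<and> (w, if w = u then v else u) \<notin> arcs \<Phi>" if "w \<in> {u, v}" for w
    using that e uv by (auto simp: insert_commute)
  show "f (if w = u then v else u) = g (if w = u then v else u)"
    if "w \<in> {u, v}" "f \<in> \<Phi>" "g \<in> \<Phi>" "f ` {u, v} = g ` {u, v}" "f w = g w" for w f g
    using that(1,4,5) uv by (auto simp: doubleton_eq_iff)
  fix J assume J: "J \<subseteq> (\<lambda>f. f ` {u, v}) ` \<Phi>"
  have JE: "J \<subseteq> edges G" using J homs_nbr e(1) \<Phi> by fastforce
  have sub: "\<Union>J \<subseteq> verts G" using JE G by (auto simp: simple_graph_def)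
  have fU: "finite (\<Union>J)" by (rule finite_subset[OF sub finG])
  have fJ: "finite J" using fU finite_UnionD by blast
  show "card J \<le> 8 * card (\<Union>i\<in>J. i)"
  proof (cases "J = {}")
    case False
    have c2: "card j = 2" if "j \<in> J" for j using that JE G by (auto simp: simple_graph_def)
    have ne: "\<Union>J \<noteq> {}"
    proof
      assume "\<Union>J = {}"
      moreover obtain j where "j \<in> J" using False by auto
      ultimately have "j = {}" by auto
      thus False using c2[OF \<open>j \<in> J\<close>] by simp
    qed
    have "2 * card J \<le> e2 (nbr G) (\<Union>J)"
      by (rule card_pairs_le_e2[OF fJ fU, of "\<lambda>j. j"]) (use c2 JE in auto)
    also have "\<dots> < 16 * card (\<Union>J)"
      by (rule k33_free_e2[OF k33 symp_nbr irreflp_nbr[OF G] fU ne])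
    finally show ?thesis by simp
  qed simp
qed

section \<open>Source components of the digraph of arcs\<close>

definition total :: "('a \<Rightarrow> 'b) set \<Rightarrow> bool" where
  "total \<Phi> \<longleftrightarrow> (\<forall>u v. nbr T u v \<longrightarrow> (u, v) \<in> arcs \<Phi> \<or> (v, u) \<in> arcs \<Phi>)"

definition above :: "('a \<Rightarrow> 'b) set \<Rightarrow> 'a \<Rightarrow> 'a set" where
  "above \<Phi> x = {y. (y, x) \<in> (arcs \<Phi>)\<^sup>*}"

text \<open>For such \<open>x\<close>, \<open>above \<Phi> x\<close> is the strong component of
  \<open>x\<close>, and no arc enters it.\<close>

definition source :: "('a \<Rightarrow> 'b) set \<Rightarrow> 'a \<Rightarrow> bool" where
  "source \<Phi> x \<longleftrightarrow> x \<in> verts T \<and> (\<forall>y\<in>above \<Phi> x. (x, y) \<in> (arcs \<Phi>)\<^sup>*)"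

lemma arcs_nbr: "(u, v) \<in> arcs \<Phi> \<Longrightarrow> nbr T u v"
  by (auto simp: arcs_def)

lemma reach_determines:
  assumes "(x, y) \<in> (arcs \<Phi>)\<^sup>*" "f \<in> \<Phi>" "g \<in> \<Phi>" "f x = g x"
  shows "f y = g y"
  using assms(1)
proof (induction rule: rtrancl_induct)
  case (step y z)
  thus ?case using assms by (auto simp: arcs_def)
qed (rule assms)

lemma above_refl: "x \<in> above \<Phi> x"
  by (simp add: above_def)

lemma above_verts: "x \<in> verts T \<Longrightarrow> above \<Phi> x \<subseteq> verts T"
proof
  fix y assume x: "x \<in> verts T" and "y \<in> above \<Phi> x"
  hence "(y, x) \<in> (arcs \<Phi>)\<^sup>*" by (simp add: above_def)
  thus "y \<in> verts T"
    by (cases rule: converse_rtranclE) (use x arcs_nbr nbr_verts[OF sT] in blast)+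
qed

lemma sconn_above: "sconn (nbr T) (above \<Phi> x)"
proof (rule sconn_rootI[OF symp_nbr above_refl])
  let ?r = "\<lambda>a b. a \<in> above \<Phi> x \<and> b \<in> above \<Phi> x \<and> nbr T a b"
  fix y assume "y \<in> above \<Phi> x"
  hence "(y, x) \<in> (arcs \<Phi>)\<^sup>*" by (simp add: above_def)
  thus "?r\<^sup>*\<^sup>* x y"
  proof (induction rule: converse_rtrancl_induct)
    case (step y z)
    have "y \<in> above \<Phi> x" "z \<in> above \<Phi> x"
      using step by (auto simp: above_def intro: converse_rtrancl_into_rtrancl)
    hence "?r z y" using arcs_nbr[OF step(1)] by (simp add: insert_commute)
    thus ?case using step(3) by (rule rtranclp.rtrancl_into_rtrancl[rotated])
  qed simp
qed

lemma above_no_entry: "k \<in> above \<Phi> x \<Longrightarrow> w \<notin> above \<Phi> x \<Longrightarrow> (w, k) \<notin> arcs \<Phi>"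
  by (auto simp: above_def intro: converse_rtrancl_into_rtrancl)

lemma source_determines:
  assumes "source \<Phi> x" "y \<in> above \<Phi> x" "z \<in> above \<Phi> x" "f \<in> \<Phi>" "g \<in> \<Phi>" "f y = g y"
  shows "f z = g z"
proof -
  have "(y, x) \<in> (arcs \<Phi>)\<^sup>*" "(x, z) \<in> (arcs \<Phi>)\<^sup>*" using assms by (auto simp: source_def above_def)
  thus ?thesis using reach_determines assms by (meson rtrancl_trans)
qed

text \<open>Among the vertices that reach \<open>v\<close>, one with the fewest ancestors qualifies:
  each of its ancestors must have the same ancestors.\<close>

lemma source_exists:
  assumes "v \<in> verts T"
  obtains x where "source \<Phi> x" "(x, v) \<in> (arcs \<Phi>)\<^sup>*"
proof -
  have "(v, v) \<in> (arcs \<Phi>)\<^sup>*" by simp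
  then obtain x where x: "(x, v) \<in> (arcs \<Phi>)\<^sup>*"
    and min: "\<And>y. (y, v) \<in> (arcs \<Phi>)\<^sup>* \<Longrightarrow> card (above \<Phi> x) \<le> card (above \<Phi> y)"
    using ex_has_least_nat[of "\<lambda>x. (x, v) \<in> (arcs \<Phi>)\<^sup>*" v "\<lambda>x. card (above \<Phi> x)"] by blast
  have "x \<in> above \<Phi> v" using x by (simp add: above_def)
  hence xT: "x \<in> verts T" using above_verts[OF assms] by auto
  have "(x, y) \<in> (arcs \<Phi>)\<^sup>*" if y: "y \<in> above \<Phi> x" for y
  proof -
    have "above \<Phi> y \<subseteq> above \<Phi> x" using y by (auto simp: above_def intro: rtrancl_trans)
    moreover have "card (above \<Phi> x) \<le> card (above \<Phi> y)"
      using min[of y] y x by (auto simp: above_def intro: rtrancl_trans)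
    moreover have "finite (above \<Phi> x)" using above_verts[OF xT] finT finite_subset by blast
    ultimately have "above \<Phi> y = above \<Phi> x" by (metis card_seteq)
    thus ?thesis using above_refl[of x \<Phi>] by (auto simp: above_def)
  qed
  hence "source \<Phi> x" using xT by (simp add: source_def)
  thus ?thesis using x that by blast
qed

text \<open>The images of the source component \<open>K\<close> are disjoint connected sets, one for each value at \<open>x\<close>,
  and each is joined to the images of the boundary vertices of \<open>K\<close>.\<close>

lemma refine_source:
  assumes \<Phi>: "\<Phi> \<subseteq> homs" and tot: "total \<Phi>" and x: "source \<Phi> x" and K: "K = above \<Phi> x"
    and W: "W \<subseteq> boundary (nbr T) (verts T) K" "W \<noteq> {}"
    and count: "\<And>J A g. finite J \<Longrightarrow> (\<And>i. i \<in> J \<Longrightarrow> \<exists>f\<in>\<Phi>. f x = i \<and> A i = f ` K \<and> g i = f ` W) \<Longrightarrow>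
      (\<And>i. i \<in> J \<Longrightarrow> sconn (nbr G) (A i)) \<Longrightarrow>
      (\<And>i j. i \<in> J \<Longrightarrow> j \<in> J \<Longrightarrow> i \<noteq> j \<Longrightarrow> A i \<inter> A j = {}) \<Longrightarrow>
      (\<And>i. i \<in> J \<Longrightarrow> A i \<inter> (\<Union>i\<in>J. g i) = {}) \<Longrightarrow> finite (\<Union>i\<in>J. g i) \<Longrightarrow>
      (\<And>i y. i \<in> J \<Longrightarrow> y \<in> g i \<Longrightarrow> touches (nbr G) (A i) y) \<Longrightarrow>
      (\<And>i. i \<in> J \<Longrightarrow> card (g i) = card W) \<Longrightarrow> card J \<le> c * card (\<Union>i\<in>J. g i)"
    and bc: "Suc (card W * c) * card W \<le> 5277"
  shows "refinable \<Phi>"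
proof -
  have xT: "x \<in> verts T" using x by (simp add: source_def)
  have KT: "K \<subseteq> verts T" using above_verts[OF xT] K by simp
  have WT: "W \<subseteq> verts T" "W \<inter> K = {}" using W by (auto simp: boundary_def)
  have fW: "finite W" using WT finT finite_subset by blast
  have "\<forall>w\<in>W. \<exists>k\<in>K. nbr T k w" using W by (auto simp: boundary_def touches_def)
  then obtain v where v: "\<And>w. w \<in> W \<Longrightarrow> v w \<in> K \<and> nbr T (v w) w" by metis
  define F where "F i = (SOME f. f \<in> \<Phi> \<and> f x = i)" for i
  have F: "F i \<in> \<Phi>" "F i x = i" if "i \<in> (\<lambda>f. f x) ` \<Phi>" for i
  proof -
    have "\<exists>f. f \<in> \<Phi> \<and> f x = i" using that by auto
    from someI_ex[OF this] show "F i \<in> \<Phi>" "F i x = i" by (auto simp: F_def)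
  qed
  have detK: "f z = g z" if "f \<in> \<Phi>" "g \<in> \<Phi>" "f y = g y" "y \<in> K" "z \<in> K" for f g y z
    using source_determines[OF x, of y z f g] that K by auto
  \<comment> \<open>No arc enters a set \<open>above \<Phi> x\<close>, so \<open>tot\<close> directs
    its boundary edges outwards. The missing arcs \<open>(w, v w)\<close> are the ones a split can
    gain.\<close>
  have vw: "(v w, w) \<in> arcs \<Phi>" "(w, v w) \<notin> arcs \<Phi>" if w: "w \<in> W" for w
  proof -
    have k: "v w \<in> above \<Phi> x" "w \<notin> above \<Phi> x" using v[OF w] w WT K by auto
    show "(w, v w) \<notin> arcs \<Phi>" by (rule above_no_entry[OF k])
    thus "(v w, w) \<in> arcs \<Phi>" using tot v[OF w] by (auto simp: total_def)
  qed
  have xK: "x \<in> K" using above_refl K by simp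
  have detW: "f w = g w" if "f \<in> \<Phi>" "g \<in> \<Phi>" "f x = g x" "w \<in> W" for f g w
    using detK[OF that(1-3) xK, of "v w"] v[OF that(4)] vw(1)[OF that(4)] that by (auto simp: arcs_def)
  \<comment> \<open>By \<open>detW\<close> the images of \<open>W\<close> depend only on the value
    at \<open>x\<close>, so a representative \<open>F i\<close> suffices.\<close>
  define S where "S i = F i ` W" for i
  show ?thesis
  proof (rule refine_by_choice[OF \<Phi> WT(1) W(2) le_refl, of S "\<lambda>f. f x" c v])
    show "S (f x) = f ` W" if "f \<in> \<Phi>" for f
    proof -
      have "F (f x) w = f w" if "w \<in> W" for w
        using detW[of "F (f x)" f w] F[of "f x"] \<open>f \<in> \<Phi>\<close> that by auto
      thus ?thesis by (auto simp: S_def)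
    qed
    show "nbr T w (v w) \<and> (w, v w) \<notin> arcs \<Phi>" if "w \<in> W" for w
      using v[OF that] vw[OF that] by (simp add: insert_commute)
    show "f (v w) = g (v w)" if "w \<in> W" "f \<in> \<Phi>" "g \<in> \<Phi>" "f x = g x" "f w = g w" for w f g
      using detK[OF that(2,3,4) xK, of "v w"] v[OF that(1)] by auto
    show "Suc (card W * c) * card W \<le> 5277" by (rule bc)
    fix J assume J: "J \<subseteq> (\<lambda>f. f x) ` \<Phi>"
    have FJ: "F i \<in> \<Phi>" "F i x = i" "F i \<in> homs" if "i \<in> J" for i using F[of i] J that \<Phi> by auto
    have fJ: "finite J" using J finite_homs[OF \<Phi>] finite_subset by blast
    show "card J \<le> c * card (\<Union>i\<in>J. S i)"
    proof (rule count[OF fJ, of "\<lambda>i. F i ` K"])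
      show "\<exists>f\<in>\<Phi>. f x = i \<and> F i ` K = f ` K \<and> S i = f ` W" if "i \<in> J" for i
        using FJ[OF that] by (auto simp: S_def)
      show "sconn (nbr G) (F i ` K)" if "i \<in> J" for i
        by (rule sconn_image[OF sconn_above[of \<Phi> x, folded K]]) (rule homs_nbr[OF FJ(3)[OF that]])
      show "F i ` K \<inter> F j ` K = {}" if ij: "i \<in> J" "j \<in> J" "i \<noteq> j" for i j
      proof -
        have False if y: "y \<in> K" "z \<in> K" "F i y = F j z" for y z
        proof -
          \<comment> \<open>The colour identifies the vertex, and a common value there forces a
            common value at \<open>x\<close>.\<close>
          have "y = z" using homs_eq[OF FJ(3)[OF ij(1)] FJ(3)[OF ij(2)] _ _ y(3)] y KT by auto
          hence "F i x = F j x" using detK[OF FJ(1)[OF ij(1)] FJ(1)[OF ij(2)] _ y(1) xK] y by auto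
          thus False using FJ(2) ij by metis
        qed
        thus ?thesis by blast
      qed
      show "F i ` K \<inter> (\<Union>j\<in>J. S j) = {}" if i: "i \<in> J" for i
      proof -
        have False if y: "y \<in> K" "w \<in> W" "j \<in> J" "F i y = F j w" for y w j
          using homs_eq[OF FJ(3)[OF i] FJ(3)[OF y(3)] _ _ y(4)] y KT WT by blast
        thus ?thesis by (auto simp: S_def)
      qed
      show "finite (\<Union>i\<in>J. S i)" using fJ fW by (auto simp: S_def)
      show "touches (nbr G) (F i ` K) y" if iy: "i \<in> J" "y \<in> S i" for i y
      proof -
        obtain w where w: "w \<in> W" "y = F i w" using iy by (auto simp: S_def)
        have "nbr G (F i (v w)) (F i w)" by (rule homs_nbr[OF FJ(3)[OF iy(1)]]) (use v w in auto)
        thus ?thesis using v[OF w(1)] w by (auto simp: touches_def)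
      qed
      show "card (S i) = card W" if "i \<in> J" for i
        unfolding S_def by (rule card_image) (use homs_eq[OF FJ(3)[OF that] FJ(3)[OF that]] WT in \<open>auto simp: inj_on_def\<close>)
    qed
  qed
qed

text \<open>Any three boundary vertices will do: \<open>connected_sets_triples\<close> allows
  different values at \<open>x\<close> to have the same triple of boundary images.\<close>

lemma refine_branching_source:
  assumes \<Phi>: "\<Phi> \<subseteq> homs" "total \<Phi>" "source \<Phi> x"
    and b: "3 \<le> card (boundary (nbr T) (verts T) (above \<Phi> x))"
  shows "refinable \<Phi>"
proof -
  obtain W where W: "W \<subseteq> boundary (nbr T) (verts T) (above \<Phi> x)" "card W = 3"
    using obtain_subset_with_card_n[OF b] by metis
  show ?thesis
  proof (rule refine_source[OF \<Phi> refl W(1), where c = 586])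
    show "W \<noteq> {}" using W by auto
    show "Suc (card W * 586) * card W \<le> 5277" using W by simp
    fix J :: "'b set" and A g
    assume a: "finite J" "\<And>i. i \<in> J \<Longrightarrow> sconn (nbr G) (A i)"
      "\<And>i j. i \<in> J \<Longrightarrow> j \<in> J \<Longrightarrow> i \<noteq> j \<Longrightarrow> A i \<inter> A j = {}"
      "\<And>i. i \<in> J \<Longrightarrow> A i \<inter> (\<Union>i\<in>J. g i) = {}" "finite (\<Union>i\<in>J. g i)"
      "\<And>i y. i \<in> J \<Longrightarrow> y \<in> g i \<Longrightarrow> touches (nbr G) (A i) y"
      "\<And>i. i \<in> J \<Longrightarrow> card (g i) = card W"
    show "card J \<le> 586 * card (\<Union>i\<in>J. g i)"
      by (rule connected_sets_triples[OF k33 symp_nbr a(1,5,2,3,4,6)]) (use a(7) W in auto)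
  qed
qed

text \<open>If two values at \<open>x\<close> had the same pair of boundary images, the two disjoint
  images of the path would close up to a cycle of length \<open>2 * Suc (card K)\<close>, which is
  at most \<open>2 * l\<close>. So the pairs are distinct and \<open>connected_sets_pairs\<close>
  applies.\<close>

lemma refine_short_source:
  assumes \<Phi>: "\<Phi> \<subseteq> homs" "total \<Phi>" "source \<Phi> x" and K: "K = above \<Phi> x"
    and b: "card (boundary (nbr T) (verts T) K) = 2" and d: "\<And>y. y \<in> K \<Longrightarrow> dg (nbr T) (verts T) y = 2"
    and lt: "card K < l"
  shows "refinable \<Phi>"
proof -
  obtain w1 w2 where w: "boundary (nbr T) (verts T) K = {w1, w2}" "w1 \<noteq> w2"
    using b by (auto simp: card_2_iff)
  have xT: "x \<in> verts T" using \<Phi> by (simp add: source_def)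
  have KT: "K \<subseteq> verts T" using above_verts[OF xT] K by simp
  have wT: "w1 \<in> verts T" "w2 \<in> verts T" "w1 \<notin> K" "w2 \<notin> K" using w(1) by (auto simp: boundary_def)
  have cK: "sconn (nbr T) K" using sconn_above K by simp
  obtain xs where xs: "set xs = K" "xs \<noteq> []" "induced_path (nbr T) (w1 # xs)" "nbr T (last xs) w2"
  proof (rule degree_two_path[OF forest_tree[OF T] KT cK d, of w1])
    show "w1 \<in> boundary (nbr T) (verts T) K" using w by simp
    fix xs assume xs: "set xs = K" "xs \<noteq> []" "induced_path (nbr T) (w1 # xs)"
      "\<And>v. v \<in> boundary (nbr T) (verts T) K \<Longrightarrow> v \<noteq> w1 \<Longrightarrow> nbr T (last xs) v"
    show thesis by (rule that[OF xs(1-3) xs(4)]) (use w in auto)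
  qed
  have dxs: "distinct xs" "successively (nbr T) (w1 # xs)"
    using xs(3) by (auto simp: induced_path_def successively_conv_nth)
  show ?thesis
  proof (rule refine_source[OF \<Phi>, of "above \<Phi> x" "{w1, w2}" 8])
    show "{w1, w2} \<subseteq> boundary (nbr T) (verts T) (above \<Phi> x)" using w K by simp
    show "Suc (card {w1, w2} * 8) * card {w1, w2} \<le> 5277" using w(2) by simp
    fix J :: "'b set" and A g
    assume f: "\<And>i. i \<in> J \<Longrightarrow> \<exists>f\<in>\<Phi>. f x = i \<and> A i = f ` above \<Phi> x \<and> g i = f ` {w1, w2}"
    assume a: "finite J" "\<And>i. i \<in> J \<Longrightarrow> sconn (nbr G) (A i)"
      "\<And>i j. i \<in> J \<Longrightarrow> j \<in> J \<Longrightarrow> i \<noteq> j \<Longrightarrow> A i \<inter> A j = {}"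
      "\<And>i. i \<in> J \<Longrightarrow> A i \<inter> (\<Union>i\<in>J. g i) = {}" "finite (\<Union>i\<in>J. g i)"
      "\<And>i y. i \<in> J \<Longrightarrow> y \<in> g i \<Longrightarrow> touches (nbr G) (A i) y"
      "\<And>i. i \<in> J \<Longrightarrow> card (g i) = card {w1, w2}"
    have "inj_on g J"
    proof (rule inj_onI, rule ccontr)
      fix i j assume ij: "i \<in> J" "j \<in> J" "g i = g j" "i \<noteq> j"
      obtain h where h: "h \<in> \<Phi>" "A i = h ` K" "g i = h ` {w1, w2}" using f[OF ij(1)] K by auto
      obtain h' where h': "h' \<in> \<Phi>" "A j = h' ` K" "g j = h' ` {w1, w2}" using f[OF ij(2)] K by auto
      have hh: "h \<in> homs" "h' \<in> homs" using h h' \<Phi> by auto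
      have eq: "h w1 = h' w1" "h w2 = h' w2"
        using homs_eq[OF hh wT(1,2)] homs_eq[OF hh wT(2,1)] w(2) ij(3) h(3) h'(3)
        by (auto simp: doubleton_eq_iff)
      have inj: "inj_on h (verts T)" "inj_on h' (verts T)"
        using homs_eq[OF hh(1) hh(1)] homs_eq[OF hh(2) hh(2)] by (auto simp: inj_on_def)
      \<comment> \<open>The cycle runs from \<open>w1\<close> to \<open>w2\<close> through the image
        under \<open>h\<close> and back through the image under \<open>h'\<close>.\<close>
      define ys where "ys = map h (w1 # xs) @ h w2 # map h' (rev xs)"
      have len: "length ys = 2 * Suc (card K)" using dxs(1) xs(1) distinct_card[of xs] by (simp add: ys_def)
      have hw: "h u \<notin> h' ` K" if "u \<in> verts T" "u \<notin> K" for u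
      proof
        assume "h u \<in> h' ` K"
        then obtain k where "h u = h' k" "k \<in> K" by (rule imageE)
        thus False using homs_eq[OF hh \<open>u \<in> verts T\<close>, of k] KT \<open>u \<notin> K\<close> by auto
      qed
      have hw': "h u \<notin> h ` K" if "u \<in> verts T" "u \<notin> K" for u
      proof
        assume "h u \<in> h ` K"
        then obtain k where "h u = h k" "k \<in> K" by (rule imageE)
        thus False using homs_eq[OF hh(1) hh(1) \<open>u \<in> verts T\<close>, of k] KT \<open>u \<notin> K\<close> by auto
      qed
      have disj: "h ` K \<inter> h' ` K = {}" using a(3)[OF ij(1,2,4)] h h' by simp
      have ne12: "h w1 \<noteq> h w2" using homs_eq[OF hh(1) hh(1) wT(1,2)] w(2) by auto
      have "distinct (map h xs)" "distinct (map h' xs)"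
        using dxs(1) xs(1) KT inj inj_on_subset by (auto simp: distinct_map)
      hence "distinct ys"
        unfolding ys_def using xs(1) hw[OF wT(1,3)] hw[OF wT(2,4)] hw'[OF wT(1,3)] hw'[OF wT(2,4)] disj ne12
        by (auto simp: distinct_map)
      moreover have "successively (nbr G) ys"
      proof -
        have s1: "successively (nbr G) (map h (w1 # xs))"
          unfolding successively_map using dxs(2) by (rule successively_mono) (use homs_nbr[OF hh(1)] in auto)
        have "successively (nbr T) xs" using dxs(2) xs(2) by (simp add: successively_Cons)
        hence "successively (nbr T) (rev xs)"
          by (subst successively_rev) (auto simp: insert_commute)
        hence s2: "successively (nbr G) (map h' (rev xs))"
          unfolding successively_map by (rule successively_mono) (use homs_nbr[OF hh(2)] in auto)
        have j1: "nbr G (h (last xs)) (h w2)" using homs_nbr[OF hh(1) xs(4)] by simp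
        have j2: "nbr G (h w2) (h' (last xs))" using homs_nbr[OF hh(2) xs(4)] eq(2) by (simp add: insert_commute)
        have l1: "last (map h (w1 # xs)) = h (last xs)" using xs(2) by (simp add: last_map)
        have l2: "hd (map h' (rev xs)) = h' (last xs)" using xs(2) by (simp add: hd_map hd_rev)
        have s3: "successively (nbr G) (h w2 # map h' (rev xs))"
          using s2 j2 l2 by (simp add: successively_Cons)
        show ?thesis unfolding ys_def successively_append_iff using s1 s3 j1 l1 by (simp del: list.map)
      qed
      moreover have K1: "1 \<le> card K" using xs(2) distinct_card[OF dxs(1)] xs(1) by (cases xs) auto
      hence "3 \<le> length ys" using len by simp
      moreover have "nbr G (last ys) (hd ys)"
      proof -
        have "nbr T w1 (hd xs)" using dxs(2) xs(2) by (cases xs) (auto simp: successively_Cons)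
        hence "nbr G (h' w1) (h' (hd xs))" by (rule homs_nbr[OF hh(2)])
        moreover have "last ys = h' (hd xs)" using xs(2) by (simp add: ys_def last_map last_rev)
        moreover have "hd ys = h' w1" using eq by (simp add: ys_def)
        ultimately show ?thesis by (simp add: insert_commute)
      qed
      ultimately have "copies (cycle_graph (2 * Suc (card K))) G \<noteq> {}"
        using closed_walk_cycle[OF G] len by metis
      thus False using even[of "Suc (card K)"] lt K1 by auto
    qed
    thus "card J \<le> 8 * card (\<Union>i\<in>J. g i)"
      by (intro connected_sets_pairs[OF k33 symp_nbr a(1,5,2,3,4,6)]) (use a(7) w(2) in auto)
  qed (use K in auto)
qed

text \<open>Branching and short source components allow a split, so each one contains a leaf or a
  sufficiently long path. Different source components are disjoint and not adjacent: by
  \<open>total\<close> an edge between them would carry an arc, which merges them.\<close>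

lemma sources_le_beta:
  assumes nr: "\<not> refinable \<Phi>" and \<Phi>: "\<Phi> \<subseteq> homs" "total \<Phi>"
  shows "card {above \<Phi> x | x. source \<Phi> x} \<le> beta l T"
proof -
  let ?K = "{above \<Phi> x | x. source \<Phi> x}"
  have "\<exists>C\<subseteq>K. admissible_component l T C \<and> sconn (nbr T) C" if "K \<in> ?K" for K
  proof -
    obtain x where x: "source \<Phi> x" "K = above \<Phi> x" using \<open>K \<in> ?K\<close> by auto
    have KT: "K \<subseteq> verts T" using above_verts[of x \<Phi>] x by (simp add: source_def)
    have cK: "sconn (nbr T) K" using sconn_above x by simp
    show ?thesis
    proof (rule forest_subtree_cases[OF forest_tree[OF T] KT cK])
      fix v assume v: "v \<in> K" "dg (nbr T) (verts T) v \<le> 1"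
      hence "admissible_component l T {v}" by (auto simp: admissible_component_def degree_dg[OF sT])
      thus ?thesis using v sconn_singleton by (intro exI[of _ "{v}"]) auto
    next
      assume "3 \<le> card (boundary (nbr T) (verts T) K)"
      thus ?thesis using refine_branching_source[OF \<Phi> x(1)] x(2) nr by auto
    next
      assume b: "card (boundary (nbr T) (verts T) K) = 2" and d: "\<And>y. y \<in> K \<Longrightarrow> dg (nbr T) (verts T) y = 2"
      have lK: "l \<le> card K" using refine_short_source[OF \<Phi> x b d] nr by (meson not_le)
      obtain w where w: "w \<in> boundary (nbr T) (verts T) K" using b by fastforce
      obtain xs where xs: "set xs = K" "xs \<noteq> []" "induced_path (nbr T) (w # xs)"
        by (rule degree_two_path[OF forest_tree[OF T] KT cK d w])
      have dx: "distinct xs" using xs(3) by (simp add: induced_path_def)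
      hence len: "length xs = card K" using xs(1) distinct_card by metis
      define ys where "ys = take l xs"
      have ne: "ys \<noteq> []" using xs(2) l by (simp add: ys_def)
      have ly: "length ys = l" using lK len by (simp add: ys_def)
      have ip: "induced_path (nbr T) ys"
        unfolding induced_path_def
      proof (intro conjI allI impI)
        show "distinct ys" using dx by (simp add: ys_def)
        fix i assume i: "Suc i < length ys"
        show "nbr T (ys ! i) (ys ! Suc i)"
          using xs(3) i unfolding induced_path_def ys_def by (auto dest: spec[of _ "Suc i"])
      next
        fix i j assume ij: "i < length ys \<and> j < length ys \<and> nbr T (ys ! i) (ys ! j)"
        hence "nbr T ((w # xs) ! Suc i) ((w # xs) ! Suc j)" "Suc i < length (w # xs)" "Suc j < length (w # xs)"
          by (auto simp: ys_def)
        hence "Suc i = Suc (Suc j) \<or> Suc j = Suc (Suc i)" using xs(3) unfolding induced_path_def by blast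
        thus "i = Suc j \<or> j = Suc i" by simp
      qed
      have sub: "set ys \<subseteq> K" using set_take_subset[of l xs] xs(1) by (simp add: ys_def)
      have "admissible_component l T (set ys)"
        by (rule admissible_path[OF sT ip ly]) (use sub d in \<open>auto simp: degree_dg[OF sT]\<close>)
      thus ?thesis using sub sconn_induced_path[OF symp_nbr ip ne] by blast
    qed
  qed
  hence "\<forall>K\<in>?K. \<exists>C. C \<subseteq> K \<and> admissible_component l T C \<and> sconn (nbr T) C" by blast
  from bchoice[OF this] obtain C where
    C: "\<And>K. K \<in> ?K \<Longrightarrow> C K \<subseteq> K \<and> admissible_component l T (C K) \<and> sconn (nbr T) (C K)" by blast
  have sep: "K = K'" if kk: "K \<in> ?K" "K' \<in> ?K" "y \<in> K" "z \<in> K'" "y = z \<or> nbr T y z" for K K' y z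
  proof -
    obtain x x' where x: "source \<Phi> x" "K = above \<Phi> x" "source \<Phi> x'" "K' = above \<Phi> x'" using kk by auto
    have "(y, z) \<in> (arcs \<Phi>)\<^sup>* \<or> (z, y) \<in> (arcs \<Phi>)\<^sup>*" using kk(5) \<Phi>(2) by (auto simp: total_def insert_commute)
    moreover have "(y, x) \<in> (arcs \<Phi>)\<^sup>*" "(x, y) \<in> (arcs \<Phi>)\<^sup>*" "(z, x') \<in> (arcs \<Phi>)\<^sup>*" "(x', z) \<in> (arcs \<Phi>)\<^sup>*"
      using kk x by (auto simp: above_def source_def)
    ultimately have "(x, x') \<in> (arcs \<Phi>)\<^sup>* \<or> (x', x) \<in> (arcs \<Phi>)\<^sup>*" by (meson rtrancl_trans)
    hence "(x, x') \<in> (arcs \<Phi>)\<^sup>* \<and> (x', x) \<in> (arcs \<Phi>)\<^sup>*" using x by (auto simp: source_def above_def)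
    thus ?thesis using x by (auto simp: above_def intro: rtrancl_trans)
  qed
  have KT: "K \<subseteq> verts T" if "K \<in> ?K" for K using that above_verts by (auto simp: source_def)
  have "inj_on C ?K"
  proof (rule inj_onI)
    fix K K' assume k: "K \<in> ?K" "K' \<in> ?K" "C K = C K'"
    obtain y where "y \<in> C K" using C[OF k(1)] by (auto simp: sconn_def)
    thus "K = K'" using sep[OF k(1,2), of y y] C[OF k(1)] C[OF k(2)] k(3) by auto
  qed
  hence "card ?K = card (C ` ?K)" by (simp add: card_image)
  also have "\<dots> \<le> beta l T"
  proof (rule beta_ge[OF finT])
    show "D \<subseteq> verts T \<and> admissible_component l T D" if "D \<in> C ` ?K" for D using that C KT by blast
    show "sconn (nbr T) D" if "D \<in> C ` ?K" for D using that C by blast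
    show "D = D'" if D: "D \<in> C ` ?K" "D' \<in> C ` ?K" "y \<in> D" "z \<in> D'" "y = z \<or> nbr T y z" for D D' y z
    proof -
      obtain K K' where k: "K \<in> ?K" "D = C K" "K' \<in> ?K" "D' = C K'" using D by blast
      have "K = K'" by (rule sep[OF k(1,3) _ _ D(5)]) (use C[OF k(1)] C[OF k(3)] k D in auto)
      thus ?thesis using k by simp
    qed
  qed
  finally show ?thesis .
qed

lemma unrefinable_card:
  assumes nr: "\<not> refinable \<Phi>" and \<Phi>: "\<Phi> \<subseteq> homs"
  shows "card \<Phi> \<le> card (verts G) ^ beta l T"
proof (cases "\<Phi> = {}")
  case False
  have tot: "total \<Phi>" unfolding total_def using refine_undirected_edge[OF \<Phi>] nr by blast
  let ?K = "{above \<Phi> x | x. source \<Phi> x}"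
  have b: "card ?K \<le> beta l T" by (rule sources_le_beta[OF nr \<Phi> tot])
  have KT: "K \<subseteq> verts T" "K \<noteq> {}" if "K \<in> ?K" for K
  proof -
    obtain x where "source \<Phi> x" "K = above \<Phi> x" using \<open>K \<in> ?K\<close> by blast
    thus "K \<subseteq> verts T" "K \<noteq> {}" using above_verts[of x \<Phi>] above_refl[of x \<Phi>] by (auto simp: source_def)
  qed
  have fK: "finite ?K" by (rule finite_subset[of _ "Pow (verts T)"]) (use KT finT in auto)
  define rep where "rep K = (SOME x. x \<in> K)" for K :: "'a set"
  have rep: "rep K \<in> K" if "K \<in> ?K" for K using KT[OF that] by (auto simp: rep_def some_in_eq)
  have fG: "f v \<in> verts G" if "f \<in> \<Phi>" "v \<in> verts T" for f v using that \<Phi> by (auto simp: homs_def)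
  have "inj_on (\<lambda>f. \<lambda>K\<in>?K. f (rep K)) \<Phi>"
  proof (rule inj_onI)
    fix f g assume fg: "f \<in> \<Phi>" "g \<in> \<Phi>" "(\<lambda>K\<in>?K. f (rep K)) = (\<lambda>K\<in>?K. g (rep K))"
    show "f = g"
    proof (rule PiE_ext)
      show "f \<in> verts T \<rightarrow>\<^sub>E verts G" "g \<in> verts T \<rightarrow>\<^sub>E verts G" using fg \<Phi> by (auto simp: homs_def)
      fix v assume "v \<in> verts T"
      then obtain x where x: "source \<Phi> x" "(x, v) \<in> (arcs \<Phi>)\<^sup>*" using source_exists by metis
      have K: "above \<Phi> x \<in> ?K" using x by auto
      have "f (rep (above \<Phi> x)) = g (rep (above \<Phi> x))" using fun_cong[OF fg(3), of "above \<Phi> x"] K by simp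
      moreover have "(rep (above \<Phi> x), v) \<in> (arcs \<Phi>)\<^sup>*" using rep[OF K] x by (auto simp: above_def)
      ultimately show "f v = g v" using reach_determines fg by blast
    qed
  qed
  moreover have "(\<lambda>f. \<lambda>K\<in>?K. f (rep K)) ` \<Phi> \<subseteq> ?K \<rightarrow>\<^sub>E verts G"
    using fG rep KT by (auto intro!: restrict_PiE_iff[THEN iffD2]) blast
  moreover have "finite (?K \<rightarrow>\<^sub>E verts G)" by (rule finite_PiE[OF fK finG])
  ultimately have "card \<Phi> \<le> card (?K \<rightarrow>\<^sub>E verts G)" by (rule card_inj_on_le)
  also have "\<dots> = card (verts G) ^ card ?K" by (simp add: card_PiE[OF fK])
  also have "\<dots> \<le> card (verts G) ^ beta l T"
  proof (rule power_increasing[OF b])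
    obtain f where "f \<in> \<Phi>" using False by auto
    moreover obtain v where "v \<in> verts T" using T by (auto simp: tree_def connected_graph_def)
    ultimately have "verts G \<noteq> {}" using fG by blast
    thus "1 \<le> card (verts G)" using finG by (simp add: Suc_le_eq card_gt_0_iff)
  qed
  finally show ?thesis .
qed simp

section \<open>Iterating the split\<close>

definition darts :: "('a \<times> 'a) set" where
  "darts = {(u, v). nbr T u v}"

lemma finite_darts: "finite darts"
  by (rule finite_subset[of _ "verts T \<times> verts T"]) (use nbr_verts[OF sT] finT in \<open>auto simp: darts_def\<close>)

lemma arcs_subset_darts: "arcs \<Phi> \<subseteq> darts"
  by (rule subrelI) (drule arcs_nbr, simp add: darts_def)

text \<open>Each split costs a factor 5277 and adds an arc in every class; the darts that are not
  yet arcs bound the number of rounds.\<close>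

lemma card_subset_homs:
  assumes "\<Phi> \<subseteq> homs"
  shows "card \<Phi> \<le> 5277 ^ (card darts - card (arcs \<Phi>)) * card (verts G) ^ beta l T"
  using assms
proof (induction "card darts - card (arcs \<Phi>)" arbitrary: \<Phi> rule: less_induct)
  case less
  let ?B = "card (verts G) ^ beta l T" and ?m = "card darts - card (arcs \<Phi>)"
  show ?case
  proof (cases "refinable \<Phi>")
    case False
    have "?B \<le> 5277 ^ ?m * ?B" by simp
    thus ?thesis using unrefinable_card[OF False less.prems] by linarith
  next
    case True
    then obtain \<kappa> where k: "\<kappa> ` \<Phi> \<subseteq> {..<5277::nat}" "\<And>k. arcs \<Phi> \<subset> arcs {f \<in> \<Phi>. \<kappa> f = k}" by blast
    have cls: "card {f \<in> \<Phi>. \<kappa> f = k} \<le> 5277 ^ (?m - 1) * ?B" and m: "0 < ?m" for k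
    proof -
      let ?\<Psi> = "{f \<in> \<Phi>. \<kappa> f = k}"
      have "card (arcs \<Phi>) < card (arcs ?\<Psi>)"
        by (rule psubset_card_mono[OF finite_subset[OF arcs_subset_darts finite_darts] k(2)])
      moreover have "card (arcs ?\<Psi>) \<le> card darts" by (rule card_mono[OF finite_darts arcs_subset_darts])
      ultimately have lt: "card darts - card (arcs ?\<Psi>) < ?m" "0 < ?m" by linarith+
      show "0 < ?m" by (rule lt)
      have "card ?\<Psi> \<le> 5277 ^ (card darts - card (arcs ?\<Psi>)) * ?B"
        by (rule less.hyps[OF lt(1)]) (use less.prems in auto)
      also have "\<dots> \<le> 5277 ^ (?m - 1) * ?B" using lt by (intro mult_right_mono power_increasing) auto
      finally show "card ?\<Psi> \<le> 5277 ^ (?m - 1) * ?B" .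
    qed
    have "\<Phi> = (\<Union>k<5277::nat. {f \<in> \<Phi>. \<kappa> f = k})" using k(1) by auto
    hence "card \<Phi> \<le> (\<Sum>k<5277::nat. card {f \<in> \<Phi>. \<kappa> f = k})"
      using card_UN_le[of "{..<5277::nat}" "\<lambda>k. {f \<in> \<Phi>. \<kappa> f = k}"] by simp
    also have "\<dots> \<le> (\<Sum>k<5277::nat. 5277 ^ (?m - 1) * ?B)" by (rule sum_mono) (rule cls)
    also have "\<dots> = 5277 ^ Suc (?m - 1) * ?B" by simp
    also have "Suc (?m - 1) = ?m" using m by simp
    finally show ?thesis .
  qed
qed

lemma card_homs: "card homs \<le> 5277 ^ card {(u, v). nbr T u v} * card (verts G) ^ beta l T"
proof -
  have "card homs \<le> 5277 ^ (card darts - card (arcs homs)) * card (verts G) ^ beta l T"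
    by (rule card_subset_homs) simp
  also have "\<dots> \<le> 5277 ^ card darts * card (verts G) ^ beta l T"
    by (intro mult_right_mono power_increasing) auto
  finally show ?thesis by (simp add: darts_def)
qed

end

section \<open>From coloured homomorphisms to copies\<close>

definition embeddings :: "'a graph \<Rightarrow> 'b graph \<Rightarrow> ('a \<Rightarrow> 'b) set" where
  "embeddings T G = {f \<in> verts T \<rightarrow>\<^sub>E verts G. inj_on f (verts T) \<and> (\<forall>u v. nbr T u v \<longrightarrow> nbr G (f u) (f v))}"

lemma copies_le_embeddings:
  assumes T: "simple_graph T" and G: "simple_graph G"
  shows "card (copies T G) \<le> card (embeddings T G)"
proof (rule surj_card_le)
  show "finite (embeddings T G)"
    by (rule finite_subset[of _ "verts T \<rightarrow>\<^sub>E verts G"])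
      (use T G in \<open>auto simp: embeddings_def simple_graph_def intro: finite_PiE\<close>)
  show "copies T G \<subseteq> (\<lambda>f. (f ` verts T, (\<lambda>e. f ` e) ` edges T)) ` embeddings T G"
  proof
    fix H assume "H \<in> copies T G"
    then obtain f where H: "subgraph H G" "bij_betw f (verts T) (verts H)" "(\<lambda>e. f ` e) ` edges T = edges H"
      by (auto simp: copies_def iso_def)
    define g where "g = restrict f (verts T)"
    have g: "g v = f v" if "v \<in> verts T" for v using that by (simp add: g_def)
    have ge: "g ` e = f ` e" if "e \<in> edges T" for e
    proof -
      have "e \<subseteq> verts T" using T that by (auto simp: simple_graph_def)
      thus ?thesis using g by (intro image_cong) auto
    qed
    have "H = (g ` verts T, (\<lambda>e. g ` e) ` edges T)"
      using H g ge by (intro prod_eqI) (auto simp: bij_betw_def)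
    moreover have "g \<in> embeddings T G"
    proof -
      have "nbr G (g u) (g v)" if "nbr T u v" for u v
      proof -
        have "f ` {u, v} \<in> edges H" using that H(3) by blast
        hence "g ` {u, v} \<in> edges H" using ge[OF that] by simp
        thus ?thesis using H(1) by (auto simp: subgraph_def)
      qed
      moreover have "g \<in> verts T \<rightarrow>\<^sub>E verts G"
        using H(1,2) by (auto simp: g_def subgraph_def bij_betw_def)
      moreover have "inj_on g (verts T)" using H(2) g by (auto simp: bij_betw_def inj_on_def)
      ultimately show ?thesis by (simp add: embeddings_def)
    qed
    ultimately show "H \<in> (\<lambda>f. (f ` verts T, (\<lambda>e. f ` e) ` edges T)) ` embeddings T G" by blast
  qed
qed

text \<open>A uniformly random colouring of \<open>G\<close> by the \<open>t\<close> vertices of \<open>T\<close> is compatible with a given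
  embedding with probability \<open>t\<close> to the power \<open>-t\<close>.\<close>

lemma embeddings_colouring:
  assumes T: "finite (verts T)" "verts T \<noteq> {}" and G: "finite (verts G)"
    and B: "\<And>col. card {f \<in> embeddings T G. \<forall>v\<in>verts T. col (f v) = v} \<le> B"
  shows "card (embeddings T G) \<le> card (verts T) ^ card (verts T) * B"
proof (cases "embeddings T G = {}")
  case False
  let ?t = "card (verts T)" and ?n = "card (verts G)" and ?C = "verts G \<rightarrow>\<^sub>E verts T"
  have fC: "finite ?C" using T G by (auto intro: finite_PiE)
  have fE: "finite (embeddings T G)"
    by (rule finite_subset[of _ "verts T \<rightarrow>\<^sub>E verts G"]) (use T G in \<open>auto simp: embeddings_def intro: finite_PiE\<close>)
  have t: "0 < ?t" using T by (simp add: card_gt_0_iff)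
  have sub: "f ` verts T \<subseteq> verts G" "inj_on f (verts T)" if "f \<in> embeddings T G" for f
    using that by (auto simp: embeddings_def)
  have tn: "?t \<le> ?n" using False sub card_inj_on_le[OF _ _ G] by blast
  \<comment> \<open>The colouring is prescribed on the \<open>?t\<close> image vertices and free on
    the other \<open>?n - ?t\<close>.\<close>
  have cnt: "card {col \<in> ?C. \<forall>v\<in>verts T. col (f v) = v} = ?t ^ (?n - ?t)" if f: "f \<in> embeddings T G" for f
  proof -
    let ?X = "\<lambda>x. if x \<in> f ` verts T then {the_inv_into (verts T) f x} else verts T"
    have inv: "the_inv_into (verts T) f (f v) = v" if "v \<in> verts T" for v
      using the_inv_into_f_f[OF sub(2)[OF f] that] .
    have "{col \<in> ?C. \<forall>v\<in>verts T. col (f v) = v} = Pi\<^sub>E (verts G) ?X"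
    proof (intro set_eqI iffI)
      fix c assume c: "c \<in> {col \<in> ?C. \<forall>v\<in>verts T. col (f v) = v}"
      show "c \<in> Pi\<^sub>E (verts G) ?X"
      proof (rule PiE_I)
        fix x assume "x \<in> verts G"
        thus "c x \<in> ?X x" using c inv by auto
      next
        fix x assume "x \<notin> verts G"
        thus "c x = undefined" using c by auto
      qed
    next
      fix c assume c: "c \<in> Pi\<^sub>E (verts G) ?X"
      have "c x \<in> verts T" if "x \<in> verts G" for x using PiE_mem[OF c that] inv by (auto split: if_splits)
      moreover have "c x = undefined" if "x \<notin> verts G" for x using PiE_arb[OF c that] .
      moreover have "c (f v) = v" if "v \<in> verts T" for v
        using PiE_mem[OF c, of "f v"] sub(1)[OF f] that inv by auto
      ultimately show "c \<in> {col \<in> ?C. \<forall>v\<in>verts T. col (f v) = v}" by (auto intro!: PiE_I)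
    qed
    hence "card {col \<in> ?C. \<forall>v\<in>verts T. col (f v) = v} = (\<Prod>x\<in>verts G. card (?X x))"
      using card_PiE[OF G] by simp
    also have "\<dots> = (\<Prod>x\<in>verts G. if x \<in> f ` verts T then 1 else ?t)"
      by (rule prod.cong) auto
    also have "\<dots> = ?t ^ card (verts G - f ` verts T)"
      using G by (simp add: prod.If_cases Diff_eq)
    also have "card (verts G - f ` verts T) = ?n - ?t"
      using card_Diff_subset[of "f ` verts T" "verts G"] sub[OF f] T by (simp add: card_image)
    finally show ?thesis .
  qed
  have "card (embeddings T G) * ?t ^ (?n - ?t) = (\<Sum>f\<in>embeddings T G. card {col \<in> ?C. \<forall>v\<in>verts T. col (f v) = v})"
    using cnt by simp
  also have "\<dots> = (\<Sum>col\<in>?C. card {f \<in> embeddings T G. \<forall>v\<in>verts T. col (f v) = v})"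
    using sum.swap_restrict[OF fE fC, of "\<lambda>_ _. 1::nat" "\<lambda>f col. \<forall>v\<in>verts T. col (f v) = v"]
    by (simp only: card_eq_sum)
  also have "\<dots> \<le> (\<Sum>col\<in>?C. B)" by (rule sum_mono) (rule B)
  also have "\<dots> = ?t ^ ?n * B" using card_PiE[OF G, of "\<lambda>_. verts T"] by simp
  also have "\<dots> = (?t ^ ?t * B) * ?t ^ (?n - ?t)"
    using tn by (simp add: power_add[symmetric] mult.commute mult.left_commute)
  finally show ?thesis using t by simp
qed simp

lemma copies_upper_bound:
  fixes T :: "'a graph" and G :: "'b graph"
  assumes T: "tree T" and G: "simple_graph G" "planar G" "\<forall>K\<in>even_cycles l. copies K G = {}" and l: "1 \<le> l"
  shows "card (copies T G) \<le> card (verts T) ^ card (verts T) *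
    (5277 ^ card {(u, v). nbr T u v} * card (verts G) ^ beta l T)"
proof -
  have sT: "simple_graph T" using T by (simp add: tree_def)
  have "card {f \<in> embeddings T G. \<forall>v\<in>verts T. col (f v) = v}
      \<le> 5277 ^ card {(u, v). nbr T u v} * card (verts G) ^ beta l T" for col
  proof -
    interpret coloured_homs T G col l
    proof
      fix s :: nat assume "2 \<le> s" "s \<le> l"
      hence "cycle_graph (2 * s) \<in> even_cycles l" by (auto simp: even_cycles_def)
      thus "copies (cycle_graph (2 * s)) G = {}" using G by blast
    qed (use T G l planar_k33_free[OF G(1,2)] in auto)
    have "{f \<in> embeddings T G. \<forall>v\<in>verts T. col (f v) = v} \<subseteq> homs"
      by (auto simp: embeddings_def homs_def)
    hence "card {f \<in> embeddings T G. \<forall>v\<in>verts T. col (f v) = v} \<le> card homs"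
      using finite_homs[OF subset_refl] by (rule card_mono[rotated])
    thus ?thesis using card_homs by linarith
  qed
  hence "card (embeddings T G) \<le> card (verts T) ^ card (verts T) *
    (5277 ^ card {(u, v). nbr T u v} * card (verts G) ^ beta l T)"
    by (rule embeddings_colouring[rotated -1]) (use T sT G in \<open>auto simp: tree_def connected_graph_def simple_graph_def\<close>)
  thus ?thesis using copies_le_embeddings[OF sT G(1)] by linarith
qed

section \<open>Layered drawings\<close>

text \<open>A segment between consecutive columns has an integer abscissa only at its ends, so it
  passes through no other vertex.\<close>

lemma unit_interval_nat_diff: "real a = real b + s \<Longrightarrow> 0 \<le> s \<Longrightarrow> s \<le> 1 \<Longrightarrow> s = 0 \<or> s = 1"
  by (cases "a \<le> b"; cases "a = Suc b") auto

text \<open>The heights of two segments at an inner abscissa are averages with the same positive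
  weights; if the ends are in the same order, they agree only when the ends do.\<close>

lemma weighted_eq:
  fixes a b c d s :: real
  assumes "(1 - s) * a + s * b = (1 - s) * c + s * d" "0 < s" "s < 1" "a \<le> c \<and> b \<le> d"
  shows "a = c \<and> b = d"
proof -
  have "(1 - s) * (c - a) + s * (d - b) = 0" using assms(1) by (simp add: algebra_simps)
  moreover have "0 \<le> (1 - s) * (c - a)" "0 \<le> s * (d - b)" using assms by auto
  ultimately have "(1 - s) * (c - a) = 0" "s * (d - b) = 0" by linarith+
  thus ?thesis using assms by auto
qed

text \<open>Vertices are placed at \<open>(X v, Y v)\<close> and edges drawn as segments between
  consecutive columns. By \<open>mono\<close>, segments between the same columns have the same order
  at both ends, so they cannot cross.\<close>

lemma layered_planar:
  fixes X Y :: "'v \<Rightarrow> nat"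
  assumes G: "simple_graph G" and inj: "inj_on (\<lambda>v. (X v, Y v)) (verts G)"
    and lay: "\<And>u v. nbr G u v \<Longrightarrow> X v = Suc (X u) \<or> X u = Suc (X v)"
    and mono: "\<And>u v u' v'. nbr G u v \<Longrightarrow> nbr G u' v' \<Longrightarrow> X v = Suc (X u) \<Longrightarrow> X v' = Suc (X u') \<Longrightarrow>
      X u = X u' \<Longrightarrow> Y u \<le> Y u' \<and> Y v \<le> Y v' \<or> Y u' \<le> Y u \<and> Y v' \<le> Y v"
  shows "planar G"
proof -
  define p where "p v = Complex (real (X v)) (real (Y v))" for v
  have pinj: "inj_on p (verts G)" using inj by (auto simp: inj_on_def p_def)
  have "\<forall>e\<in>edges G. \<exists>u v. e = {u, v} \<and> X v = Suc (X u)"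
  proof
    fix e assume e: "e \<in> edges G"
    then obtain u v where "e = {u, v}" using G by (auto simp: simple_graph_def card_2_iff)
    thus "\<exists>u v. e = {u, v} \<and> X v = Suc (X u)" using lay[of u v] e by (metis insert_commute)
  qed
  then obtain lo hi where lh: "\<And>e. e \<in> edges G \<Longrightarrow> e = {lo e, hi e} \<and> X (hi e) = Suc (X (lo e))" by metis
  have V: "lo e \<in> verts G" "hi e \<in> verts G" "nbr G (lo e) (hi e)" if "e \<in> edges G" for e
  proof -
    have "e = {lo e, hi e}" using lh[OF that] by simp
    thus "nbr G (lo e) (hi e)" using that by simp
    from nbr_verts[OF G this] show "lo e \<in> verts G" "hi e \<in> verts G" by auto
  qed
  define \<gamma> where "\<gamma> e = linepath (p (lo e)) (p (hi e))" for e
  have pt: "\<exists>s\<ge>0. s \<le> 1 \<and> Re z = real (X (lo e)) + s \<and>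
      Im z = (1 - s) * real (Y (lo e)) + s * real (Y (hi e))"
    if ez: "e \<in> edges G" "z \<in> path_image (\<gamma> e)" for e z
  proof -
    obtain s where s: "0 \<le> s" "s \<le> 1" "z = (1 - s) *\<^sub>R p (lo e) + s *\<^sub>R p (hi e)"
      using ez(2) by (auto simp: \<gamma>_def closed_segment_def)
    have "Re z = (1 - s) * real (X (lo e)) + s * real (X (hi e))"
      "Im z = (1 - s) * real (Y (lo e)) + s * real (Y (hi e))" by (simp_all add: s(3) p_def)
    thus ?thesis using lh[OF ez(1)] s(1,2) by (intro exI[of _ s]) (auto simp: algebra_simps)
  qed
  have end0: "z = p (lo e)" if "e \<in> edges G" "Re z = real (X (lo e))" "Im z = real (Y (lo e))" for e z
    using that by (simp add: p_def complex_eq_iff)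
  have end1: "z = p (hi e)" if "e \<in> edges G" "Re z = real (X (lo e)) + 1" "Im z = real (Y (hi e))" for e z
    using that lh[OF that(1)] by (simp add: p_def complex_eq_iff)
  have plane: "path_image (\<gamma> e) \<inter> path_image (\<gamma> e') \<subseteq> p ` (e \<inter> e')"
    if e: "e \<in> edges G" "e' \<in> edges G" "e \<noteq> e'" "X (lo e) \<le> X (lo e')" for e e'
  proof
    fix z assume z: "z \<in> path_image (\<gamma> e) \<inter> path_image (\<gamma> e')"
    obtain s where s: "0 \<le> s" "s \<le> 1" "Re z = real (X (lo e)) + s"
        "Im z = (1 - s) * real (Y (lo e)) + s * real (Y (hi e))" using pt[OF e(1), of z] z by auto
    obtain s' where s': "0 \<le> s'" "s' \<le> 1" "Re z = real (X (lo e')) + s'"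
        "Im z = (1 - s') * real (Y (lo e')) + s' * real (Y (hi e'))" using pt[OF e(2), of z] z by auto
    have ee: "e = {lo e, hi e}" "e' = {lo e', hi e'}" using lh e by auto
    have meet: "z \<in> p ` (e \<inter> e')" if "z = p u" "z = p u'" "u \<in> e" "u' \<in> e'" for u u'
    proof -
      have "u \<in> verts G" "u' \<in> verts G" using that e G by (auto simp: simple_graph_def)
      hence "u = u'" using that pinj by (auto dest: inj_onD)
      thus ?thesis using that by auto
    qed
    show "z \<in> p ` (e \<inter> e')"
    proof (cases "X (lo e) = X (lo e')")
      \<comment> \<open>Segments starting in different columns can share only an abscissa that ends
        one and starts the other.\<close>
      case False
      hence "real (X (lo e)) + 1 \<le> real (X (lo e'))" using e(4) by linarith
      hence 1: "s = 1" "s' = 0" using s s' by linarith+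
      have "z = p (hi e)" by (rule end1[OF e(1)]) (use s 1 in auto)
      moreover have "z = p (lo e')" by (rule end0[OF e(2)]) (use s' 1 in auto)
      ultimately show ?thesis using meet ee by blast
    next
      case True
      hence ss: "s' = s" using s s' by simp
      consider "s = 0" | "s = 1" | "0 < s" "s < 1" using s by linarith
      thus ?thesis
      proof cases
        case 1
        have "z = p (lo e)" by (rule end0[OF e(1)]) (use s 1 in auto)
        moreover have "z = p (lo e')" by (rule end0[OF e(2)]) (use s' ss 1 in auto)
        ultimately show ?thesis using meet ee by blast
      next
        case 2
        have "z = p (hi e)" by (rule end1[OF e(1)]) (use s 2 in auto)
        moreover have "z = p (hi e')" by (rule end1[OF e(2)]) (use s' ss 2 in auto)
        ultimately show ?thesis using meet ee by blast
      next
        case 3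
        have eq: "(1 - s) * real (Y (lo e)) + s * real (Y (hi e)) = (1 - s) * real (Y (lo e')) + s * real (Y (hi e'))"
          using s s' ss by simp
        have h: "X (hi e) = Suc (X (lo e))" "X (hi e') = Suc (X (lo e'))" using lh e by auto
        have "Y (lo e) = Y (lo e') \<and> Y (hi e) = Y (hi e')"
          using mono[OF V(3)[OF e(1)] V(3)[OF e(2)] h True] weighted_eq[OF eq 3] weighted_eq[OF eq[symmetric] 3]
          by auto
        hence "lo e = lo e'" "hi e = hi e'"
          using inj_onD[OF inj, of "lo e" "lo e'"] inj_onD[OF inj, of "hi e" "hi e'"] V e h True by auto
        hence "e = e'" using ee by simp
        thus ?thesis using e by simp
      qed
    qed
  qed
  have "plane_drawing G p \<gamma>"
    unfolding plane_drawing_def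
  proof (intro conjI ballI impI)
    show "inj_on p (verts G)" by (rule pinj)
    fix e assume e: "e \<in> edges G"
    have ee: "e = {lo e, hi e}" using lh e by auto
    have "p (lo e) \<noteq> p (hi e)" using lh[OF e] by (simp add: p_def)
    thus "arc (\<gamma> e)" by (simp add: \<gamma>_def arc_linepath)
    show "{pathstart (\<gamma> e), pathfinish (\<gamma> e)} = p ` e" by (subst ee) (simp add: \<gamma>_def)
    show "path_image (\<gamma> e) \<inter> p ` verts G \<subseteq> p ` e"
    proof
      fix z assume z: "z \<in> path_image (\<gamma> e) \<inter> p ` verts G"
      then obtain w where w: "z = p w" by auto
      obtain s where s: "0 \<le> s" "s \<le> 1" "Re z = real (X (lo e)) + s"
        "Im z = (1 - s) * real (Y (lo e)) + s * real (Y (hi e))" using pt[OF e, of z] z by auto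
      have "s = 0 \<or> s = 1" by (rule unit_interval_nat_diff[of "X w" "X (lo e)"]) (use s w in \<open>auto simp: p_def\<close>)
      hence "z = p (lo e) \<or> z = p (hi e)" using end0[OF e, of z] end1[OF e, of z] s by auto
      thus "z \<in> p ` e" using ee by blast
    qed
    fix e' assume e': "e' \<in> edges G" "e \<noteq> e'"
    show "path_image (\<gamma> e) \<inter> path_image (\<gamma> e') \<subseteq> p ` (e \<inter> e')"
      using plane[OF e e'] plane[OF e'(1) e e'(2)[symmetric]] by (cases "X (lo e) \<le> X (lo e')") (auto simp: Int_commute)
  qed
  thus ?thesis by (auto simp: planar_def)
qed

lemma dg_ge_2D:
  assumes "2 \<le> dg R V x"
  obtains a b where "a \<noteq> b" "a \<in> V" "b \<in> V" "R x a" "R x b"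
proof -
  obtain B where "B \<subseteq> {y \<in> V. R x y}" "card B = 2"
    using obtain_subset_with_card_n[of 2 "{y \<in> V. R x y}"] assms by (auto simp: dg_def)
  thus ?thesis using that by (auto simp: card_2_iff)
qed

lemma dg_ge_2:
  assumes "finite V" "{a, b} \<subseteq> V" "a \<noteq> b" "R x a" "R x b"
  shows "2 \<le> dg R V x"
proof -
  have "card {a, b} \<le> card {y \<in> V. R x y}" using assms by (intro card_mono) auto
  thus ?thesis using assms by (simp add: dg_def)
qed

text \<open>Predecessor and successor on a cycle differ since \<open>t\<close> is at least 3. This
  reduces the exclusion of cycles to \<open>blown_girth\<close>, which only looks at minimum
  degree.\<close>

lemma cycle_copy_min_degree:
  assumes H: "H \<in> copies (cycle_graph t) G" and t: "3 \<le> t"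
  shows "finite (verts H)" "card (verts H) = t" "verts H \<subseteq> verts G"
    "\<And>z. z \<in> verts H \<Longrightarrow> 2 \<le> dg (nbr G) (verts H) z"
proof -
  obtain f where f: "bij_betw f {..<t} (verts H)" "(\<lambda>e. f ` e) ` edges (cycle_graph t) = edges H"
    and sub: "subgraph H G" using H by (auto simp: copies_def iso_def cycle_graph_def)
  show "card (verts H) = t" using bij_betw_same_card[OF f(1)] by simp
  show fin: "finite (verts H)" using bij_betw_finite[OF f(1)] by simp
  show "verts H \<subseteq> verts G" using sub by (simp add: subgraph_def)
  fix z assume "z \<in> verts H"
  then obtain a where a: "a < t" "z = f a" using f(1) by (auto simp: bij_betw_def)
  define c where "c = (if a = 0 then t - 1 else a - 1)"
  have c: "c < t" "Suc c mod t = a" using a t by (auto simp: c_def)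
  have b: "Suc a mod t < t" using t by simp
  have edge: "nbr G (f i) (f (Suc i mod t))" if "i < t" for i
  proof -
    have "{i, Suc i mod t} \<in> edges (cycle_graph t)" using that by (auto simp: cycle_graph_def)
    hence "f ` {i, Suc i mod t} \<in> edges H" using f(2) by blast
    thus ?thesis using sub by (auto simp: subgraph_def)
  qed
  have "c \<noteq> Suc a mod t" using a t by (auto simp: c_def mod_Suc)
  hence "f c \<noteq> f (Suc a mod t)" using f(1) c b by (auto simp: bij_betw_def inj_on_def)
  moreover have "{f c, f (Suc a mod t)} \<subseteq> verts H" using f(1) c b by (auto simp: bij_betw_def)
  ultimately show "2 \<le> dg (nbr G) (verts H) z"
    using edge[of a] edge[of c] a c by (intro dg_ge_2[OF fin]) (auto simp: insert_commute)
qed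

section \<open>The lower bound\<close>

text \<open>The number \<open>x\<close> stands for the copy with index \<open>cp x\<close> of the vertex \<open>vt x\<close> of \<open>T\<close>. Vertices
  outside \<open>S\<close> are not multiplied: their copies with nonzero index are isolated.\<close>

locale blow_up =
  fixes T :: "'a graph" and S :: "'a set" and l :: nat and enc :: "'a \<Rightarrow> nat" and t :: nat
  assumes T: "tree T" and S: "S \<subseteq> verts T"
    and adm: "\<And>C. C \<in> components (induced T S) \<Longrightarrow> admissible_component l T C"
    and enc: "bij_betw enc (verts T) {..<t}"
begin

definition vt :: "nat \<Rightarrow> 'a" where "vt x = the_inv_into (verts T) enc (x mod t)"
definition cp :: "nat \<Rightarrow> nat" where "cp x = x div t"
definition nd :: "'a \<Rightarrow> nat \<Rightarrow> nat" where "nd v j = enc v + t * j"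

text \<open>Inside \<open>S\<close> the index is kept, so whole components are multiplied in
  parallel. A vertex of \<open>S\<close> with a neighbour outside \<open>S\<close> sends all its
  copies to the copy of that neighbour with index 0.\<close>

definition jn :: "nat \<Rightarrow> nat \<Rightarrow> bool" where
  "jn x y \<longleftrightarrow> nbr T (vt x) (vt y) \<and> (vt x \<in> S \<or> cp x = 0) \<and> (vt y \<in> S \<or> cp y = 0) \<and>
     (vt x \<in> S \<and> vt y \<in> S \<longrightarrow> cp x = cp y)"

text \<open>If \<open>t\<close> does not divide \<open>n\<close>, the last layer is incomplete; the
  layers with index below \<open>n div t\<close> are full.\<close>

definition blown :: "nat \<Rightarrow> nat graph" where
  "blown n = ({..<n}, {{x, y} | x y. x < n \<and> y < n \<and> jn x y})"

definition cc :: "'a \<Rightarrow> 'a set" where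
  "cc v = {u. (v, u) \<in> (adj (induced T S))\<^sup>*}"

lemma sT: "simple_graph T" and finT: "finite (verts T)" and neT: "verts T \<noteq> {}"
  using T by (auto simp: tree_def simple_graph_def connected_graph_def)

lemma forT: "forest (nbr T) (verts T)"
  by (rule forest_tree[OF T])

lemma t_pos: "0 < t"
  using enc neT by (auto simp: bij_betw_def)

lemma enc_less: "v \<in> verts T \<Longrightarrow> enc v < t"
  using enc by (auto simp: bij_betw_def)

lemma enc_inj: "u \<in> verts T \<Longrightarrow> v \<in> verts T \<Longrightarrow> enc u = enc v \<Longrightarrow> u = v"
  using enc by (auto simp: bij_betw_def inj_on_def)

lemma vt_in: "vt x \<in> verts T"
  unfolding vt_def using enc t_pos by (intro the_inv_into_into) (auto simp: bij_betw_def)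

lemma enc_vt: "enc (vt x) = x mod t"
  unfolding vt_def using enc t_pos by (intro f_the_inv_into_f) (auto simp: bij_betw_def)

lemma nd_vt_cp: "nd (vt x) (cp x) = x"
  by (simp add: nd_def cp_def enc_vt)

lemma vt_nd: "v \<in> verts T \<Longrightarrow> vt (nd v j) = v"
  using enc by (auto simp: vt_def nd_def enc_less bij_betw_def the_inv_into_f_f)

lemma cp_nd: "v \<in> verts T \<Longrightarrow> cp (nd v j) = j"
  using enc_less t_pos by (simp add: cp_def nd_def)

lemma node_eqI: "vt x = vt y \<Longrightarrow> cp x = cp y \<Longrightarrow> x = y"
  using nd_vt_cp by metis

lemma jn_sym: "jn x y \<Longrightarrow> jn y x"
  by (auto simp: jn_def insert_commute)

lemma jn_nbr: "jn x y \<Longrightarrow> nbr T (vt x) (vt y)"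
  by (simp add: jn_def)

lemma nbr_blown: "nbr (blown n) x y \<longleftrightarrow> x < n \<and> y < n \<and> jn x y"
  using jn_sym by (auto simp: blown_def doubleton_eq_iff)

lemma simple_blown: "simple_graph (blown n)"
proof -
  have "card {x, y} = 2" if "jn x y" for x y
  proof -
    have "x \<noteq> y" using nbr_verts[OF sT jn_nbr[OF that]] by auto
    thus ?thesis by simp
  qed
  thus ?thesis by (auto simp: simple_graph_def blown_def)
qed

lemma cc_refl: "v \<in> cc v"
  by (simp add: cc_def)

lemma cc_component: "v \<in> S \<Longrightarrow> cc v \<in> components (induced T S)"
  by (auto simp: cc_def components_def induced_def)

lemma component_cc: "C \<in> components (induced T S) \<Longrightarrow> \<exists>v\<in>S. C = cc v"
  by (auto simp: cc_def components_def induced_def)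

lemma cc_subset: "v \<in> S \<Longrightarrow> cc v \<subseteq> S"
proof
  fix u assume "v \<in> S" "u \<in> cc v"
  hence "(v, u) \<in> (adj (induced T S))\<^sup>*" by (simp add: cc_def)
  thus "u \<in> S" by (induction rule: rtrancl_induct) (use \<open>v \<in> S\<close> in \<open>auto simp: adj_induced\<close>)
qed

lemma sym_adj: "sym (adj (induced T S))"
  by (auto simp: sym_def adj_induced insert_commute)

lemma cc_eq: "u \<in> cc v \<Longrightarrow> cc u = cc v"
  using sym_adj sym_rtrancl[OF sym_adj] by (auto simp: cc_def dest: symD intro: rtrancl_trans)

lemma cc_nbr: "u \<in> S \<Longrightarrow> v \<in> S \<Longrightarrow> nbr T u v \<Longrightarrow> cc u = cc v"
  by (rule cc_eq[symmetric]) (auto simp: cc_def adj_induced intro: r_into_rtrancl)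

lemma S_cases:
  assumes v: "v \<in> S"
  obtains (leaf) "dg (nbr T) (verts T) v \<le> 1"
    | (path) "card (cc v) = l" "\<And>u. u \<in> cc v \<Longrightarrow> dg (nbr T) (verts T) u = 2"
proof -
  have "admissible_component l T (cc v)" by (rule adm[OF cc_component[OF v]])
  thus ?thesis unfolding admissible_component_def
  proof
    assume "\<exists>u. cc v = {u} \<and> degree T u \<le> 1"
    thus ?thesis using cc_refl[of v] leaf by (auto simp: degree_dg[OF sT])
  next
    assume p: "iso (path_graph l) (induced T (cc v)) \<and> (\<forall>u\<in>cc v. degree T u = 2)"
    then obtain f where "bij_betw f {..<l} (cc v)" by (auto simp: iso_def path_graph_def induced_def)
    hence "card (cc v) = l" using bij_betw_same_card by fastforce
    thus ?thesis using p path by (auto simp: degree_dg[OF sT])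
  qed
qed

lemma S_degree: "v \<in> S \<Longrightarrow> dg (nbr T) (verts T) v \<le> 2"
  by (rule S_cases[of v]) (use cc_refl in auto)

text \<open>A vertex \<open>x\<close> that is a leaf of the projection has two neighbours in \<open>Z\<close>. They are copies of the
  same vertex \<open>y\<close> of \<open>S\<close>, and \<open>Z\<close> contains the two copies of the path through \<open>y\<close>.\<close>

lemma blown_girth:
  assumes Z: "finite Z" "Z \<noteq> {}" and d: "\<And>z. z \<in> Z \<Longrightarrow> 2 \<le> dg jn Z z"
  shows "2 * l + 1 \<le> card Z"
proof -
  let ?P = "vt ` Z"
  have PT: "?P \<subseteq> verts T" using vt_in by auto
  have fP: "finite ?P" using Z by simp
  have "?P \<noteq> {}" using Z by simp
  then obtain x where x: "x \<in> ?P" "dg (nbr T) ?P x \<le> 1" using forest_leaf[OF forT _ PT] by blast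
  then obtain z where z: "z \<in> Z" "vt z = x" by auto
  obtain a b where ab: "a \<noteq> b" "a \<in> Z" "b \<in> Z" "jn z a" "jn z b" by (rule dg_ge_2D[OF d[OF z(1)]])
  define y where "y = vt a"
  have yb: "vt b = y"
    using dg_le_1D[OF x(2) fP, of "vt b" "vt a"] jn_nbr[OF ab(4)] jn_nbr[OF ab(5)] ab z by (auto simp: y_def)
  have cab: "cp a \<noteq> cp b" using ab(1) yb node_eqI[of a b] by (auto simp: y_def)
  have yS: "y \<in> S" using ab(4,5) cab yb by (auto simp: jn_def y_def)
  \<comment> \<open>For \<open>x\<close> in \<open>S\<close>, both \<open>a\<close> and
    \<open>b\<close> would have the index of \<open>z\<close>.\<close>
  have xS: "x \<notin> S" using ab(4,5) cab yb yS z by (auto simp: jn_def y_def)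
  have xy: "nbr T y x" using jn_nbr[OF ab(4)] z by (simp add: y_def insert_commute)
  show ?thesis
  proof (rule S_cases[OF yS])
    \<comment> \<open>A leaf \<open>y\<close> has only the neighbour \<open>x\<close>, of which a
      single copy has edges, so \<open>a\<close> cannot have two neighbours in
      \<open>Z\<close>.\<close>
    assume "dg (nbr T) (verts T) y \<le> 1"
    hence only: "v = x" if "nbr T y v" for v
      using dg_le_1D[of "nbr T" "verts T" y v x] finT that xy nbr_verts[OF sT] by blast
    obtain p q where pq: "p \<noteq> q" "p \<in> Z" "q \<in> Z" "jn a p" "jn a q" by (rule dg_ge_2D[OF d[OF ab(2)]])
    have "vt p = x" "vt q = x" using only jn_nbr[OF pq(4)] jn_nbr[OF pq(5)] by (auto simp: y_def)
    moreover have "cp p = 0" "cp q = 0" using pq(4,5) calculation xS by (auto simp: jn_def)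
    ultimately have "p = q" using node_eqI by metis
    thus ?thesis using pq by simp
  next
    assume c: "card (cc y) = l" and d2: "\<And>u. u \<in> cc y \<Longrightarrow> dg (nbr T) (verts T) u = 2"
    have ccS: "cc y \<subseteq> S" by (rule cc_subset[OF yS])
    have ccT: "cc y \<subseteq> verts T" using ccS S by auto
    \<comment> \<open>\<open>Z\<close> propagates along the component: a copy of a vertex of degree
      two has at most one neighbour over each of its two neighbours in \<open>T\<close>, so both
      must be in \<open>Z\<close>.\<close>
    have all: "nd u k \<in> Z" if "nd y k \<in> Z" "u \<in> cc y" for u k
    proof -
      have "(y, u) \<in> (adj (induced T S))\<^sup>*" using that by (simp add: cc_def)
      thus ?thesis
      proof (induction rule: rtrancl_induct)
        case (step c c')
        have cy: "c \<in> cc y" using step(1) by (simp add: cc_def)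
        have cS: "c \<in> S" "c \<in> verts T" using cy ccS ccT by auto
        have c': "c' \<in> S" "nbr T c c'" "c' \<in> verts T" using step(2) S by (auto simp: adj_induced)
        obtain p q where pq: "p \<noteq> q" "p \<in> Z" "q \<in> Z" "jn (nd c k) p" "jn (nd c k) q"
          by (rule dg_ge_2D[OF d[OF step(3)]])
        have n: "nbr T c (vt p)" "nbr T c (vt q)"
          using jn_nbr[OF pq(4)] jn_nbr[OF pq(5)] cS by (auto simp: vt_nd)
        have cpr: "cp r = (if vt r \<in> S then k else 0)" if "jn (nd c k) r" for r
          using that cS by (auto simp: jn_def vt_nd cp_nd)
        have "vt p \<noteq> vt q" using pq(1) cpr[OF pq(4)] cpr[OF pq(5)] node_eqI by metis
        have "c' = vt p \<or> c' = vt q"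
        proof (rule ccontr)
          assume "\<not> ?thesis"
          hence "3 \<le> dg (nbr T) (verts T) c"
            using \<open>vt p \<noteq> vt q\<close> n c' vt_in by (intro dg_ge_3[OF finT, of c' "vt p" "vt q"]) auto
          thus False using d2[OF cy] by simp
        qed
        then obtain r where r: "r \<in> Z" "jn (nd c k) r" "c' = vt r" using pq by blast
        have "nd c' k = r" using cpr[OF r(2)] r c' nd_vt_cp[of r] by auto
        thus ?case using r by simp
      qed (rule that)
    qed
    have aZ: "nd y (cp a) \<in> Z" "nd y (cp b) \<in> Z" using ab nd_vt_cp[of a] nd_vt_cp[of b] yb by (auto simp: y_def)
    let ?A = "(\<lambda>u. nd u (cp a)) ` cc y" and ?B = "(\<lambda>u. nd u (cp b)) ` cc y"
    have fcc: "finite (cc y)" using ccT finT finite_subset by blast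
    have injn: "inj_on (\<lambda>u. nd u k) (cc y)" for k
    proof (rule inj_onI)
      fix u w assume "u \<in> cc y" "w \<in> cc y" "nd u k = nd w k"
      thus "u = w" using vt_nd[of u k] vt_nd[of w k] ccT by auto
    qed
    have cpk: "cp p = k" and vtS: "vt p \<in> S" if "p \<in> (\<lambda>u. nd u k) ` cc y" for p k
    proof -
      obtain u where "p = nd u k" "u \<in> cc y" using \<open>p \<in> _\<close> by (rule imageE)
      moreover from this have "u \<in> S" "u \<in> verts T" using ccS ccT by auto
      ultimately show "cp p = k" "vt p \<in> S" by (simp_all add: cp_nd vt_nd)
    qed
    have "?A \<inter> ?B = {}"
    proof (rule ccontr)
      assume "?A \<inter> ?B \<noteq> {}"
      then obtain p where "p \<in> ?A" "p \<in> ?B" using ex_in_conv[of "?A \<inter> ?B"] by blast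
      thus False using cpk[of p "cp a"] cpk[of p "cp b"] cab by simp
    qed
    moreover have "z \<notin> ?A \<union> ?B" using vtS[of z "cp a"] vtS[of z "cp b"] z(2) xS by auto
    ultimately have "card (insert z (?A \<union> ?B)) = 2 * l + 1"
      using fcc c by (simp add: card_Un_disjoint card_image[OF injn])
    moreover have "insert z (?A \<union> ?B) \<subseteq> Z" using z all aZ by auto
    ultimately show ?thesis using card_mono[OF Z(1)] by metis
  qed
qed

lemma blown_no_even_cycles:
  assumes "K \<in> even_cycles l"
  shows "copies K (blown n) = {}"
proof (rule ccontr)
  obtain i where i: "K = cycle_graph (2 * i)" "2 \<le> i" "i \<le> l" using assms by (auto simp: even_cycles_def)
  assume "copies K (blown n) \<noteq> {}"
  then obtain H where H: "H \<in> copies (cycle_graph (2 * i)) (blown n)" using i by auto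
  have "3 \<le> 2 * i" using i by simp
  note c = cycle_copy_min_degree[OF H this]
  have "verts H \<noteq> {}" using c(2) i by auto
  moreover have "2 \<le> dg jn (verts H) z" if "z \<in> verts H" for z
  proof -
    have "card {y \<in> verts H. nbr (blown n) z y} \<le> card {y \<in> verts H. jn z y}"
      using c(1) by (intro card_mono) (auto simp: nbr_blown)
    thus ?thesis using c(4)[OF that] by (simp add: dg_def)
  qed
  ultimately have "2 * l + 1 \<le> card (verts H)" using blown_girth[OF c(1)] by blast
  thus False using c(2) i by simp
qed

text \<open>Columns are the depths in \<open>T\<close>, siblings are placed in the order of their
  parents, and the copies of a vertex are stacked. Rooting at a leaf leaves each vertex of
  \<open>S\<close> at most one child, as its degree is at most 2; stacked copies with edges to two
  different children would produce crossings.\<close>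

lemma blown_planar: "planar (blown n)"
proof -
  obtain r where r: "r \<in> verts T" "dg (nbr T) (verts T) r \<le> 1" using forT neT by (auto simp: forest_def)
  obtain par dep where "rooted (nbr T) (verts T) r par dep" by (rule rooted_exists[OF forT sconn_tree[OF T] r(1)])
  hence par: "\<And>v. v \<in> verts T \<Longrightarrow> v \<noteq> r \<Longrightarrow> par v \<in> verts T \<and> nbr T v (par v) \<and> dep v = Suc (dep (par v))"
    and edge: "\<And>u v. nbr T u v \<Longrightarrow> u \<noteq> r \<and> v = par u \<or> v \<noteq> r \<and> u = par v" and dr: "dep r = 0"
    unfolding rooted_def using nbr_verts[OF sT] by auto
  have child: "w \<noteq> r \<and> v = par w" if "nbr T v w" "dep w = Suc (dep v)" for v w
    using edge[OF that(1)] par[of v] nbr_verts[OF sT that(1)] that(2) by auto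
  \<comment> \<open>The codes along the path from the root, read as a number in base
    \<open>t\<close> with the root's digit first; so children inherit the order of their
    parents.\<close>
  define ord where "ord = rec_nat enc (\<lambda>_ f v. enc v + t * f (par v))"
  have ord: "ord 0 v = enc v" "ord (Suc k) v = enc v + t * ord k (par v)" for k v by (auto simp: ord_def)
  define Fo where "Fo v = ord (dep v) v" for v
  have Fom: "Fo v mod t = enc v" if "v \<in> verts T" for v
    using enc_less[OF that] by (cases "dep v") (auto simp: Fo_def ord)
  have Foi: "u = v" if "u \<in> verts T" "v \<in> verts T" "Fo u = Fo v" for u v
    using that Fom enc_inj by metis
  have Foc: "Fo w = enc w + t * Fo v" if "nbr T v w" "dep w = Suc (dep v)" for v w
    using child[OF that] that(2) by (simp add: Fo_def ord)
  have onechild: "w = w'" if v: "v \<in> S" "nbr T v w" "nbr T v w'" "dep w = Suc (dep v)" "dep w' = Suc (dep v)" for v w w'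
  proof (rule ccontr)
    assume ne: "w \<noteq> w'"
    have vT: "v \<in> verts T" "w \<in> verts T" "w' \<in> verts T" using nbr_verts[OF sT] v by auto
    show False
    proof (cases "v = r")
      case True
      have "2 \<le> dg (nbr T) (verts T) v" by (rule dg_ge_2[OF finT _ ne]) (use v vT in auto)
      thus False using r True by simp
    next
      case False
      have "3 \<le> dg (nbr T) (verts T) v"
        by (rule dg_ge_3[OF finT, of "par v" w w']) (use v vT ne par[OF vT(1) False] in auto)
      thus False using S_degree[OF v(1)] by simp
    qed
  qed
  have cpn: "cp x < n" if "x < n" for x using that by (simp add: cp_def le_less_trans[OF div_le_dividend])
  show ?thesis
  proof (rule layered_planar[OF simple_blown, of "\<lambda>x. dep (vt x)" "\<lambda>x. Fo (vt x) * n + cp x"])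
    show "inj_on (\<lambda>x. (dep (vt x), Fo (vt x) * n + cp x)) (verts (blown n))"
    proof (rule inj_onI)
      fix x y assume "x \<in> verts (blown n)" "y \<in> verts (blown n)"
        and eq: "(dep (vt x), Fo (vt x) * n + cp x) = (dep (vt y), Fo (vt y) * n + cp y)"
      hence xy: "x < n" "y < n" by (auto simp: blown_def)
      have "(Fo (vt x) * n + cp x) div n = Fo (vt x)" "(Fo (vt y) * n + cp y) div n = Fo (vt y)"
        using cpn xy by auto
      hence "Fo (vt x) = Fo (vt y)" "cp x = cp y" using eq by auto
      thus "x = y" using Foi vt_in node_eqI by blast
    qed
    show "dep (vt y) = Suc (dep (vt x)) \<or> dep (vt x) = Suc (dep (vt y))" if "nbr (blown n) x y" for x y
    proof -
      have e: "nbr T (vt x) (vt y)" using that jn_nbr by (simp add: nbr_blown)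
      show ?thesis using edge[OF e] par vt_in by metis
    qed
    fix x y x' y'
    assume "nbr (blown n) x y" "nbr (blown n) x' y'"
      and dep: "dep (vt y) = Suc (dep (vt x))" "dep (vt y') = Suc (dep (vt x'))" "dep (vt x) = dep (vt x')"
    hence j: "jn x y" "jn x' y'" and lt: "x < n" "y < n" "x' < n" "y' < n" by (auto simp: nbr_blown)
    have nn: "nbr T (vt x) (vt y)" "nbr T (vt x') (vt y')" using j jn_nbr by auto
    have big: "Fo u * n + cp p \<le> Fo v * n + cp q" if "Fo u < Fo v" "p < n" for u v p q
    proof -
      have "Fo u * n + n \<le> Fo v * n" using that(1) by (metis Suc_leI add.commute mult_Suc mult_le_mono1)
      thus ?thesis using cpn[OF that(2)] by linarith
    qed
    have up: "Fo u < Fo v" if "Fo a < Fo b" "nbr T a u" "nbr T b v" "dep u = Suc (dep a)" "dep v = Suc (dep b)" for a b u v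
    proof -
      have "enc u < t" using nbr_verts[OF sT that(2)] enc_less by auto
      moreover have "t * Fo a + t \<le> t * Fo b" using that(1) by (metis Suc_leI add.commute mult_Suc_right mult_le_mono2)
      ultimately show ?thesis using Foc[OF that(2,4)] Foc[OF that(3,5)] by linarith
    qed
    let ?Y = "\<lambda>x. Fo (vt x) * n + cp x"
    consider "Fo (vt x) < Fo (vt x')" | "Fo (vt x') < Fo (vt x)" | "vt x = vt x'"
      using Foi vt_in by (metis linorder_neqE_nat)
    thus "?Y x \<le> ?Y x' \<and> ?Y y \<le> ?Y y' \<or> ?Y x' \<le> ?Y x \<and> ?Y y' \<le> ?Y y"
    proof cases
      case 1
      thus ?thesis using big up[OF 1 nn dep(1,2)] lt by blast
    next
      case 2
      thus ?thesis using big up[OF 2 nn(2,1) dep(2,1)] lt by blast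
    next
      case 3
      show ?thesis
      proof (cases "vt y = vt y'")
        case True
        \<comment> \<open>For two copies of one edge of \<open>T\<close>, either both ends carry
          equal indices or one end has index 0 in both copies.\<close>
        have "cp x \<le> cp x' \<and> cp y \<le> cp y' \<or> cp x' \<le> cp x \<and> cp y' \<le> cp y"
          using j 3 True unfolding jn_def by (metis le_cases le0)
        thus ?thesis using 3 True by auto
      next
        case False
        \<comment> \<open>With two children, \<open>vt x\<close> is not multiplied, so both edges
          start at the same point.\<close>
        have "vt x \<notin> S" using onechild[of "vt x" "vt y" "vt y'"] nn 3 dep False by auto
        hence "cp x = 0" "cp x' = 0" using j 3 by (auto simp: jn_def)
        hence eq: "?Y x = ?Y x'" using 3 by simp
        have "?Y y \<le> ?Y y' \<or> ?Y y' \<le> ?Y y" by linarith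
        thus ?thesis using eq by auto
      qed
    qed
  qed
qed

text \<open>An index below \<open>n div t\<close> is chosen for each component independently. As
  \<open>vt\<close> inverts every such embedding, distinct choices give distinct subgraphs and not
  only distinct embeddings.\<close>

lemma blown_copies:
  assumes n: "t \<le> n"
  shows "(n div t) ^ card (components (induced T S)) \<le> card (copies T (blown n))"
proof -
  let ?F = "components (induced T S)" and ?m = "n div t"
  have fS: "finite S" using S finT finite_subset by blast
  have "?F = cc ` S" using component_cc cc_component by auto
  hence fF: "finite ?F" using fS by simp
  define h where "h \<phi> v = nd v (if v \<in> S then \<phi> (cc v) else 0)" for \<phi> :: "'a set \<Rightarrow> nat" and v
  have vh: "vt (h \<phi> v) = v" if "v \<in> verts T" for \<phi> v using vt_nd[OF that] by (simp add: h_def)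
  have ch: "cp (h \<phi> v) = (if v \<in> S then \<phi> (cc v) else 0)" if "v \<in> verts T" for \<phi> v
    using cp_nd[OF that] by (simp add: h_def)
  have injh: "inj_on (h \<phi>) (verts T)" for \<phi> using vh by (metis inj_onI)
  define K where "K \<phi> = (h \<phi> ` verts T, (\<lambda>e. h \<phi> ` e) ` edges T)" for \<phi>
  have "K \<phi> \<in> copies T (blown n)" if \<phi>: "\<phi> \<in> ?F \<rightarrow>\<^sub>E {..<?m}" for \<phi>
  proof -
    have lt: "h \<phi> v < n" if v: "v \<in> verts T" for v
    proof (cases "v \<in> S")
      case True
      have "\<phi> (cc v) < ?m" using \<phi> cc_component[OF True] by auto
      hence "t * \<phi> (cc v) + t \<le> t * ?m" by (metis Suc_leI add.commute mult_Suc_right mult_le_mono2)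
      also have "\<dots> \<le> n" by simp
      finally show ?thesis using enc_less[OF v] True by (simp add: h_def nd_def)
    next
      case False
      thus ?thesis using enc_less[OF v] n by (simp add: h_def nd_def)
    qed
    have nb: "nbr (blown n) (h \<phi> u) (h \<phi> v)" if uv: "nbr T u v" for u v
    proof -
      have "u \<in> verts T" "v \<in> verts T" using nbr_verts[OF sT uv] by auto
      thus ?thesis using lt uv cc_nbr by (auto simp: nbr_blown jn_def vh ch)
    qed
    have ee: "h \<phi> ` e \<in> edges (blown n) \<and> e \<subseteq> verts T \<and> card e = 2" if e: "e \<in> edges T" for e
    proof -
      have "e \<subseteq> verts T" "card e = 2" using e sT by (auto simp: simple_graph_def)
      then obtain u v where "e = {u, v}" by (auto simp: card_2_iff)
      thus ?thesis using nb[of u v] e \<open>e \<subseteq> verts T\<close> \<open>card e = 2\<close> by auto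
    qed
    have "card (h \<phi> ` e) = 2" if "e \<in> edges T" for e
      using ee[OF that] card_image[OF inj_on_subset[OF injh]] by auto
    hence "simple_graph (K \<phi>)" using ee finT by (auto simp: simple_graph_def K_def)
    hence "subgraph (K \<phi>) (blown n)" using ee lt by (auto simp: subgraph_def K_def) (auto simp: blown_def)
    moreover have "iso T (K \<phi>)" unfolding iso_def using injh by (intro exI[of _ "h \<phi>"]) (auto simp: K_def bij_betw_def)
    ultimately show ?thesis by (simp add: copies_def)
  qed
  hence sub: "K ` (?F \<rightarrow>\<^sub>E {..<?m}) \<subseteq> copies T (blown n)" by auto
  have "inj_on K (?F \<rightarrow>\<^sub>E {..<?m})"
  proof (rule inj_onI)
    fix \<phi> \<psi> assume p: "\<phi> \<in> ?F \<rightarrow>\<^sub>E {..<?m}" "\<psi> \<in> ?F \<rightarrow>\<^sub>E {..<?m}" "K \<phi> = K \<psi>"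
    show "\<phi> = \<psi>"
    proof (rule PiE_ext[OF p(1,2)])
      fix C assume "C \<in> ?F"
      then obtain v where v: "v \<in> S" "C = cc v" using component_cc by auto
      have vT: "v \<in> verts T" using v S by auto
      have "h \<phi> v \<in> h \<psi> ` verts T" using p(3) vT by (auto simp: K_def)
      then obtain u where u: "u \<in> verts T" "h \<phi> v = h \<psi> u" by auto
      have "v = u" using vh[OF vT, of \<phi>] vh[OF u(1), of \<psi>] u(2) by simp
      thus "\<phi> C = \<psi> C" using ch[OF vT, of \<phi>] ch[OF vT, of \<psi>] u(2) v by simp
    qed
  qed
  moreover have "finite (copies T (blown n))"
    by (rule finite_subset[of _ "Pow {..<n} \<times> Pow (Pow {..<n})"])
      (auto simp: copies_def subgraph_def blown_def simple_graph_def)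
  ultimately have "card (?F \<rightarrow>\<^sub>E {..<?m}) \<le> card (copies T (blown n))" using sub card_inj_on_le by blast
  thus ?thesis using fF by (simp add: card_PiE)
qed

end

section \<open>Generalized planar Turan numbers\<close>

lemma finite_ex_planar_set:
  "finite {card (copies H G) | G :: nat graph.
     simple_graph G \<and> card (verts G) = n \<and> planar G \<and> (\<forall>K\<in>F. copies K G = {})}"
proof (rule finite_subset)
  show "{card (copies H G) | G :: nat graph. simple_graph G \<and> card (verts G) = n \<and> planar G \<and>
      (\<forall>K\<in>F. copies K G = {})} \<subseteq> {..2 ^ n * 2 ^ 2 ^ n}"
  proof (intro subsetI)
    fix k assume "k \<in> {card (copies H G) | G :: nat graph. simple_graph G \<and> card (verts G) = n \<and> planar G \<and>
      (\<forall>K\<in>F. copies K G = {})}"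
    then obtain G :: "nat graph" where k: "k = card (copies H G)" and G: "simple_graph G" "card (verts G) = n" by blast
    have fin: "finite (verts G)" using G by (simp add: simple_graph_def)
    have "copies H G \<subseteq> Pow (verts G) \<times> Pow (Pow (verts G))"
      by (auto simp: copies_def subgraph_def simple_graph_def) blast
    hence "card (copies H G) \<le> card (Pow (verts G) \<times> Pow (Pow (verts G)))"
      by (rule card_mono[rotated]) (simp add: fin)
    thus "k \<in> {..2 ^ n * 2 ^ 2 ^ n}" using k G(2) fin by (simp add: card_cartesian_product card_Pow)
  qed
qed simp

text \<open>Shows that the maximum in \<open>ex_planar\<close> is taken over a nonempty set, as
  bounding it from above requires.\<close>

lemma empty_graph_even_cycles:
  fixes n :: nat
  defines "G \<equiv> ({..<n}, {}) :: nat graph"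
  shows "simple_graph G \<and> card (verts G) = n \<and> planar G \<and> (\<forall>K\<in>even_cycles l. copies K G = {})"
proof (intro conjI ballI)
  show "simple_graph G" "card (verts G) = n" by (auto simp: G_def simple_graph_def)
  have "plane_drawing G of_nat (\<lambda>_ _. 0)" by (auto simp: plane_drawing_def G_def inj_on_def)
  thus "planar G" unfolding planar_def by blast
  fix K assume "K \<in> even_cycles l"
  then obtain i where i: "K = cycle_graph (2 * i)" "2 \<le> i" by (auto simp: even_cycles_def)
  have "{0, Suc 0 mod (2 * i)} \<in> edges K" using i by (auto simp: cycle_graph_def)
  hence "edges K \<noteq> {}" by blast
  thus "copies K G = {}" by (auto simp: copies_def subgraph_def iso_def G_def)
qed

lemma ex_planar_le:
  assumes "\<And>G :: nat graph. simple_graph G \<Longrightarrow> card (verts G) = n \<Longrightarrow> planar G \<Longrightarrow>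
    \<forall>K\<in>even_cycles l. copies K G = {} \<Longrightarrow> card (copies H G) \<le> B"
  shows "ex_planar n H (even_cycles l) \<le> B"
  unfolding ex_planar_def
proof (rule Max.boundedI[OF finite_ex_planar_set])
  show "{card (copies H G) | G :: nat graph. simple_graph G \<and> card (verts G) = n \<and> planar G \<and>
      (\<forall>K\<in>even_cycles l. copies K G = {})} \<noteq> {}"
    using empty_graph_even_cycles[of n l] by blast
  fix k assume "k \<in> {card (copies H G) | G :: nat graph. simple_graph G \<and> card (verts G) = n \<and> planar G \<and>
      (\<forall>K\<in>even_cycles l. copies K G = {})}"
  then obtain G :: "nat graph" where "k = card (copies H G)" "simple_graph G" "card (verts G) = n" "planar G"
    "\<forall>K\<in>even_cycles l. copies K G = {}" by blast
  thus "k \<le> B" using assms by simp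
qed

lemma ex_planar_ge:
  fixes G :: "nat graph"
  assumes "simple_graph G" "card (verts G) = n" "planar G" "\<forall>K\<in>F. copies K G = {}"
  shows "card (copies H G) \<le> ex_planar n H F"
  unfolding ex_planar_def by (rule Max_ge[OF finite_ex_planar_set]) (use assms in blast)

lemma ex_planar_lower_bound:
  assumes T: "tree T" and n: "card (verts T) \<le> n"
  shows "(n div card (verts T)) ^ beta l T \<le> ex_planar n T (even_cycles l)"
proof -
  have fin: "finite (verts T)" using T by (simp add: tree_def simple_graph_def)
  let ?M = "{card (components (induced T S)) | S.
     S \<subseteq> verts T \<and> (\<forall>C\<in>components (induced T S). admissible_component l T C)}"
  have "0 \<in> ?M" by (intro CollectI exI[of _ "{}"]) (auto simp: components_def induced_def)
  hence "?M \<noteq> {}" by blast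
  from Max_in[OF finite_beta_set[OF fin] this] obtain S where
    W: "S \<subseteq> verts T" "\<And>C. C \<in> components (induced T S) \<Longrightarrow> admissible_component l T C"
      "beta l T = card (components (induced T S))" unfolding beta_def by auto
  obtain enc where e: "bij_betw enc (verts T) {0..<card (verts T)}"
    using ex_bij_betw_finite_nat[OF fin] by auto
  interpret blow_up T S l enc "card (verts T)"
  proof
    show "tree T" by (rule T)
    show "S \<subseteq> verts T" by (rule W(1))
    show "admissible_component l T C" if "C \<in> components (induced T S)" for C by (rule W(2)[OF that])
    show "bij_betw enc (verts T) {..<card (verts T)}" using e by (simp only: atLeast0LessThan)
  qed
  have "(n div card (verts T)) ^ beta l T \<le> card (copies T (blown n))"
    unfolding W(3) by (rule blown_copies[OF n])
  also have "\<dots> \<le> ex_planar n T (even_cycles l)"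
  proof (rule ex_planar_ge[OF simple_blown _ blown_planar])
    show "card (verts (blown n)) = n" by (simp add: blown_def)
    show "\<forall>K\<in>even_cycles l. copies K (blown n) = {}" using blown_no_even_cycles by blast
  qed
  finally show ?thesis .
qed

theorem theorem2p7:
  fixes l :: nat and T :: "'a graph"
  assumes "l \<ge> 1" and "tree T"
  shows "(\<lambda>n. real (ex_planar n T (even_cycles l))) \<in> \<Theta>(\<lambda>n. real n ^ beta l T)"
proof (rule bigthetaI)
  define t where "t = card (verts T)"
  have t: "0 < t" using assms(2) by (auto simp: t_def tree_def connected_graph_def simple_graph_def card_gt_0_iff)
  define c where "c = t ^ t * 5277 ^ card {(u, v). nbr T u v}"
  have "ex_planar n T (even_cycles l) \<le> c * n ^ beta l T" for n
  proof (rule ex_planar_le)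
    fix G :: "nat graph"
    assume G: "simple_graph G" "card (verts G) = n" "planar G" "\<forall>K\<in>even_cycles l. copies K G = {}"
    show "card (copies T G) \<le> c * n ^ beta l T"
      using copies_upper_bound[OF assms(2) G(1,3,4) assms(1)] G(2) by (simp add: c_def t_def mult.assoc)
  qed
  hence "real (ex_planar n T (even_cycles l)) \<le> real c * real n ^ beta l T" for n
    by (metis of_nat_le_iff of_nat_mult of_nat_power)
  thus "(\<lambda>n. real (ex_planar n T (even_cycles l))) \<in> O(\<lambda>n. real n ^ beta l T)"
    by (intro bigoI[where c = "real c"] always_eventually) auto
  have "norm (real n ^ beta l T) \<le> (2 * real t) ^ beta l T * norm (real (ex_planar n T (even_cycles l)))"
    if n: "t \<le> n" for n
  proof -
    \<comment> \<open>For \<open>n \<ge> t\<close>, rounding \<open>n / t\<close> down loses at most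
      a factor 2; hence the constant \<open>(2 * real t) ^ beta l T\<close>.\<close>
    have "n < t * Suc (n div t)" using dividend_less_times_div[OF t] by simp
    moreover have "1 \<le> n div t" using n t by (simp add: Suc_le_eq div_greater_zero_iff)
    hence "t * Suc (n div t) \<le> 2 * t * (n div t)" by simp
    ultimately have "n \<le> 2 * t * (n div t)" by linarith
    hence "real n \<le> real (2 * t * (n div t))" by (simp only: of_nat_le_iff)
    hence "real n \<le> 2 * real t * real (n div t)" by simp
    hence "real n ^ beta l T \<le> (2 * real t * real (n div t)) ^ beta l T" by (rule power_mono) simp
    also have "\<dots> = (2 * real t) ^ beta l T * real ((n div t) ^ beta l T)"
      by (simp only: power_mult_distrib of_nat_power)
    also have "\<dots> \<le> (2 * real t) ^ beta l T * real (ex_planar n T (even_cycles l))"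
      using ex_planar_lower_bound[OF assms(2), of n l] n
      by (intro mult_left_mono) (auto simp: t_def simp flip: of_nat_power)
    finally show ?thesis by simp
  qed
  thus "(\<lambda>n. real (ex_planar n T (even_cycles l))) \<in> \<Omega>(\<lambda>n. real n ^ beta l T)"
    unfolding bigomega_iff_bigo
    by (intro bigoI[where c = "(2 * real t) ^ beta l T"] eventually_at_top_linorderI[of t])
qed

end
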